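(* Let $\mathbb R^3_+=\{(x_1,x_2,x_3):x_1\ge 0\}$, let $\theta\in(0,\pi)$, and suppose $\Sigma^2\subset\mathbb R^3_+$ is a properly immersed, two-sided capillary minimal surface with constant contact angle $\theta$. Suppose also that $\Sigma$ has Euclidean area growth, that is, there exists some $C>0$ such that $\mathrm{Area}(\Sigma\cap B_r(0))<Cr^2$ for any $r>0$, and that $\Sigma$ is stable for the capillary functional. Then $\Sigma$ is planar (its second fundamental form vanishes identically).
   Context: $\bar\eta=-e_1$ is the outward unit normal of $\partial\mathbb R^3_+$. A capillary minimal surface with contact angle $\theta$ is a smooth immersed two-sided surface $\Sigma\subset\mathbb R^3_+$ with $\partial\Sigma\subset\partial\mathbb R^3_+$, with zero mean curvature, and with a unit normal $\nu$ satisfying $\langle\nu,\bar\eta\rangle=\cos\theta$ along $\partial\Sigma$. Let $\eta$ be the outward unit conormal of $\partial\Sigma$ in $\Sigma$ and $A(X,Y)=\langle\nabla_X\nu,Y\rangle$ the second fundamental form. $\Sigma$ is stable (for the capillary functional) if for all compactly supported $f\in C^2(\Sigma)$ (not required to vanish on $\partial\Sigma$) $$-\int_\Sigma \big(f\Delta f+|A|^2f^2\big)+\int_{\partial\Sigma}f\Big(\frac{\partial f}{\partial\eta}-Qf\Big)\ge 0,\qquad Q=-\cot\theta\,A(\eta,\eta).$$ *)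

theory Defs
  imports "HOL-Analysis.Analysis" "HOL-Library.Extended_Nat"
begin

section \<open>Differentiability classes up to the boundary of the half-plane\<close>

fun higher_differentiable_on ::
    "'v::real_normed_vector set \<Rightarrow> ('v \<Rightarrow> 'w::real_normed_vector) \<Rightarrow> nat \<Rightarrow> bool" where
  "higher_differentiable_on W f 0 \<longleftrightarrow> continuous_on W f"
| "higher_differentiable_on W f (Suc n) \<longleftrightarrow>
     (\<forall>x\<in>W. f differentiable (at x)) \<and>
     (\<forall>v. higher_differentiable_on W (\<lambda>x. frechet_derivative f (at x) v) n)"

text \<open>Meant for open \<open>W\<close>; \<open>k = \<infinity>\<close> means smooth.\<close>

definition Ck_on :: "enat \<Rightarrow> ('v::real_normed_vector \<Rightarrow> 'w::real_normed_vector) \<Rightarrow> 'v set \<Rightarrow> bool" where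
  "Ck_on k f W \<longleftrightarrow> (\<forall>n. enat n \<le> k \<longrightarrow> higher_differentiable_on W f n)"

definition halfplane :: "(real ^ 2) set" where
  "halfplane = {p. 0 \<le> p $ 1}"

text \<open>On a relatively open subset \<open>U\<close> of the half-plane, a map is of class \<open>C\<^sup>k\<close> (up to the
  boundary) if it extends, locally around each point of \<open>U\<close>, to a \<open>C\<^sup>k\<close> map on an open subset
  of the plane.\<close>

definition Ck_half :: "enat \<Rightarrow> (real ^ 2 \<Rightarrow> 'w::real_normed_vector) \<Rightarrow> (real ^ 2) set \<Rightarrow> bool" where
  "Ck_half k h U \<longleftrightarrow>
     (\<forall>p\<in>U. \<exists>W g. open W \<and> p \<in> W \<and> Ck_on k g W \<and> (\<forall>q\<in>U \<inter> W. g q = h q))"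

text \<open>The derivative relative to the half-plane: at edge points it is one-sided in the first
  variable, hence equal to the derivative of any \<open>C\<^sup>1\<close> extension.\<close>

definition D_half :: "(real ^ 2 \<Rightarrow> 'w::real_normed_vector) \<Rightarrow> real ^ 2 \<Rightarrow> real ^ 2 \<Rightarrow> 'w" where
  "D_half h p = frechet_derivative h (at p within halfplane)"


section \<open>Smooth surfaces with boundary\<close>

text \<open>A surface is given by an atlas of local parametrizations \<open>(U, \<phi>)\<close>, with \<open>U\<close> relatively open
  in the half-plane. Its points are those covered by the atlas, with the subspace topology of the
  ambient (Hausdorff, second countable) type.\<close>

type_synonym 'a param = "(real ^ 2) set \<times> (real ^ 2 \<Rightarrow> 'a)"

definition points :: "'a param set \<Rightarrow> 'a set" where
  "points \<A> = (\<Union>(U, \<phi>)\<in>\<A>. \<phi> ` U)"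

definition bdry :: "'a param set \<Rightarrow> 'a set" where
  "bdry \<A> = (\<Union>(U, \<phi>)\<in>\<A>. \<phi> ` {p \<in> U. p $ 1 = 0})"

definition smooth_surface :: "'a::{t2_space, second_countable_topology} param set \<Rightarrow> bool" where
  "smooth_surface \<A> \<longleftrightarrow>
     (\<forall>(U, \<phi>)\<in>\<A>. openin (top_of_set halfplane) U \<and>
        openin (top_of_set (points \<A>)) (\<phi> ` U) \<and>
        homeomorphism U (\<phi> ` U) \<phi> (inv_into U \<phi>)) \<and>
     (\<forall>(U, \<phi>)\<in>\<A>. \<forall>(V, \<psi>)\<in>\<A>.
        Ck_half \<infinity> (\<lambda>p. inv_into V \<psi> (\<phi> p)) {p \<in> U. \<phi> p \<in> \<psi> ` V})"

definition Ck_fun :: "enat \<Rightarrow> 'a param set \<Rightarrow> ('a \<Rightarrow> 'w::real_normed_vector) \<Rightarrow> bool" where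
  "Ck_fun k \<A> f \<longleftrightarrow> (\<forall>(U, \<phi>)\<in>\<A>. Ck_half k (\<lambda>p. f (\<phi> p)) U)"

definition compactly_supported ::
    "'a::topological_space param set \<Rightarrow> ('a \<Rightarrow> real) \<Rightarrow> bool" where
  "compactly_supported \<A> f \<longleftrightarrow> (\<exists>K. compact K \<and> K \<subseteq> points \<A> \<and> (\<forall>x\<in>points \<A> - K. f x = 0))"

text \<open>The value at a point \<open>x\<close> of a quantity \<open>q \<phi> p\<close> that is computed in a parametrization \<open>\<phi>\<close>
  at \<open>p\<close> with \<open>\<phi> p = x\<close>; meaningful for quantities that do not depend on the parametrization.\<close>

definition invariant_value :: "'a param set \<Rightarrow> ((real ^ 2 \<Rightarrow> 'a) \<Rightarrow> real ^ 2 \<Rightarrow> 'b) \<Rightarrow> 'a \<Rightarrow> 'b" where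
  "invariant_value \<A> q x = (THE y. \<forall>(U, \<phi>)\<in>\<A>. \<forall>p\<in>U. \<phi> p = x \<longrightarrow> q \<phi> p = y)"

text \<open>The unique Borel measure on the surface that is given by \<open>m (U, \<phi>)\<close> on the Borel subsets
  of each \<open>\<phi> ` U\<close>.\<close>

definition glued_measure ::
    "'a::topological_space param set \<Rightarrow> ('a param \<Rightarrow> 'a set \<Rightarrow> ennreal) \<Rightarrow> 'a measure" where
  "glued_measure \<A> m =
     (THE \<mu>. sets \<mu> = sets (restrict_space borel (points \<A>)) \<and>
        (\<forall>(U, \<phi>)\<in>\<A>. \<forall>B\<in>sets \<mu>. B \<subseteq> \<phi> ` U \<longrightarrow> emeasure \<mu> B = m (U, \<phi>) B))"


section \<open>Local geometry of an immersion\<close>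

text \<open>Here \<open>X\<close> is a parametrized piece of surface in space, \<open>N\<close> its unit normal and \<open>u\<close> a function,
  all in the same coordinates.\<close>

definition gram :: "(real ^ 2 \<Rightarrow> real ^ 3) \<Rightarrow> real ^ 2 \<Rightarrow> real ^ 2 ^ 2" where
  "gram X p = (\<chi> i j. D_half X p (axis i 1) \<bullet> D_half X p (axis j 1))"

text \<open>The second fundamental form \<open>A(Y, Z) = \<langle>\<nabla>\<^sub>Y \<nu>, Z\<rangle>\<close> on the tangent vectors \<open>Y = dX(a)\<close>,
  \<open>Z = dX(b)\<close>.\<close>

definition sff ::
    "(real ^ 2 \<Rightarrow> real ^ 3) \<Rightarrow> (real ^ 2 \<Rightarrow> real ^ 3) \<Rightarrow> real ^ 2 \<Rightarrow> real ^ 2 \<Rightarrow> real ^ 2 \<Rightarrow> real" where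
  "sff X N p a b = D_half N p a \<bullet> D_half X p b"

definition mean_curvature ::
    "(real ^ 2 \<Rightarrow> real ^ 3) \<Rightarrow> (real ^ 2 \<Rightarrow> real ^ 3) \<Rightarrow> real ^ 2 \<Rightarrow> real" where
  "mean_curvature X N p =
     (\<Sum>i\<in>UNIV. \<Sum>j\<in>UNIV. matrix_inv (gram X p) $ i $ j * sff X N p (axis i 1) (axis j 1))"

definition sff_norm_sq ::
    "(real ^ 2 \<Rightarrow> real ^ 3) \<Rightarrow> (real ^ 2 \<Rightarrow> real ^ 3) \<Rightarrow> real ^ 2 \<Rightarrow> real" where
  "sff_norm_sq X N p =
     (let G = matrix_inv (gram X p) in
      \<Sum>i\<in>UNIV. \<Sum>j\<in>UNIV. \<Sum>k\<in>UNIV. \<Sum>l\<in>UNIV.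
        G $ i $ k * G $ j $ l * sff X N p (axis i 1) (axis j 1) * sff X N p (axis k 1) (axis l 1))"

definition laplace_beltrami ::
    "(real ^ 2 \<Rightarrow> real ^ 3) \<Rightarrow> (real ^ 2 \<Rightarrow> real) \<Rightarrow> real ^ 2 \<Rightarrow> real" where
  "laplace_beltrami X u p =
     (1 / sqrt (det (gram X p))) *
     (\<Sum>i\<in>UNIV. D_half
        (\<lambda>q. sqrt (det (gram X q)) *
             (\<Sum>j\<in>UNIV. matrix_inv (gram X q) $ i $ j * D_half u q (axis j 1)))
        p (axis i 1))"

text \<open>Coordinates of the outward unit conormal at an edge point: the edge is tangent to the second
  axis, and the surface lies on the side of the positive first axis.\<close>

definition conormal :: "(real ^ 2 \<Rightarrow> real ^ 3) \<Rightarrow> real ^ 2 \<Rightarrow> real ^ 2" where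
  "conormal X p =
     (THE a. norm (D_half X p a) = 1 \<and> D_half X p a \<bullet> D_half X p (axis 2 1) = 0 \<and> a $ 1 < 0)"


section \<open>Immersed surfaces with a unit normal field\<close>

text \<open>\<open>F\<close> is the immersion and \<open>\<nu>\<close> a unit normal field along it.\<close>

definition immersed_two_sided ::
    "'a::{t2_space, second_countable_topology} param set \<Rightarrow> ('a \<Rightarrow> real ^ 3) \<Rightarrow> ('a \<Rightarrow> real ^ 3) \<Rightarrow> bool"
  where
  "immersed_two_sided \<A> F \<nu> \<longleftrightarrow>
     smooth_surface \<A> \<and> Ck_fun \<infinity> \<A> F \<and> Ck_fun \<infinity> \<A> \<nu> \<and>
     (\<forall>x\<in>points \<A>. norm (\<nu> x) = 1) \<and>
     (\<forall>(U, \<phi>)\<in>\<A>. \<forall>p\<in>U. inj (D_half (\<lambda>q. F (\<phi> q)) p) \<and>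
        (\<forall>a. \<nu> (\<phi> p) \<bullet> D_half (\<lambda>q. F (\<phi> q)) p a = 0))"

definition area_measure ::
    "'a::topological_space param set \<Rightarrow> ('a \<Rightarrow> real ^ 3) \<Rightarrow> 'a measure" where
  "area_measure \<A> F = glued_measure \<A> (\<lambda>(U, \<phi>) B.
     \<integral>\<^sup>+p. ennreal (sqrt (det (gram (\<lambda>q. F (\<phi> q)) p))) * indicator {p \<in> U. \<phi> p \<in> B} p \<partial>lborel)"

text \<open>Arc length along the boundary, as a measure on the whole surface that is concentrated on
  \<open>bdry \<A>\<close>.\<close>

definition bdry_measure ::
    "'a::topological_space param set \<Rightarrow> ('a \<Rightarrow> real ^ 3) \<Rightarrow> 'a measure" where
  "bdry_measure \<A> F = glued_measure \<A> (\<lambda>(U, \<phi>) B.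
     \<integral>\<^sup>+t. ennreal (norm (D_half (\<lambda>q. F (\<phi> q)) (vector [0, t]) (axis 2 1))) *
          indicator {t. vector [0, t] \<in> U \<and> \<phi> (vector [0, t]) \<in> B} t \<partial>lborel)"

definition Laplacian :: "'a param set \<Rightarrow> ('a \<Rightarrow> real ^ 3) \<Rightarrow> ('a \<Rightarrow> real) \<Rightarrow> 'a \<Rightarrow> real" where
  "Laplacian \<A> F f =
     invariant_value \<A> (\<lambda>\<phi>. laplace_beltrami (\<lambda>q. F (\<phi> q)) (\<lambda>q. f (\<phi> q)))"

definition A_norm_sq ::
    "'a param set \<Rightarrow> ('a \<Rightarrow> real ^ 3) \<Rightarrow> ('a \<Rightarrow> real ^ 3) \<Rightarrow> 'a \<Rightarrow> real" where
  "A_norm_sq \<A> F \<nu> =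
     invariant_value \<A> (\<lambda>\<phi>. sff_norm_sq (\<lambda>q. F (\<phi> q)) (\<lambda>q. \<nu> (\<phi> q)))"

text \<open>The next two, \<open>\<partial>f/\<partial>\<eta>\<close> and \<open>A(\<eta>, \<eta>)\<close>, are meaningful at boundary points only.\<close>

definition conormal_deriv :: "'a param set \<Rightarrow> ('a \<Rightarrow> real ^ 3) \<Rightarrow> ('a \<Rightarrow> real) \<Rightarrow> 'a \<Rightarrow> real" where
  "conormal_deriv \<A> F f =
     invariant_value \<A> (\<lambda>\<phi> p. D_half (\<lambda>q. f (\<phi> q)) p (conormal (\<lambda>q. F (\<phi> q)) p))"

definition A_conormal ::
    "'a param set \<Rightarrow> ('a \<Rightarrow> real ^ 3) \<Rightarrow> ('a \<Rightarrow> real ^ 3) \<Rightarrow> 'a \<Rightarrow> real" where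
  "A_conormal \<A> F \<nu> =
     invariant_value \<A> (\<lambda>\<phi> p. let \<eta> = conormal (\<lambda>q. F (\<phi> q)) p
       in sff (\<lambda>q. F (\<phi> q)) (\<lambda>q. \<nu> (\<phi> q)) p \<eta> \<eta>)"

definition properly_immersed ::
    "'a::topological_space param set \<Rightarrow> ('a \<Rightarrow> real ^ 3) \<Rightarrow> bool" where
  "properly_immersed \<A> F \<longleftrightarrow> (\<forall>K. compact K \<longrightarrow> compact {x \<in> points \<A>. F x \<in> K})"

text \<open>Area is counted with multiplicity.\<close>

definition euclidean_area_growth ::
    "'a::topological_space param set \<Rightarrow> ('a \<Rightarrow> real ^ 3) \<Rightarrow> bool" where
  "euclidean_area_growth \<A> F \<longleftrightarrow>
     (\<exists>C>0. \<forall>r>0. emeasure (area_measure \<A> F) {x \<in> points \<A>. F x \<in> ball 0 r} < ennreal (C * r\<^sup>2))"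

definition sff_vanishes ::
    "'a param set \<Rightarrow> ('a \<Rightarrow> real ^ 3) \<Rightarrow> ('a \<Rightarrow> real ^ 3) \<Rightarrow> bool" where
  "sff_vanishes \<A> F \<nu> \<longleftrightarrow>
     (\<forall>(U, \<phi>)\<in>\<A>. \<forall>p\<in>U. \<forall>a b. sff (\<lambda>q. F (\<phi> q)) (\<lambda>q. \<nu> (\<phi> q)) p a b = 0)"


section \<open>Capillary surfaces in the half-space\<close>

definition halfspace :: "(real ^ 3) set" where
  "halfspace = {x. 0 \<le> x $ 1}"

definition eta_bar :: "real ^ 3" where
  "eta_bar = - axis 1 1"

definition capillary_minimal_surface ::
    "real \<Rightarrow> 'a::{t2_space, second_countable_topology} param set \<Rightarrow>
       ('a \<Rightarrow> real ^ 3) \<Rightarrow> ('a \<Rightarrow> real ^ 3) \<Rightarrow> bool" where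
  "capillary_minimal_surface \<theta> \<A> F \<nu> \<longleftrightarrow>
     immersed_two_sided \<A> F \<nu> \<and>
     F ` points \<A> \<subseteq> halfspace \<and>
     F ` bdry \<A> \<subseteq> frontier halfspace \<and>
     (\<forall>(U, \<phi>)\<in>\<A>. \<forall>p\<in>U. mean_curvature (\<lambda>q. F (\<phi> q)) (\<lambda>q. \<nu> (\<phi> q)) p = 0) \<and>
     (\<forall>x\<in>bdry \<A>. \<nu> x \<bullet> eta_bar = cos \<theta>)"

definition capillary_stable ::
    "real \<Rightarrow> 'a::topological_space param set \<Rightarrow>
       ('a \<Rightarrow> real ^ 3) \<Rightarrow> ('a \<Rightarrow> real ^ 3) \<Rightarrow> bool" where
  "capillary_stable \<theta> \<A> F \<nu> \<longleftrightarrow>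
     (let Q = (\<lambda>x. - cot \<theta> * A_conormal \<A> F \<nu> x) in
      \<forall>f. Ck_fun 2 \<A> f \<and> compactly_supported \<A> f \<longrightarrow>
        0 \<le> - (LINT x|area_measure \<A> F. f x * Laplacian \<A> F f x + A_norm_sq \<A> F \<nu> x * (f x)\<^sup>2)
            + (LINT x:bdry \<A>|bdry_measure \<A> F. f x * (conormal_deriv \<A> F f x - Q x * f x)))"

end

theory Submission
  imports Defs
begin

text \<open>
  The idea is to test stability with a cutoff times the positive function
  \<open>w = 1 - cos \<theta> \<langle>\<nu>, eta_bar\<rangle>\<close>, which absorbs the boundary term of the stability form.

  In the interior, the unit normal of a minimal surface satisfies \<open>\<Delta>\<nu> = - |A|\<^sup>2 \<nu>\<close>
  (\<open>laplace_normal\<close>), so that \<open>\<Delta>w + |A|\<^sup>2 w = |A|\<^sup>2\<close> (\<open>Laplacian_weight\<close>). On the boundary,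
  \<open>eta_bar = cos \<theta> \<nu> + sin \<theta> \<eta>\<close> (\<open>conormal_vector\<close>), hence
  \<open>\<partial>w/\<partial>\<eta> = - cos \<theta> sin \<theta> A(\<eta>, \<eta>)\<close>; since \<open>w = sin\<^sup>2 \<theta>\<close> there, this is \<open>Q w\<close>
  (\<open>conormal_deriv_weight\<close>).

  Let \<open>f = \<zeta> w\<close> with a compactly supported \<open>\<zeta>\<close>. Green's formula (\<open>green\<close>), applied to the
  pairs \<open>f, f\<close> and \<open>\<zeta>\<^sup>2 w, w\<close>, and the pointwise identity
  \<open>|\<nabla>f|\<^sup>2 = \<langle>\<nabla>(\<zeta>\<^sup>2 w), \<nabla>w\<rangle> + w\<^sup>2 |\<nabla>\<zeta>|\<^sup>2\<close> make all boundary terms cancel, and stability becomes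
  \<open>\<integral> \<zeta>\<^sup>2 w |A|\<^sup>2 \<le> \<integral> w\<^sup>2 |\<nabla>\<zeta>|\<^sup>2\<close> (\<open>stability_weighted\<close>). For the logarithmic cutoff
  \<open>\<zeta> = (1 - ln (1 + |F|\<^sup>2) / L)\<^sub>+\<^sup>3\<close> and Euclidean area growth, the right-hand side is \<open>O(1/L)\<close>
  (\<open>cutoff_energy\<close>). As \<open>w \<ge> 1 - |cos \<theta>| > 0\<close>, letting \<open>L\<close> tend to infinity gives \<open>A = 0\<close>.

  To make this rigorous, the quantities that are defined chart by chart have to be shown independent
  of the chart. For first-order expressions this is linear algebra. For the Laplacian it is
  \<open>laplace_beltrami_change\<close>, where the second derivatives of the coordinate change cancel. Area and
  arc length agree on overlaps by the change of variables formula (\<open>area_compat\<close>,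
  \<open>length_compat\<close>), and agreeing measures on charts glue to a unique measure (\<open>glued_ex1\<close>).

  Inside one chart, Green's formula is the divergence theorem in the half-plane, that is, the
  fundamental theorem of calculus and Fubini's theorem. It passes to the surface by cutting the
  compactly supported factor into finitely many pieces that live in single charts (\<open>localize\<close>).
\<close>

section \<open>Differentiability relative to a thick set\<close>

text \<open>A point of a thick set can be approached inside the set along each coordinate axis. This
  makes derivatives relative to the set unique, in the half-plane also at edge points.\<close>

definition thick :: "'v::euclidean_space set \<Rightarrow> bool" where
  "thick S \<longleftrightarrow> (\<forall>x\<in>S. \<forall>i\<in>Basis. \<forall>e>0. \<exists>d. 0 < \<bar>d\<bar> \<and> \<bar>d\<bar> < e \<and> x + d *\<^sub>R i \<in> S)"

lemma thick_UNIV: "thick UNIV"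
  unfolding thick_def
proof (intro ballI allI impI)
  show "\<exists>d. 0 < \<bar>d\<bar> \<and> \<bar>d\<bar> < e \<and> x + d *\<^sub>R i \<in> UNIV" if "0 < e" for x i :: 'a and e :: real
    using that by (intro exI[of _ "e/2"]) auto
qed

lemma thick_halfplane: "thick halfplane"
  unfolding thick_def
proof (intro ballI allI impI)
  fix x i :: "real^2" and e :: real
  assume x: "x \<in> halfplane" and i: "i \<in> Basis" and e: "0 < e"
  have "0 \<le> i $ 1" using i by (auto simp: Basis_vec_def axis_def)
  then have "x + (e/2) *\<^sub>R i \<in> halfplane" using x e by (auto simp: halfplane_def)
  then show "\<exists>d. 0 < \<bar>d\<bar> \<and> \<bar>d\<bar> < e \<and> x + d *\<^sub>R i \<in> halfplane"
    using e by (intro exI[of _ "e/2"]) auto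
qed

lemma frechet_derivative_thick:
  assumes "thick S" "x \<in> S" "(f has_derivative f') (at x within S)"
  shows "frechet_derivative f (at x within S) = f'"
proof (rule frechet_derivative_unique_within)
  show "(f has_derivative frechet_derivative f (at x within S)) (at x within S)"
    using assms(3) frechet_derivative_works differentiable_def by blast
qed (use assms in \<open>auto simp: thick_def\<close>)

lemma at_within_openin:
  assumes "openin (top_of_set S) U" "x \<in> U"
  shows "at x within U = at x within S"
proof -
  obtain T where "open T" "U = S \<inter> T" using assms(1) by (auto simp: openin_open)
  with assms(2) show ?thesis by (intro at_within_nhd[of _ T]) auto
qed

lemma eventually_openin:
  assumes "openin (top_of_set S) U" "x \<in> U"
  shows "eventually (\<lambda>y. y \<in> U) (at x within S)"
proof -
  obtain T where "open T" "U = S \<inter> T" using assms(1) by (auto simp: openin_open)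
  with assms(2) show ?thesis unfolding eventually_at_filter eventually_nhds by auto
qed

lemma has_derivative_cong_openin:
  assumes "openin (top_of_set S) U" "x \<in> U" "\<And>y. y \<in> U \<Longrightarrow> f y = g y"
    "(f has_derivative f') (at x within S)"
  shows "(g has_derivative f') (at x within S)"
proof (rule has_derivative_transform_eventually[OF assms(4)])
  show "\<forall>\<^sub>F y in at x within S. f y = g y"
    using eventually_openin[OF assms(1,2)] by eventually_elim (use assms in auto)
qed (use assms openin_imp_subset[OF assms(1)] in auto)

lemma frechet_derivative_cong_openin:
  assumes "openin (top_of_set S) U" "x \<in> U" "\<And>y. y \<in> U \<Longrightarrow> f y = g y"
  shows "frechet_derivative f (at x within S) = frechet_derivative g (at x within S)"
proof -
  have "(f has_derivative f') (at x within S) = (g has_derivative f') (at x within S)" for f'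
    using has_derivative_cong_openin[OF assms(1,2)] assms(3) by metis
  then show ?thesis by (simp add: frechet_derivative_def)
qed

lemma differentiable_cong_openin:
  assumes "openin (top_of_set S) U" "x \<in> U" "\<And>y. y \<in> U \<Longrightarrow> f y = g y"
    "f differentiable (at x within S)"
  shows "g differentiable (at x within S)"
  using assms has_derivative_cong_openin unfolding differentiable_def by metis

text \<open>The class \<open>C\<^sup>1\<close> relative to \<open>S\<close>. Taking \<open>S\<close> to be the whole plane gives the usual notion, on
  open sets; taking the half-plane gives one-sided differentiability at its edge.\<close>

definition C1_on :: "'v::euclidean_space set \<Rightarrow> ('v \<Rightarrow> 'w::real_normed_vector) \<Rightarrow> 'v set \<Rightarrow> bool" where
  "C1_on S h U \<longleftrightarrow> (\<forall>p\<in>U. h differentiable (at p within S)) \<and>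
     (\<forall>a. continuous_on U (\<lambda>p. frechet_derivative h (at p within S) a))"

definition C2_on :: "'v::euclidean_space set \<Rightarrow> ('v \<Rightarrow> 'w::real_normed_vector) \<Rightarrow> 'v set \<Rightarrow> bool" where
  "C2_on S h U \<longleftrightarrow> C1_on S h U \<and> (\<forall>a. C1_on S (\<lambda>p. frechet_derivative h (at p within S) a) U)"

lemma C1_onD:
  assumes "C1_on S h U" "p \<in> U"
  shows "(h has_derivative frechet_derivative h (at p within S)) (at p within S)"
  using assms unfolding C1_on_def by (simp add: frechet_derivative_works[symmetric])

lemma C1_on_cont:
  assumes "C1_on S h U" "U \<subseteq> S"
  shows "continuous_on U h"
  unfolding continuous_on_eq_continuous_within
  using C1_onD[OF assms(1)] has_derivative_continuous continuous_within_subset assms(2) by blast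

lemma C1_on_cont_deriv: "C1_on S h U \<Longrightarrow> continuous_on U (\<lambda>p. frechet_derivative h (at p within S) a)"
  by (simp add: C1_on_def)

lemma C1_on_subset: "C1_on S h U \<Longrightarrow> V \<subseteq> U \<Longrightarrow> C1_on S h V"
  unfolding C1_on_def by (meson continuous_on_subset subsetD)

lemma C2_on_subset: "C2_on S h U \<Longrightarrow> V \<subseteq> U \<Longrightarrow> C2_on S h V"
  unfolding C2_on_def by (meson C1_on_subset)

lemma C2_on_C1: "C2_on S h U \<Longrightarrow> C1_on S h U" and
  C2_on_C1_deriv: "C2_on S h U \<Longrightarrow> C1_on S (\<lambda>p. frechet_derivative h (at p within S) a) U"
  by (auto simp: C2_on_def)

lemma C1_on_I:
  assumes "thick S" "U \<subseteq> S" "\<And>p. p \<in> U \<Longrightarrow> (h has_derivative h' p) (at p within S)"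
    "\<And>a. continuous_on U (\<lambda>p. h' p a)"
  shows "C1_on S h U"
proof -
  have eq: "frechet_derivative h (at p within S) = h' p" if "p \<in> U" for p
    using frechet_derivative_thick assms that by blast
  show ?thesis unfolding C1_on_def
  proof (intro conjI ballI allI)
    show "continuous_on U (\<lambda>p. frechet_derivative h (at p within S) a)" for a
      using assms(4)[of a] by (rule continuous_on_eq) (simp add: eq)
  qed (use assms in \<open>auto simp: differentiable_def\<close>)
qed

lemma C1_on_cong:
  assumes "openin (top_of_set S) U" "\<And>y. y \<in> U \<Longrightarrow> f y = g y" "C1_on S f U"
  shows "C1_on S g U"
  unfolding C1_on_def
proof (intro conjI ballI allI)
  show "g differentiable at p within S" if "p \<in> U" for p
    using assms that differentiable_cong_openin unfolding C1_on_def by metis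
  show "continuous_on U (\<lambda>p. frechet_derivative g (at p within S) a)" for a
    using C1_on_cont_deriv[OF assms(3), of a]
    by (rule continuous_on_eq) (use frechet_derivative_cong_openin[OF assms(1) _ assms(2)] in auto)
qed

lemma C1_on_local:
  assumes "U \<subseteq> S" "\<And>p. p \<in> U \<Longrightarrow> \<exists>V. openin (top_of_set S) V \<and> p \<in> V \<and> C1_on S h V"
  shows "C1_on S h U"
  unfolding C1_on_def
proof (intro conjI ballI allI)
  show "h differentiable at p within S" if "p \<in> U" for p
    using assms(2)[OF that] by (auto simp: C1_on_def)
  show "continuous_on U (\<lambda>p. frechet_derivative h (at p within S) a)" for a
    unfolding continuous_on_eq_continuous_within
  proof
    fix p assume "p \<in> U"
    then obtain V where V: "openin (top_of_set S) V" "p \<in> V" "C1_on S h V" using assms by blast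
    then obtain T where T: "open T" "V = S \<inter> T" by (auto simp: openin_open)
    have "continuous (at p within V) (\<lambda>p. frechet_derivative h (at p within S) a)"
      using C1_on_cont_deriv[OF V(3)] V(2) by (simp add: continuous_on_eq_continuous_within)
    then have "continuous (at p within U \<inter> T) (\<lambda>p. frechet_derivative h (at p within S) a)"
      by (rule continuous_within_subset) (use assms(1) T in auto)
    moreover have "at p within U \<inter> T = at p within U"
      using T V(2) by (intro at_within_nhd[of _ T]) auto
    ultimately show "continuous (at p within U) (\<lambda>p. frechet_derivative h (at p within S) a)"
      by simp
  qed
qed

lemma C2_on_local:
  assumes "U \<subseteq> S" "\<And>p. p \<in> U \<Longrightarrow> \<exists>V. openin (top_of_set S) V \<and> p \<in> V \<and> C2_on S h V"
  shows "C2_on S h U"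
  unfolding C2_on_def
proof (intro conjI allI C1_on_local[OF assms(1)])
  show "\<exists>V. openin (top_of_set S) V \<and> p \<in> V \<and> C1_on S h V" if "p \<in> U" for p
    using assms(2)[OF that] by (auto simp: C2_on_def)
  show "\<exists>V. openin (top_of_set S) V \<and> p \<in> V \<and> C1_on S (\<lambda>p. frechet_derivative h (at p within S) a) V"
    if "p \<in> U" for p a
    using assms(2)[OF that] by (auto simp: C2_on_def)
qed

lemma C2_on_cong:
  assumes "openin (top_of_set S) U" "\<And>y. y \<in> U \<Longrightarrow> f y = g y" "C2_on S f U"
  shows "C2_on S g U"
proof -
  have "frechet_derivative f (at p within S) = frechet_derivative g (at p within S)" if "p \<in> U" for p
    by (rule frechet_derivative_cong_openin[OF assms(1) that]) (rule assms(2))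
  then have "C1_on S (\<lambda>p. frechet_derivative g (at p within S) a) U" for a
    by (intro C1_on_cong[OF assms(1) _ C2_on_C1_deriv[OF assms(3), of a]]) simp
  moreover have "C1_on S g U"
    by (rule C1_on_cong[OF assms(1) _ C2_on_C1[OF assms(3)]]) (rule assms(2))
  ultimately show ?thesis by (simp add: C2_on_def)
qed

context
  fixes S U :: "'v::euclidean_space set"
  assumes S: "thick S" and U: "openin (top_of_set S) U"
begin

lemma domain_subset: "U \<subseteq> S" by (rule openin_imp_subset[OF U])

lemma C1_on_const: "C1_on S (\<lambda>_. c) U"
  by (rule C1_on_I[where h' = "\<lambda>_ _. 0"]) (use S domain_subset in auto)

lemma frechet_const: "p \<in> U \<Longrightarrow> frechet_derivative (\<lambda>_. c) (at p within S) = (\<lambda>_. 0)"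
  by (rule frechet_derivative_thick) (use S domain_subset in auto)

lemma C2_on_const: "C2_on S (\<lambda>_. c) U"
proof -
  have "C1_on S (\<lambda>p. frechet_derivative (\<lambda>_. c) (at p within S) a) U" for a
    by (rule C1_on_cong[OF U _ C1_on_const[of 0]]) (simp add: frechet_const)
  then show ?thesis by (simp add: C2_on_def C1_on_const)
qed

lemma frechet_add:
  assumes "C1_on S f U" "C1_on S g U" "p \<in> U"
  shows "frechet_derivative (\<lambda>p. f p + g p) (at p within S)
    = (\<lambda>a. frechet_derivative f (at p within S) a + frechet_derivative g (at p within S) a)"
  by (rule frechet_derivative_thick)
     (use assms S domain_subset in \<open>auto intro!: derivative_eq_intros C1_onD\<close>)

lemma C1_on_add:
  assumes "C1_on S f U" "C1_on S g U"
  shows "C1_on S (\<lambda>p. f p + g p) U"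
  by (rule C1_on_I[where h' = "\<lambda>p a. frechet_derivative f (at p within S) a + frechet_derivative g (at p within S) a"])
     (use assms S domain_subset in \<open>auto intro!: derivative_eq_intros continuous_intros C1_on_cont_deriv intro: C1_onD\<close>)

lemma C2_on_add:
  assumes "C2_on S f U" "C2_on S g U"
  shows "C2_on S (\<lambda>p. f p + g p) U"
proof -
  note 1 = assms[THEN C2_on_C1]
  have "C1_on S (\<lambda>p. frechet_derivative (\<lambda>p. f p + g p) (at p within S) a) U" for a
    by (rule C1_on_cong[OF U _ C1_on_add[OF C2_on_C1_deriv[OF assms(1), of a] C2_on_C1_deriv[OF assms(2), of a]]])
       (simp add: frechet_add 1)
  then show ?thesis by (simp add: C2_on_def C1_on_add 1)
qed

lemma frechet_bilinear:
  assumes "bounded_bilinear B" "C1_on S f U" "C1_on S g U" "p \<in> U"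
  shows "frechet_derivative (\<lambda>p. B (f p) (g p)) (at p within S)
    = (\<lambda>a. B (f p) (frechet_derivative g (at p within S) a) + B (frechet_derivative f (at p within S) a) (g p))"
  by (rule frechet_derivative_thick)
     (use assms S domain_subset in \<open>auto intro!: bounded_bilinear.FDERIV C1_onD\<close>)

lemma C1_on_bilinear:
  assumes "bounded_bilinear B" "C1_on S f U" "C1_on S g U"
  shows "C1_on S (\<lambda>p. B (f p) (g p)) U"
  by (rule C1_on_I[where h' = "\<lambda>p a. B (f p) (frechet_derivative g (at p within S) a) + B (frechet_derivative f (at p within S) a) (g p)"])
     (use assms S domain_subset in \<open>auto intro!: bounded_bilinear.FDERIV continuous_intros
        bounded_bilinear.continuous_on[OF assms(1)] C1_on_cont_deriv intro: C1_onD C1_on_cont\<close>)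

lemma C2_on_bilinear:
  assumes B: "bounded_bilinear B" and fg: "C2_on S f U" "C2_on S g U"
  shows "C2_on S (\<lambda>p. B (f p) (g p)) U"
proof -
  note 1 = fg[THEN C2_on_C1]
  have "C1_on S (\<lambda>p. frechet_derivative (\<lambda>p. B (f p) (g p)) (at p within S) a) U" for a
    by (rule C1_on_cong[OF U _ C1_on_add[OF C1_on_bilinear[OF B 1(1) C2_on_C1_deriv[OF fg(2), of a]]
            C1_on_bilinear[OF B C2_on_C1_deriv[OF fg(1), of a] 1(2)]]])
       (simp add: frechet_bilinear B 1)
  then show ?thesis by (simp add: C2_on_def C1_on_bilinear B 1)
qed

lemma frechet_real_comp:
  fixes f :: "'v \<Rightarrow> real"
  assumes "C1_on S f U" "p \<in> U" "(h has_real_derivative h') (at (f p))"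
  shows "frechet_derivative (\<lambda>p. h (f p)) (at p within S)
    = (\<lambda>a. h' * frechet_derivative f (at p within S) a)"
proof (rule frechet_derivative_thick[OF S])
  have "(h has_derivative (*) h') (at (f p))" using assms(3) by (simp add: has_field_derivative_def)
  from has_derivative_compose[OF C1_onD[OF assms(1,2)] this]
  show "((\<lambda>p. h (f p)) has_derivative (\<lambda>a. h' * frechet_derivative f (at p within S) a)) (at p within S)" .
qed (use domain_subset assms in auto)

lemma C1_on_real_comp:
  fixes f :: "'v \<Rightarrow> real"
  assumes "C1_on S f U" "f ` U \<subseteq> T" "\<And>x. x \<in> T \<Longrightarrow> (h has_real_derivative h' x) (at x)" "continuous_on T h'"
  shows "C1_on S (\<lambda>p. h (f p)) U"
proof (rule C1_on_I[OF S domain_subset, where h' = "\<lambda>p a. h' (f p) * frechet_derivative f (at p within S) a"])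
  fix p assume "p \<in> U"
  then have "(h has_derivative (*) (h' (f p))) (at (f p))"
    using assms(2,3) by (auto simp: has_field_derivative_def)
  from has_derivative_compose[OF C1_onD[OF assms(1) \<open>p \<in> U\<close>] this]
  show "((\<lambda>p. h (f p)) has_derivative (\<lambda>a. h' (f p) * frechet_derivative f (at p within S) a)) (at p within S)" .
next
  show "continuous_on U (\<lambda>p. h' (f p) * frechet_derivative f (at p within S) a)" for a
    using continuous_on_compose2[OF assms(4) C1_on_cont[OF assms(1) domain_subset] assms(2)]
    by (intro continuous_intros C1_on_cont_deriv assms)
qed

lemma C2_on_real_comp:
  fixes f :: "'v \<Rightarrow> real"
  assumes "C2_on S f U" "f ` U \<subseteq> T" "\<And>x. x \<in> T \<Longrightarrow> (h has_real_derivative h' x) (at x)"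
    "\<And>x. x \<in> T \<Longrightarrow> (h' has_real_derivative h'' x) (at x)" "continuous_on T h''"
  shows "C2_on S (\<lambda>p. h (f p)) U"
proof -
  note 1 = assms(1)[THEN C2_on_C1]
  have h': "continuous_on T h'"
    using assms(4) by (meson DERIV_isCont continuous_at_imp_continuous_on)
  have "C1_on S (\<lambda>p. frechet_derivative (\<lambda>p. h (f p)) (at p within S) a) U" for a
    by (rule C1_on_cong[OF U _ C1_on_bilinear[OF bounded_bilinear_mult
            C1_on_real_comp[OF 1 assms(2,4,5)] C2_on_C1_deriv[OF assms(1), of a]]])
       (subst frechet_real_comp[OF 1 _ assms(3)], use assms(2) in auto)
  then show ?thesis by (simp add: C2_on_def C1_on_real_comp[OF 1 assms(2,3) h'])
qed

lemma
  assumes k: "C1_on T k V" and V: "openin (top_of_set T) V" and t: "C1_on S \<tau> U" and UV: "\<tau> ` U \<subseteq> V"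
  shows frechet_chain: "p \<in> U \<Longrightarrow> frechet_derivative (\<lambda>p. k (\<tau> p)) (at p within S)
      = (\<lambda>a. frechet_derivative k (at (\<tau> p) within T) (frechet_derivative \<tau> (at p within S) a))"
    and C1_on_chain: "C1_on S (\<lambda>p. k (\<tau> p)) U"
proof -
  have VT: "V \<subseteq> T" by (rule openin_imp_subset[OF V])
  have 1: "((\<lambda>p. k (\<tau> p)) has_derivative
      (\<lambda>a. frechet_derivative k (at (\<tau> p) within T) (frechet_derivative \<tau> (at p within S) a))) (at p within S)"
    if "p \<in> U" for p
  proof -
    have "(k has_derivative frechet_derivative k (at (\<tau> p) within T)) (at (\<tau> p) within \<tau> ` U)"
      by (rule has_derivative_subset[OF C1_onD[OF k]]) (use UV VT that in auto)
    moreover have "(\<tau> has_derivative frechet_derivative \<tau> (at p within S)) (at p within U)"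
      using C1_onD[OF t that] at_within_openin[OF U that] by simp
    ultimately have "(k \<circ> \<tau> has_derivative
      frechet_derivative k (at (\<tau> p) within T) \<circ> frechet_derivative \<tau> (at p within S)) (at p within U)"
      by (rule diff_chain_within[rotated])
    then show ?thesis using at_within_openin[OF U that] by (simp add: o_def)
  qed
  then show "p \<in> U \<Longrightarrow> frechet_derivative (\<lambda>p. k (\<tau> p)) (at p within S)
      = (\<lambda>a. frechet_derivative k (at (\<tau> p) within T) (frechet_derivative \<tau> (at p within S) a))"
    using frechet_derivative_thick[OF S] domain_subset by blast
  show "C1_on S (\<lambda>p. k (\<tau> p)) U"
  proof (rule C1_on_I[OF S domain_subset 1])
    fix a
    have "frechet_derivative k (at (\<tau> p) within T) (frechet_derivative \<tau> (at p within S) a)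
      = (\<Sum>i\<in>Basis. (frechet_derivative \<tau> (at p within S) a \<bullet> i) *\<^sub>R frechet_derivative k (at (\<tau> p) within T) i)"
      if "p \<in> U" for p
    proof -
      have "linear (frechet_derivative k (at (\<tau> p) within T))"
        using C1_onD[OF k, of "\<tau> p"] UV that has_derivative_linear by blast
      then show ?thesis
        by (subst (1) euclidean_representation[symmetric]) (simp add: linear_sum linear_cmul)
    qed
    moreover have "continuous_on U (\<lambda>p. \<Sum>i\<in>Basis. (frechet_derivative \<tau> (at p within S) a \<bullet> i) *\<^sub>R frechet_derivative k (at (\<tau> p) within T) i)"
      by (intro continuous_intros C1_on_cont_deriv[OF t]
         continuous_on_compose2[OF C1_on_cont_deriv[OF k] C1_on_cont[OF t domain_subset] UV])
    ultimately show "continuous_on U (\<lambda>p. frechet_derivative k (at (\<tau> p) within T) (frechet_derivative \<tau> (at p within S) a))"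
      by (simp cong: continuous_on_cong)
  qed
qed

end

section \<open>Symmetry of second derivatives\<close>

text \<open>Schwarz's argument: the second difference of \<open>f\<close> over a parallelogram does not change when the
  two directions are exchanged, and two applications of the mean value theorem turn it into a mixed
  second derivative at some point of the parallelogram.\<close>

lemma second_difference_mvt:
  fixes f :: "'v::euclidean_space \<Rightarrow> real"
  assumes f: "C2_on UNIV f W" and h: "0 < h"
    and W: "\<And>s t. 0 \<le> s \<Longrightarrow> s \<le> h \<Longrightarrow> 0 \<le> t \<Longrightarrow> t \<le> h \<Longrightarrow> p + s *\<^sub>R u + t *\<^sub>R v \<in> W"
  obtains s t where "0 \<le> s" "s \<le> h" "0 \<le> t" "t \<le> h"
    "f (p + h *\<^sub>R u + h *\<^sub>R v) - f (p + h *\<^sub>R u) - f (p + h *\<^sub>R v) + f p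
      = h * h * frechet_derivative (\<lambda>q. frechet_derivative f (at q) u) (at (p + s *\<^sub>R u + t *\<^sub>R v)) v"
proof -
  let ?fu = "\<lambda>q. frechet_derivative f (at q) u"
  have d1: "((\<lambda>s. g (a + s *\<^sub>R w)) has_real_derivative frechet_derivative g (at (a + s *\<^sub>R w)) w) (at s)"
    if "C1_on UNIV g W" "a + s *\<^sub>R w \<in> W" for g :: "'v \<Rightarrow> real" and a w s
  proof -
    have g: "(g has_derivative frechet_derivative g (at (a + s *\<^sub>R w))) (at (a + s *\<^sub>R w))"
      using C1_onD[OF that] by simp
    have "((\<lambda>s. a + s *\<^sub>R w) has_derivative (\<lambda>d. d *\<^sub>R w)) (at s)"
      by (auto intro!: derivative_eq_intros)
    from has_derivative_compose[OF this g]
    have "((\<lambda>s. g (a + s *\<^sub>R w)) has_derivative (\<lambda>d. frechet_derivative g (at (a + s *\<^sub>R w)) (d *\<^sub>R w))) (at s)" .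
    moreover have "(\<lambda>d. frechet_derivative g (at (a + s *\<^sub>R w)) (d *\<^sub>R w)) = (*) (frechet_derivative g (at (a + s *\<^sub>R w)) w)"
      using has_derivative_linear[OF g] by (auto simp: linear_cmul)
    ultimately show ?thesis by (simp add: has_field_derivative_def)
  qed
  note C1 = C2_on_C1[OF f] and C1' = C2_on_C1_deriv[OF f, of u, simplified]
  have "\<exists>s>0. s < h \<and> (f (p + h *\<^sub>R v + h *\<^sub>R u) - f (p + h *\<^sub>R u)) - (f (p + h *\<^sub>R v + 0 *\<^sub>R u) - f (p + 0 *\<^sub>R u))
      = (h - 0) * (?fu (p + h *\<^sub>R v + s *\<^sub>R u) - ?fu (p + s *\<^sub>R u))"
  proof (rule MVT2[OF h])
    fix s assume "0 \<le> s" "s \<le> h"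
    then have "p + s *\<^sub>R u \<in> W" "p + h *\<^sub>R v + s *\<^sub>R u \<in> W"
      using W[of s 0] W[of s h] h by (auto simp: algebra_simps)
    then show "((\<lambda>s. f (p + h *\<^sub>R v + s *\<^sub>R u) - f (p + s *\<^sub>R u)) has_real_derivative
        (?fu (p + h *\<^sub>R v + s *\<^sub>R u) - ?fu (p + s *\<^sub>R u))) (at s)"
      by (intro DERIV_diff d1[OF C1])
  qed
  then obtain s where s: "0 < s" "s < h" and 1: "(f (p + h *\<^sub>R v + h *\<^sub>R u) - f (p + h *\<^sub>R u)) - (f (p + h *\<^sub>R v) - f p)
      = h * (?fu (p + h *\<^sub>R v + s *\<^sub>R u) - ?fu (p + s *\<^sub>R u))" by auto
  have "\<exists>t>0. t < h \<and> ?fu ((p + s *\<^sub>R u) + h *\<^sub>R v) - ?fu ((p + s *\<^sub>R u) + 0 *\<^sub>R v)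
      = (h - 0) * frechet_derivative ?fu (at ((p + s *\<^sub>R u) + t *\<^sub>R v)) v"
    by (rule MVT2[OF h]) (use W s in \<open>auto intro!: d1[OF C1']\<close>)
  then obtain t where t: "0 < t" "t < h" and 2: "?fu (p + s *\<^sub>R u + h *\<^sub>R v) - ?fu (p + s *\<^sub>R u)
      = h * frechet_derivative ?fu (at (p + s *\<^sub>R u + t *\<^sub>R v)) v" by auto
  show ?thesis
    by (rule that[of s t]) (use s t 1 2 in \<open>auto simp: algebra_simps\<close>)
qed

lemma C2_on_symmetric_real:
  fixes f :: "'v::euclidean_space \<Rightarrow> real"
  assumes f: "C2_on UNIV f W" and W: "open W" and p: "p \<in> W"
  shows "frechet_derivative (\<lambda>q. frechet_derivative f (at q) u) (at p) v
       = frechet_derivative (\<lambda>q. frechet_derivative f (at q) v) (at p) u"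
proof -
  define D where "D u v q = frechet_derivative (\<lambda>q. frechet_derivative f (at q) u) (at q) v" for u v q
  have cont: "isCont (D u v) p" for u v
    using C1_on_cont_deriv[OF C2_on_C1_deriv[OF f, of u], of v] W p
    unfolding D_def[abs_def] by (auto simp: continuous_on_eq_continuous_at)
  have "dist (D u v p) (D v u p) \<le> e" if e: "0 < e" for e
  proof -
    obtain d1 where d1: "0 < d1" "\<And>q. dist q p < d1 \<Longrightarrow> dist (D u v q) (D u v p) < e/2"
      using cont[of u v] e unfolding continuous_at_eps_delta by (metis half_gt_zero)
    obtain d2 where d2: "0 < d2" "\<And>q. dist q p < d2 \<Longrightarrow> dist (D v u q) (D v u p) < e/2"
      using cont[of v u] e unfolding continuous_at_eps_delta by (metis half_gt_zero)
    obtain d3 where d3: "0 < d3" "ball p d3 \<subseteq> W" using W p openE by blast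
    define d where "d = min d1 (min d2 d3)"
    define h where "h = d / (2 * (norm u + norm v + 1))"
    have d: "0 < d" using d1 d2 d3 by (simp add: d_def)
    have h: "0 < h" using d by (simp add: h_def add_nonneg_pos)
    have close: "dist (p + s *\<^sub>R u + t *\<^sub>R v) p < d" if "0 \<le> s" "s \<le> h" "0 \<le> t" "t \<le> h" for s t
    proof -
      have "dist (p + s *\<^sub>R u + t *\<^sub>R v) p \<le> s * norm u + t * norm v"
        using norm_triangle_ineq[of "s *\<^sub>R u" "t *\<^sub>R v"] that by (simp add: dist_norm)
      also have "\<dots> \<le> h * norm u + h * norm v" by (intro add_mono mult_right_mono that) auto
      also have "\<dots> \<le> h * (norm u + norm v + 1)" using h by (simp add: algebra_simps)
      also have "\<dots> = d / 2"
        unfolding h_def using add_nonneg_pos[of "norm u + norm v" 1] by (auto simp: field_simps)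
      finally show ?thesis using d by simp
    qed
    have inW: "p + s *\<^sub>R u + t *\<^sub>R v \<in> W" if "0 \<le> s" "s \<le> h" "0 \<le> t" "t \<le> h" for s t
      using close[OF that] d3 by (auto simp: d_def dist_commute subset_iff)
    have diff: "\<exists>s t. 0 \<le> s \<and> s \<le> h \<and> 0 \<le> t \<and> t \<le> h \<and>
        f (p + h *\<^sub>R u + h *\<^sub>R v) - f (p + h *\<^sub>R u) - f (p + h *\<^sub>R v) + f p = h * h * D u v (p + s *\<^sub>R u + t *\<^sub>R v)"
      if inW: "\<forall>s t. 0 \<le> s \<longrightarrow> s \<le> h \<longrightarrow> 0 \<le> t \<longrightarrow> t \<le> h \<longrightarrow> p + s *\<^sub>R u + t *\<^sub>R v \<in> W" for u v
    proof (rule second_difference_mvt[OF f h, of p u v])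
      fix s t
      assume "0 \<le> s" "s \<le> h" "0 \<le> t" "t \<le> h" and "f (p + h *\<^sub>R u + h *\<^sub>R v) - f (p + h *\<^sub>R u) - f (p + h *\<^sub>R v) + f p
        = h * h * frechet_derivative (\<lambda>q. frechet_derivative f (at q) u) (at (p + s *\<^sub>R u + t *\<^sub>R v)) v"
      then show ?thesis unfolding D_def by (intro exI conjI)
    qed (use inW in blast)
    obtain s t where st: "0 \<le> s" "s \<le> h" "0 \<le> t" "t \<le> h"
      "f (p + h *\<^sub>R u + h *\<^sub>R v) - f (p + h *\<^sub>R u) - f (p + h *\<^sub>R v) + f p = h * h * D u v (p + s *\<^sub>R u + t *\<^sub>R v)"
      using diff[of u v] inW by blast
    have inW': "p + s *\<^sub>R v + t *\<^sub>R u \<in> W" if "0 \<le> s" "s \<le> h" "0 \<le> t" "t \<le> h" for s t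
      using inW[of t s] that by (simp add: algebra_simps)
    obtain s' t' where st': "0 \<le> s'" "s' \<le> h" "0 \<le> t'" "t' \<le> h"
      "f (p + h *\<^sub>R v + h *\<^sub>R u) - f (p + h *\<^sub>R v) - f (p + h *\<^sub>R u) + f p = h * h * D v u (p + s' *\<^sub>R v + t' *\<^sub>R u)"
      using diff[of v u] inW' by blast
    have eq: "D u v (p + s *\<^sub>R u + t *\<^sub>R v) = D v u (p + t' *\<^sub>R u + s' *\<^sub>R v)"
    proof -
      have "h * h * D u v (p + s *\<^sub>R u + t *\<^sub>R v) = h * h * D v u (p + s' *\<^sub>R v + t' *\<^sub>R u)"
        unfolding st(5)[symmetric] st'(5)[symmetric] by (simp add: add_ac)
      then have "D u v (p + s *\<^sub>R u + t *\<^sub>R v) = D v u (p + s' *\<^sub>R v + t' *\<^sub>R u)" using h by simp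
      also have "p + s' *\<^sub>R v + t' *\<^sub>R u = p + t' *\<^sub>R u + s' *\<^sub>R v" by (simp add: add_ac)
      finally show ?thesis .
    qed
    have "dist (D u v (p + s *\<^sub>R u + t *\<^sub>R v)) (D u v p) < e/2"
      using d1(2) close[OF st(1-4)] by (simp add: d_def)
    moreover have "dist (D v u (p + t' *\<^sub>R u + s' *\<^sub>R v)) (D v u p) < e/2"
      using d2(2) close[OF st'(3,4,1,2)] by (simp add: d_def)
    ultimately show ?thesis unfolding eq dist_real_def by linarith
  qed
  then have "D u v p = D v u p" by (metis dist_le_zero_iff field_le_epsilon add_0)
  then show ?thesis by (simp add: D_def)
qed

lemma C2_on_symmetric:
  fixes f :: "'v::euclidean_space \<Rightarrow> 'w::real_inner"
  assumes f: "C2_on UNIV f W" and W: "open W" and p: "p \<in> W"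
  shows "frechet_derivative (\<lambda>q. frechet_derivative f (at q) u) (at p) v
       = frechet_derivative (\<lambda>q. frechet_derivative f (at q) v) (at p) u"
proof -
  have W': "openin (top_of_set UNIV) W" using W by (simp add: subtopology_UNIV)
  have "frechet_derivative (\<lambda>q. frechet_derivative f (at q) u) (at p) v \<bullet> w
       = frechet_derivative (\<lambda>q. frechet_derivative f (at q) v) (at p) u \<bullet> w" for w
  proof -
    have f': "C2_on UNIV (\<lambda>q. f q \<bullet> w) W"
      by (rule C2_on_bilinear[OF thick_UNIV W' bounded_bilinear_inner f C2_on_const[OF thick_UNIV W']])
    have 1: "frechet_derivative (\<lambda>q. g q \<bullet> w) (at q) a = frechet_derivative g (at q) a \<bullet> w"
      if "C1_on UNIV g W" "q \<in> W" for g :: "'v \<Rightarrow> 'w" and q a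
      using frechet_bilinear[OF thick_UNIV W' bounded_bilinear_inner that(1) C1_on_const[OF thick_UNIV W', of w] that(2)]
        frechet_const[OF thick_UNIV W' that(2), of w] by (simp add: fun_eq_iff)
    have 2: "frechet_derivative (\<lambda>q. frechet_derivative (\<lambda>q. f q \<bullet> w) (at q) a) (at p) b
        = frechet_derivative (\<lambda>q. frechet_derivative f (at q) a) (at p) b \<bullet> w" for a b
    proof -
      have "frechet_derivative (\<lambda>q. frechet_derivative (\<lambda>q. f q \<bullet> w) (at q) a) (at p within UNIV)
          = frechet_derivative (\<lambda>q. frechet_derivative f (at q) a \<bullet> w) (at p within UNIV)"
        by (rule frechet_derivative_cong_openin[OF W' p]) (rule 1[OF C2_on_C1[OF f]])
      then show ?thesis using 1[OF C2_on_C1_deriv[OF f] p, of a b] by simp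
    qed
    show ?thesis using C2_on_symmetric_real[OF f' W p, of u v] by (simp add: 2)
  qed
  then show ?thesis by (metis vector_eq_rdot)
qed

section \<open>Functions that extend across the edge\<close>

lemma Ck_on_imp_C2_on:
  assumes "Ck_on k g W" "2 \<le> k" "open W"
  shows "C2_on UNIV g W"
proof -
  have "(2::enat) = enat (Suc (Suc 0))" by (simp add: numeral_eq_enat)
  then have "enat (Suc (Suc 0)) \<le> k" using assms(2) by simp
  then have h: "higher_differentiable_on W g (Suc (Suc 0))"
    using assms(1) by (simp add: Ck_on_def del: higher_differentiable_on.simps)
  have c: "continuous_on W f" if "\<forall>x\<in>W. f differentiable (at x)" for f :: "'a \<Rightarrow> 'b"
    using that differentiable_imp_continuous_within continuous_at_imp_continuous_on by blast
  have 1: "\<forall>x\<in>W. g differentiable (at x)"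
    and 2: "\<And>v. \<forall>x\<in>W. (\<lambda>x. frechet_derivative g (at x) v) differentiable (at x)"
    and 3: "\<And>v w. continuous_on W (\<lambda>x. frechet_derivative (\<lambda>x. frechet_derivative g (at x) v) (at x) w)"
    using h by simp_all
  have "C1_on UNIV g W" unfolding C1_on_def using 1 c[OF 2] by (intro conjI allI) (assumption, assumption)
  moreover have "C1_on UNIV (\<lambda>x. frechet_derivative g (at x) v) W" for v
    unfolding C1_on_def using 2[of v] 3[of v] by (intro conjI allI) (assumption, assumption)
  ultimately show ?thesis unfolding C2_on_def by (intro conjI allI) (assumption, assumption)
qed

lemma C2_on_imp_Ck_on:
  assumes "C2_on UNIV g W"
  shows "Ck_on 2 g W"
  unfolding Ck_on_def
proof (intro allI impI)
  fix n assume "enat n \<le> 2"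
  then have "n \<le> 2" by (simp add: numeral_eq_enat)
  then consider "n = 0" | "n = Suc 0" | "n = Suc (Suc 0)" by linarith
  then show "higher_differentiable_on W g n"
    using assms C1_on_cont[OF C2_on_C1[OF assms]] by cases (auto simp: C2_on_def C1_on_def)
qed

lemma C1_on_restrict:
  assumes g: "C1_on UNIV g W" and W: "open W" and S: "thick S"
  shows "C1_on S g (S \<inter> W)"
    and "p \<in> S \<inter> W \<Longrightarrow> frechet_derivative g (at p within S) = frechet_derivative g (at p)"
proof -
  have d: "(g has_derivative frechet_derivative g (at p)) (at p within S)" if "p \<in> S \<inter> W" for p
    using C1_onD[OF g, of p] that has_derivative_at_withinI by auto
  show "C1_on S g (S \<inter> W)"
    by (rule C1_on_I[OF S _ d])
       (use C1_on_cont_deriv[OF g] in \<open>auto intro: continuous_on_subset\<close>)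
  show "p \<in> S \<inter> W \<Longrightarrow> frechet_derivative g (at p within S) = frechet_derivative g (at p)"
    using frechet_derivative_thick[OF S _ d] by auto
qed

lemma C2_on_restrict:
  assumes g: "C2_on UNIV g W" and W: "open W" and S: "thick S"
  shows "C2_on S g (S \<inter> W)"
    and "p \<in> S \<inter> W \<Longrightarrow> frechet_derivative (\<lambda>q. frechet_derivative g (at q within S) a) (at p within S)
      = frechet_derivative (\<lambda>q. frechet_derivative g (at q) a) (at p)"
proof -
  have SW: "openin (top_of_set S) (S \<inter> W)" using W by auto
  note eq = C1_on_restrict(2)[OF C2_on_C1[OF g] W S]
  note r = C1_on_restrict[OF C2_on_C1_deriv[OF g] W S]
  have "C1_on S (\<lambda>p. frechet_derivative g (at p within S) a) (S \<inter> W)" for a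
    by (rule C1_on_cong[OF SW _ r(1)[of a]]) (simp add: eq)
  then show "C2_on S g (S \<inter> W)"
    by (simp add: C2_on_def C1_on_restrict(1)[OF C2_on_C1[OF g] W S])
  assume p: "p \<in> S \<inter> W"
  have "frechet_derivative (\<lambda>q. frechet_derivative g (at q within S) a) (at p within S)
      = frechet_derivative (\<lambda>q. frechet_derivative g (at q) a) (at p within S)"
    by (rule frechet_derivative_cong_openin[OF SW p]) (simp add: eq)
  also have "\<dots> = frechet_derivative (\<lambda>q. frechet_derivative g (at q) a) (at p)"
    by (rule r(2)[OF p])
  finally show "frechet_derivative (\<lambda>q. frechet_derivative g (at q within S) a) (at p within S)
      = frechet_derivative (\<lambda>q. frechet_derivative g (at q) a) (at p)" .
qed

text \<open>One-sided derivatives at the edge agree with the derivatives of any local extension across it.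
  Therefore second derivatives are symmetric at edge points as well.\<close>

lemma Ck_half_C2:
  fixes h :: "real^2 \<Rightarrow> 'w::real_inner"
  assumes h: "Ck_half k h U" and k: "2 \<le> k" and U: "openin (top_of_set halfplane) U"
  shows "C2_on halfplane h U"
    and "p \<in> U \<Longrightarrow> frechet_derivative (\<lambda>q. frechet_derivative h (at q within halfplane) a) (at p within halfplane) b
      = frechet_derivative (\<lambda>q. frechet_derivative h (at q within halfplane) b) (at p within halfplane) a"
proof -
  have US: "U \<subseteq> halfplane" by (rule openin_imp_subset[OF U])
  have ex: "\<exists>W g. open W \<and> p \<in> W \<and> C2_on UNIV g W \<and> (\<forall>q\<in>U \<inter> W. g q = h q)" if "p \<in> U" for p
  proof -
    obtain W g where W: "open W" "p \<in> W" "Ck_on k g W" "\<forall>q\<in>U \<inter> W. g q = h q"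
      using h \<open>p \<in> U\<close> unfolding Ck_half_def by blast
    then show ?thesis using Ck_on_imp_C2_on[OF W(3) k W(1)] by blast
  qed
  have op: "openin (top_of_set halfplane) (U \<inter> W)" if "open W" for W
    using U that by (simp add: openin_Int_open)
  show "C2_on halfplane h U"
  proof (rule C2_on_local[OF US])
    fix p assume p: "p \<in> U"
    obtain W g where W: "open W" "p \<in> W" "C2_on UNIV g W" "\<forall>q\<in>U \<inter> W. g q = h q" using ex[OF p] by blast
    have "C2_on halfplane g (U \<inter> W)"
      by (rule C2_on_subset[OF C2_on_restrict(1)[OF W(3,1) thick_halfplane]]) (use US in auto)
    then have "C2_on halfplane h (U \<inter> W)" by (rule C2_on_cong[OF op[OF W(1)], rotated]) (use W in auto)
    then show "\<exists>V. openin (top_of_set halfplane) V \<and> p \<in> V \<and> C2_on halfplane h V"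
      using op[OF W(1)] p W(2) by blast
  qed
  assume p: "p \<in> U"
  obtain W g where W: "open W" "p \<in> W" "C2_on UNIV g W" "\<forall>q\<in>U \<inter> W. g q = h q" using ex[OF p] by blast
  have pW: "p \<in> halfplane \<inter> W" "p \<in> U \<inter> W" using p US W by auto
  have "frechet_derivative (\<lambda>q. frechet_derivative h (at q within halfplane) a) (at p within halfplane)
    = frechet_derivative (\<lambda>q. frechet_derivative g (at q) a) (at p)" for a
  proof -
    have "frechet_derivative h (at q within halfplane) = frechet_derivative g (at q within halfplane)"
      if "q \<in> U \<inter> W" for q
      using frechet_derivative_cong_openin[OF op[OF W(1)] that, of h g] W(4) by simp
    then have "frechet_derivative (\<lambda>q. frechet_derivative h (at q within halfplane) a) (at p within halfplane)
      = frechet_derivative (\<lambda>q. frechet_derivative g (at q within halfplane) a) (at p within halfplane)"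
      by (intro frechet_derivative_cong_openin[OF op[OF W(1)] pW(2)]) simp
    then show ?thesis using C2_on_restrict(2)[OF W(3,1) thick_halfplane pW(1)] by simp
  qed
  then show "frechet_derivative (\<lambda>q. frechet_derivative h (at q within halfplane) a) (at p within halfplane) b
      = frechet_derivative (\<lambda>q. frechet_derivative h (at q within halfplane) b) (at p within halfplane) a"
    using C2_on_symmetric[OF W(3,1,2)] by simp
qed

section \<open>Two-dimensional metrics\<close>

abbreviation e1 :: "real^2" where "e1 \<equiv> axis 1 1"
abbreviation e2 :: "real^2" where "e2 \<equiv> axis 2 1"

abbreviation hopen :: "(real^2) set \<Rightarrow> bool" where "hopen \<equiv> openin (top_of_set halfplane)"

lemma matrix_inv_2:
  fixes A :: "real^2^2"
  assumes "det A \<noteq> 0"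
  shows "matrix_inv A $ 1 $ 1 = A $ 2 $ 2 / det A" "matrix_inv A $ 1 $ 2 = - A $ 1 $ 2 / det A"
    "matrix_inv A $ 2 $ 1 = - A $ 2 $ 1 / det A" "matrix_inv A $ 2 $ 2 = A $ 1 $ 1 / det A"
proof -
  define B :: "real^2^2" where "B = vector [vector [A $ 2 $ 2 / det A, - A $ 1 $ 2 / det A],
     vector [- A $ 2 $ 1 / det A, A $ 1 $ 1 / det A]]"
  have "A ** B = mat 1"
    using assms unfolding B_def vec_eq_iff forall_2 matrix_matrix_mult_def sum_2 mat_def
    by (simp add: diff_divide_distrib[symmetric]) (simp add: det_2 mult.commute)
  moreover have "matrix_inv A ** A = mat 1"
  proof -
    have "\<exists>A'. A ** A' = mat 1 \<and> A' ** A = mat 1"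
      using assms by (simp add: invertible_det_nz[symmetric] invertible_def)
    then show ?thesis unfolding matrix_inv_def by (rule someI2_ex) simp
  qed
  ultimately have "matrix_inv A = B"
    by (metis matrix_mul_assoc matrix_mul_lid matrix_mul_rid)
  then show "matrix_inv A $ 1 $ 1 = A $ 2 $ 2 / det A" "matrix_inv A $ 1 $ 2 = - A $ 1 $ 2 / det A"
    "matrix_inv A $ 2 $ 1 = - A $ 2 $ 1 / det A" "matrix_inv A $ 2 $ 2 = A $ 1 $ 1 / det A"
    by (simp_all add: B_def)
qed

lemma vec2_expand: "a = a $ 1 *\<^sub>R e1 + a $ 2 *\<^sub>R e2" for a :: "real^2"
  by (simp add: vec_eq_iff forall_2 axis_def)

lemma D_half_linear: "h differentiable (at p within halfplane) \<Longrightarrow> linear (D_half h p)"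
  by (simp add: D_half_def linear_frechet_derivative)

lemma D_half_expand:
  assumes "C1_on halfplane h U" "p \<in> U"
  shows "D_half h p a = a $ 1 *\<^sub>R D_half h p e1 + a $ 2 *\<^sub>R D_half h p e2"
proof -
  have l: "linear (D_half h p)" using assms by (auto intro!: D_half_linear simp: C1_on_def)
  show ?thesis by (subst vec2_expand[of a]) (simp only: linear_add[OF l] linear_cmul[OF l])
qed

lemma gram_entries:
  "gram X p $ 1 $ 1 = D_half X p e1 \<bullet> D_half X p e1" "gram X p $ 1 $ 2 = D_half X p e1 \<bullet> D_half X p e2"
  "gram X p $ 2 $ 1 = D_half X p e1 \<bullet> D_half X p e2" "gram X p $ 2 $ 2 = D_half X p e2 \<bullet> D_half X p e2"
  by (simp_all add: gram_def inner_commute)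

lemma det_gram:
  "det (gram X p) = (D_half X p e1 \<bullet> D_half X p e1) * (D_half X p e2 \<bullet> D_half X p e2) - (D_half X p e1 \<bullet> D_half X p e2)\<^sup>2"
  by (simp add: det_2 gram_entries power2_eq_square)

lemma det_gram_cross: "det (gram X p) = (norm (cross3 (D_half X p e1) (D_half X p e2)))\<^sup>2"
  using norm_cross_dot[of "D_half X p e1" "D_half X p e2"]
  by (simp add: det_gram power_mult_distrib power2_norm_eq_inner)

lemma det_gram_pos:
  assumes X: "C1_on halfplane X U" and p: "p \<in> U" and inj: "inj (D_half X p)"
  shows "0 < det (gram X p)"
proof (rule ccontr)
  have l: "linear (D_half X p)" using X p by (auto intro!: D_half_linear simp: C1_on_def)
  assume "\<not> 0 < det (gram X p)"
  then have "cross3 (D_half X p e1) (D_half X p e2) = 0"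
    by (simp add: det_gram_cross zero_less_power2[of "norm _", simplified])
  then have "collinear {0, D_half X p e1, D_half X p e2}" by (simp add: cross_eq_0)
  then consider "D_half X p e1 = 0" | c where "D_half X p e2 = c *\<^sub>R D_half X p e1"
    unfolding collinear_lemma by (metis scaleR_zero_left)
  then obtain v where "v \<noteq> 0" "D_half X p v = 0"
  proof cases
    case 1
    show ?thesis by (rule that[OF _ 1]) (simp add: axis_eq_0_iff)
  next
    case (2 c)
    have "D_half X p (e2 - c *\<^sub>R e1) = 0" using 2 by (simp add: linear_diff[OF l] linear_cmul[OF l])
    moreover have "e2 - c *\<^sub>R e1 \<noteq> 0" by (simp add: vec_eq_iff forall_2 axis_def)
    ultimately show ?thesis by (rule that[rotated])
  qed
  then show False using inj linear_injective_0[OF l] by blast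
qed

text \<open>The inner product \<open>\<langle>\<nabla>u, \<nabla>v\<rangle>\<close> in the metric of \<open>X\<close>, with the inverse of the Gram matrix written out.\<close>

definition grad_inner :: "(real^2 \<Rightarrow> real^3) \<Rightarrow> (real^2 \<Rightarrow> real) \<Rightarrow> (real^2 \<Rightarrow> real) \<Rightarrow> real^2 \<Rightarrow> real" where
  "grad_inner X u v p = ((D_half X p e2 \<bullet> D_half X p e2) * D_half u p e1 * D_half v p e1
     - (D_half X p e1 \<bullet> D_half X p e2) * (D_half u p e1 * D_half v p e2 + D_half u p e2 * D_half v p e1)
     + (D_half X p e1 \<bullet> D_half X p e1) * D_half u p e2 * D_half v p e2) / det (gram X p)"

text \<open>The two components \<open>\<Sum>j. \<surd>g g\<^sup>i\<^sup>j \<partial>\<^sub>ju\<close> of the gradient as a vector density: its coordinate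
  divergence is \<open>\<surd>g \<Delta>u\<close>.\<close>

definition flux1 :: "(real^2 \<Rightarrow> real^3) \<Rightarrow> (real^2 \<Rightarrow> real) \<Rightarrow> real^2 \<Rightarrow> real" where
  "flux1 X u p = ((D_half X p e2 \<bullet> D_half X p e2) * D_half u p e1 - (D_half X p e1 \<bullet> D_half X p e2) * D_half u p e2) / sqrt (det (gram X p))"

definition flux2 :: "(real^2 \<Rightarrow> real^3) \<Rightarrow> (real^2 \<Rightarrow> real) \<Rightarrow> real^2 \<Rightarrow> real" where
  "flux2 X u p = ((D_half X p e1 \<bullet> D_half X p e1) * D_half u p e2 - (D_half X p e1 \<bullet> D_half X p e2) * D_half u p e1) / sqrt (det (gram X p))"

lemma sqrt_times_divide:
  fixes d :: real
  assumes "0 < d" shows "sqrt d * (x / d) = x / sqrt d"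
proof -
  have "s * (x / (s * s)) = x / s" if "0 < s" for s :: real using that by simp
  from this[of "sqrt d"] assms show ?thesis by simp
qed

lemma raise_index_eq:
  fixes d :: real
  assumes "0 < d"
  shows "sqrt d * (a / d * x + b / d * y) = (a * x + b * y) / sqrt d"
proof -
  have "a / d * x + b / d * y = (a * x + b * y) / d" by (simp add: add_divide_distrib)
  then show ?thesis by (simp only: sqrt_times_divide[OF assms])
qed

lemma D_half_cong: "hopen U \<Longrightarrow> p \<in> U \<Longrightarrow> (\<And>q. q \<in> U \<Longrightarrow> f q = g q) \<Longrightarrow> D_half f p = D_half g p"
  unfolding D_half_def by (rule frechet_derivative_cong_openin)

lemma flux_grad_inner:
  assumes "0 < det (gram X p)"
  shows "D_half g p e1 * flux1 X u p + D_half g p e2 * flux2 X u p = sqrt (det (gram X p)) * grad_inner X g u p"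
  unfolding grad_inner_def flux1_def flux2_def sqrt_times_divide[OF assms]
  unfolding times_divide_eq_right add_divide_distrib[symmetric]
  by (rule arg_cong2[where f = "(/)", OF _ refl]) (simp add: algebra_simps)

lemma laplace_beltrami_flux:
  assumes U: "hopen U" and p: "p \<in> U" and pos: "\<And>q. q \<in> U \<Longrightarrow> 0 < det (gram X q)"
  shows "laplace_beltrami X u p = (D_half (flux1 X u) p e1 + D_half (flux2 X u) p e2) / sqrt (det (gram X p))"
proof -
  have f: "sqrt (det (gram X q)) * (\<Sum>j\<in>UNIV. matrix_inv (gram X q) $ 1 $ j * D_half u q (axis j 1)) = flux1 X u q"
    "sqrt (det (gram X q)) * (\<Sum>j\<in>UNIV. matrix_inv (gram X q) $ 2 $ j * D_half u q (axis j 1)) = flux2 X u q"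
    if "q \<in> U" for q
  proof -
    have d: "det (gram X q) \<noteq> 0" using pos[OF that] by simp
    show "sqrt (det (gram X q)) * (\<Sum>j\<in>UNIV. matrix_inv (gram X q) $ 1 $ j * D_half u q (axis j 1)) = flux1 X u q"
      "sqrt (det (gram X q)) * (\<Sum>j\<in>UNIV. matrix_inv (gram X q) $ 2 $ j * D_half u q (axis j 1)) = flux2 X u q"
      unfolding sum_2 matrix_inv_2[OF d] raise_index_eq[OF pos[OF that]] flux1_def flux2_def gram_entries
      by simp_all
  qed
  have F: "D_half (\<lambda>q. sqrt (det (gram X q)) * (\<Sum>j\<in>UNIV. matrix_inv (gram X q) $ 1 $ j * D_half u q (axis j 1))) p
      = D_half (flux1 X u) p"
    "D_half (\<lambda>q. sqrt (det (gram X q)) * (\<Sum>j\<in>UNIV. matrix_inv (gram X q) $ 2 $ j * D_half u q (axis j 1))) p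
      = D_half (flux2 X u) p"
    by (rule D_half_cong[OF U p], rule f, assumption)+
  show ?thesis
    unfolding laplace_beltrami_def sum_2[of "\<lambda>i. D_half (\<lambda>q. sqrt (det (gram X q)) *
        (\<Sum>j\<in>UNIV. matrix_inv (gram X q) $ i $ j * D_half u q (axis j 1))) p (axis i 1)"]
      F by simp
qed

section \<open>Calculus of partial derivatives in the half-plane\<close>

lemmas C1h_const = C1_on_const[OF thick_halfplane]
  and C2h_const = C2_on_const[OF thick_halfplane]
  and C1h_add = C1_on_add[OF thick_halfplane]
  and C2h_add = C2_on_add[OF thick_halfplane]
  and C1h_bilinear = C1_on_bilinear[OF thick_halfplane]
  and C1h_mult = C1_on_bilinear[OF thick_halfplane _ bounded_bilinear_mult]
  and C1h_inner = C1_on_bilinear[OF thick_halfplane _ bounded_bilinear_inner]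
  and C2h_inner = C2_on_bilinear[OF thick_halfplane _ bounded_bilinear_inner]
  and D_half_const = frechet_const[OF thick_halfplane, folded D_half_def]
  and D_half_add = frechet_add[OF thick_halfplane, folded D_half_def]
  and D_half_bilinear = frechet_bilinear[OF thick_halfplane, folded D_half_def]
  and D_half_mult = frechet_bilinear[OF thick_halfplane _ bounded_bilinear_mult, folded D_half_def]
  and D_half_inner = frechet_bilinear[OF thick_halfplane _ bounded_bilinear_inner, folded D_half_def]
  and D_half_chain = frechet_chain[OF thick_halfplane, where T = halfplane, folded D_half_def]
  and C1h_chain = C1_on_chain[OF thick_halfplane, where T = halfplane]
  and C2h_C1_D = C2_on_C1_deriv[where S = halfplane, folded D_half_def]
  and C1h_cont_D = C1_on_cont_deriv[where S = halfplane, folded D_half_def]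

lemma C1h_minus:
  fixes f :: "real^2 \<Rightarrow> real"
  assumes "hopen U" "C1_on halfplane f U" "C1_on halfplane g U"
  shows "C1_on halfplane (\<lambda>p. f p - g p) U"
    and "p \<in> U \<Longrightarrow> D_half (\<lambda>p. f p - g p) p a = D_half f p a - D_half g p a"
proof -
  have c: "C1_on halfplane (\<lambda>p. (- 1) * g p) U"
    by (rule C1h_mult[OF assms(1) C1h_const[OF assms(1)] assms(3)])
  show "C1_on halfplane (\<lambda>p. f p - g p) U"
    using C1h_add[OF assms(1,2) c] by simp
  show "D_half (\<lambda>p. f p - g p) p a = D_half f p a - D_half g p a" if "p \<in> U"
    using D_half_add[OF assms(1,2) c that] D_half_mult[OF assms(1) C1h_const[OF assms(1)] assms(3) that, of "-1"]
      D_half_const[OF assms(1) that, of "-1::real"] by simp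
qed

lemma flux_C1:
  assumes U: "hopen U" and X: "C2_on halfplane X U" and u: "C2_on halfplane u U"
    and pos: "\<And>q. q \<in> U \<Longrightarrow> 0 < det (gram X q)"
  shows "C1_on halfplane (\<lambda>p. det (gram X p)) U" "C1_on halfplane (flux1 X u) U" "C1_on halfplane (flux2 X u) U"
proof -
  have g: "C1_on halfplane (\<lambda>p. D_half X p a \<bullet> D_half X p b) U" for a b
    by (rule C1h_inner[OF U C2h_C1_D[OF X] C2h_C1_D[OF X]])
  show d: "C1_on halfplane (\<lambda>p. det (gram X p)) U"
    unfolding det_gram power2_eq_square by (intro C1h_minus[OF U] C1h_mult[OF U] g)
  have r: "C1_on halfplane (\<lambda>p. inverse (sqrt (det (gram X p)))) U"
  proof (rule C1_on_real_comp[OF thick_halfplane U d])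
    show "(\<lambda>p. det (gram X p)) ` U \<subseteq> {0<..}" using pos by auto
    show "((\<lambda>x. inverse (sqrt x)) has_real_derivative - (inverse (sqrt x) / 2 * inverse (sqrt x) * inverse (sqrt x))) (at x)"
      if "x \<in> {0<..}" for x :: real
      using that by (auto intro!: derivative_eq_intros simp: field_simps)
    show "continuous_on {0::real<..} (\<lambda>x. - (inverse (sqrt x) / 2 * inverse (sqrt x) * inverse (sqrt x)))"
      by (auto intro!: continuous_intros)
  qed
  show "C1_on halfplane (flux1 X u) U" "C1_on halfplane (flux2 X u) U"
    unfolding flux1_def[abs_def] flux2_def[abs_def] divide_inverse
    by (intro C1h_minus[OF U] C1h_mult[OF U] g r C2h_C1_D[OF u])+
qed

text \<open>Square roots of determinants involve the sign of a Jacobian or of an orientation. Locally these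
  signs are constant, so that they can be pulled out of derivatives.\<close>

lemma sgn_locally_constant:
  fixes k :: "real^2 \<Rightarrow> real"
  assumes S: "hopen S" and k: "continuous_on S k" and p: "p \<in> S" "k p \<noteq> 0"
  obtains S' where "hopen S'" "S' \<subseteq> S" "p \<in> S'" "\<And>q. q \<in> S' \<Longrightarrow> sgn (k q) = sgn (k p)"
proof
  have "openin (top_of_set S) (S \<inter> (\<lambda>q. k p * k q) -` {0<..})"
    using k by (intro continuous_openin_preimage_gen continuous_intros) auto
  then show "hopen (S \<inter> (\<lambda>q. k p * k q) -` {0<..})" using openin_trans S by blast
  show "p \<in> S \<inter> (\<lambda>q. k p * k q) -` {0<..}"
    using p by (auto simp: zero_less_mult_iff neq_iff)
  show "sgn (k q) = sgn (k p)" if "q \<in> S \<inter> (\<lambda>q. k p * k q) -` {0<..}" for q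
    using that by (auto simp: zero_less_mult_iff)
qed auto

section \<open>Change of coordinates\<close>

lemma inner_combination:
  "(a *\<^sub>R x + c *\<^sub>R y) \<bullet> (b *\<^sub>R x + d *\<^sub>R y) = a * b * (x \<bullet> x) + (a * d + c * b) * (x \<bullet> y) + c * d * (y \<bullet> y)"
  by (simp add: inner_add_left inner_add_right inner_commute algebra_simps)

definition jac :: "(real^2 \<Rightarrow> real^2) \<Rightarrow> real^2 \<Rightarrow> real" where
  "jac \<tau> p = D_half \<tau> p e1 $ 1 * D_half \<tau> p e2 $ 2 - D_half \<tau> p e2 $ 1 * D_half \<tau> p e1 $ 2"

locale coordinate_change =
  fixes S T :: "(real^2) set" and \<tau> :: "real^2 \<Rightarrow> real^2" and X Y :: "real^2 \<Rightarrow> real^3"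
  assumes S: "hopen S" and T: "hopen T" and \<tau>: "C2_on halfplane \<tau> S" and ST: "\<tau> ` S \<subseteq> T"
    and \<tau>_sym: "\<And>p a b. p \<in> S \<Longrightarrow> D_half (\<lambda>q. D_half \<tau> q a) p b = D_half (\<lambda>q. D_half \<tau> q b) p a"
    and Y: "C2_on halfplane Y T" and XY: "\<forall>p\<in>S. X p = Y (\<tau> p)"
    and posX: "\<And>p. p \<in> S \<Longrightarrow> 0 < det (gram X p)" and posY: "\<And>p. p \<in> T \<Longrightarrow> 0 < det (gram Y p)"
begin

lemma D_comp:
  assumes "C1_on halfplane v T" "\<forall>p\<in>S. u p = v (\<tau> p)" "p \<in> S"
  shows "D_half u p a = D_half v (\<tau> p) (D_half \<tau> p a)"
    "D_half u p a = D_half \<tau> p a $ 1 *\<^sub>R D_half v (\<tau> p) e1 + D_half \<tau> p a $ 2 *\<^sub>R D_half v (\<tau> p) e2"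
proof -
  have "D_half u p = D_half (\<lambda>p. v (\<tau> p)) p" by (rule D_half_cong[OF S assms(3)]) (use assms(2) in blast)
  also have "\<dots> = (\<lambda>a. D_half v (\<tau> p) (D_half \<tau> p a))"
    by (rule D_half_chain[OF S assms(1) T C2_on_C1[OF \<tau>] ST assms(3)])
  finally show 1: "D_half u p a = D_half v (\<tau> p) (D_half \<tau> p a)" by simp
  show "D_half u p a = D_half \<tau> p a $ 1 *\<^sub>R D_half v (\<tau> p) e1 + D_half \<tau> p a $ 2 *\<^sub>R D_half v (\<tau> p) e2"
    unfolding 1 by (rule D_half_expand[OF assms(1)]) (use assms ST in auto)
qed

lemmas DX = D_comp(2)[OF C2_on_C1[OF Y] XY]

lemma det_gram_change: "p \<in> S \<Longrightarrow> det (gram X p) = (jac \<tau> p)\<^sup>2 * det (gram Y (\<tau> p))"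
  unfolding det_gram DX jac_def inner_combination by algebra

lemma jac_nonzero: "p \<in> S \<Longrightarrow> jac \<tau> p \<noteq> 0"
  using posX[of p] by (auto simp: det_gram_change)

lemma grad_inner_change:
  assumes p: "p \<in> S" and "C1_on halfplane v T" "\<forall>p\<in>S. u p = v (\<tau> p)"
    and "C1_on halfplane v' T" "\<forall>p\<in>S. u' p = v' (\<tau> p)"
  shows "grad_inner X u u' p = grad_inner Y v v' (\<tau> p)"
proof -
  have "(D_half X p e2 \<bullet> D_half X p e2) * D_half u p e1 * D_half u' p e1
     - (D_half X p e1 \<bullet> D_half X p e2) * (D_half u p e1 * D_half u' p e2 + D_half u p e2 * D_half u' p e1)
     + (D_half X p e1 \<bullet> D_half X p e1) * D_half u p e2 * D_half u' p e2
    = (jac \<tau> p)\<^sup>2 * ((D_half Y (\<tau> p) e2 \<bullet> D_half Y (\<tau> p) e2) * D_half v (\<tau> p) e1 * D_half v' (\<tau> p) e1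
     - (D_half Y (\<tau> p) e1 \<bullet> D_half Y (\<tau> p) e2) * (D_half v (\<tau> p) e1 * D_half v' (\<tau> p) e2 + D_half v (\<tau> p) e2 * D_half v' (\<tau> p) e1)
     + (D_half Y (\<tau> p) e1 \<bullet> D_half Y (\<tau> p) e1) * D_half v (\<tau> p) e2 * D_half v' (\<tau> p) e2)"
    unfolding DX[OF p] D_comp(2)[OF assms(2,3) p] D_comp(2)[OF assms(4,5) p] jac_def
      inner_combination real_scaleR_def by algebra
  then show ?thesis unfolding grad_inner_def det_gram_change[OF p] using jac_nonzero[OF p] by simp
qed

lemma flux_change:
  assumes p: "p \<in> S" and v: "C1_on halfplane v T" "\<forall>p\<in>S. u p = v (\<tau> p)"
  shows "flux1 X u p = sgn (jac \<tau> p) * (D_half \<tau> p e2 $ 2 * flux1 Y v (\<tau> p) - D_half \<tau> p e2 $ 1 * flux2 Y v (\<tau> p))"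
    "flux2 X u p = sgn (jac \<tau> p) * (D_half \<tau> p e1 $ 1 * flux2 Y v (\<tau> p) - D_half \<tau> p e1 $ 2 * flux1 Y v (\<tau> p))"
proof -
  have sq: "sqrt (det (gram X p)) = \<bar>jac \<tau> p\<bar> * sqrt (det (gram Y (\<tau> p)))"
    by (simp add: det_gram_change[OF p] real_sqrt_mult)
  have j: "x / (\<bar>j\<bar> * r) = sgn j * (y / r)" if "x = j * y" "j \<noteq> 0" for x y j r :: real
    using that by (auto simp: sgn_if abs_if)
  have 1: "(D_half X p e2 \<bullet> D_half X p e2) * D_half u p e1 - (D_half X p e1 \<bullet> D_half X p e2) * D_half u p e2
    = jac \<tau> p * (D_half \<tau> p e2 $ 2 * ((D_half Y (\<tau> p) e2 \<bullet> D_half Y (\<tau> p) e2) * D_half v (\<tau> p) e1 - (D_half Y (\<tau> p) e1 \<bullet> D_half Y (\<tau> p) e2) * D_half v (\<tau> p) e2)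
      - D_half \<tau> p e2 $ 1 * ((D_half Y (\<tau> p) e1 \<bullet> D_half Y (\<tau> p) e1) * D_half v (\<tau> p) e2 - (D_half Y (\<tau> p) e1 \<bullet> D_half Y (\<tau> p) e2) * D_half v (\<tau> p) e1))"
    unfolding DX[OF p] D_comp(2)[OF v p] jac_def inner_combination real_scaleR_def by algebra
  have 2: "(D_half X p e1 \<bullet> D_half X p e1) * D_half u p e2 - (D_half X p e1 \<bullet> D_half X p e2) * D_half u p e1
    = jac \<tau> p * (D_half \<tau> p e1 $ 1 * ((D_half Y (\<tau> p) e1 \<bullet> D_half Y (\<tau> p) e1) * D_half v (\<tau> p) e2 - (D_half Y (\<tau> p) e1 \<bullet> D_half Y (\<tau> p) e2) * D_half v (\<tau> p) e1)
      - D_half \<tau> p e1 $ 2 * ((D_half Y (\<tau> p) e2 \<bullet> D_half Y (\<tau> p) e2) * D_half v (\<tau> p) e1 - (D_half Y (\<tau> p) e1 \<bullet> D_half Y (\<tau> p) e2) * D_half v (\<tau> p) e2))"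
    unfolding DX[OF p] D_comp(2)[OF v p] jac_def inner_combination real_scaleR_def by algebra
  show "flux1 X u p = sgn (jac \<tau> p) * (D_half \<tau> p e2 $ 2 * flux1 Y v (\<tau> p) - D_half \<tau> p e2 $ 1 * flux2 Y v (\<tau> p))"
    "flux2 X u p = sgn (jac \<tau> p) * (D_half \<tau> p e1 $ 1 * flux2 Y v (\<tau> p) - D_half \<tau> p e1 $ 2 * flux1 Y v (\<tau> p))"
    unfolding flux1_def flux2_def sq j[OF 1 jac_nonzero[OF p]] j[OF 2 jac_nonzero[OF p]]
    by (simp_all only: times_divide_eq_right diff_divide_distrib[symmetric])
qed

lemma C1_D_component: "C1_on halfplane (\<lambda>p. D_half \<tau> p a $ i) S"
    and D_D_component: "p \<in> S \<Longrightarrow> D_half (\<lambda>p. D_half \<tau> p a $ i) p b = D_half (\<lambda>p. D_half \<tau> p a) p b $ i"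
proof -
  note c = C2h_C1_D[OF \<tau>, of a]
  have d: "((\<lambda>p. D_half \<tau> p a $ i) has_derivative (\<lambda>b. D_half (\<lambda>p. D_half \<tau> p a) p b $ i)) (at p within halfplane)"
    if "p \<in> S" for p
    using bounded_linear.has_derivative[OF bounded_linear_vec_nth C1_onD[OF c that], of i]
    unfolding D_half_def .
  then show "C1_on halfplane (\<lambda>p. D_half \<tau> p a $ i) S"
    by (rule C1_on_I[OF thick_halfplane openin_imp_subset[OF S]])
       (auto intro!: continuous_on_component C1h_cont_D[OF c])
  assume p: "p \<in> S"
  show "D_half (\<lambda>p. D_half \<tau> p a $ i) p b = D_half (\<lambda>p. D_half \<tau> p a) p b $ i"
    using frechet_derivative_thick[OF thick_halfplane _ d[OF p]] openin_imp_subset[OF S] p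
    unfolding D_half_def[of "\<lambda>p. D_half \<tau> p a $ i"] by auto
qed

text \<open>By \<open>flux_change\<close> the flux transforms, up to a sign, by the adjugate of the Jacobian matrix of \<open>\<tau>\<close>. The columns
  of the adjugate are divergence-free (Piola's identity, from the symmetry of second derivatives), so
  only the first derivatives of the flux remain.\<close>

lemma laplace_beltrami_change:
  assumes p: "p \<in> S" and v: "C2_on halfplane v T" "\<forall>p\<in>S. u p = v (\<tau> p)"
  shows "laplace_beltrami X u p = laplace_beltrami Y v (\<tau> p)"
proof -
  let ?s = "sgn (jac \<tau> p)"
  let ?A = "\<lambda>q. flux1 Y v (\<tau> q)" and ?B = "\<lambda>q. flux2 Y v (\<tau> q)"
  note v1 = C2_on_C1[OF v(1)]
  have jC: "continuous_on S (jac \<tau>)"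
    unfolding jac_def[abs_def]
    by (intro continuous_on_diff continuous_on_mult C1_on_cont[OF C1_D_component openin_imp_subset[OF S]])
  obtain S' where S': "hopen S'" and S'S: "S' \<subseteq> S" and p': "p \<in> S'"
    and sgn: "\<And>q. q \<in> S' \<Longrightarrow> sgn (jac \<tau> q) = ?s"
    using sgn_locally_constant[OF S jC p jac_nonzero[OF p]] by blast
  have AB: "C1_on halfplane ?A S" "C1_on halfplane ?B S"
    using flux_C1(2,3)[OF T Y v(1) posY] by (auto intro!: C1h_chain[OF S _ T C2_on_C1[OF \<tau>] ST])
  have dAB: "D_half ?A p a = D_half \<tau> p a $ 1 * D_half (flux1 Y v) (\<tau> p) e1 + D_half \<tau> p a $ 2 * D_half (flux1 Y v) (\<tau> p) e2"
     "D_half ?B p a = D_half \<tau> p a $ 1 * D_half (flux2 Y v) (\<tau> p) e1 + D_half \<tau> p a $ 2 * D_half (flux2 Y v) (\<tau> p) e2" for a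
    using D_comp(2)[OF flux_C1(2)[OF T Y v(1) posY], of ?A p a] D_comp(2)[OF flux_C1(3)[OF T Y v(1) posY], of ?B p a] p
    by simp_all
  note m = C1h_mult[OF S C1_D_component]
  note k = C1h_const[OF S, of ?s]
  have "D_half (flux1 X u) p = D_half (\<lambda>q. ?s * (D_half \<tau> q e2 $ 2 * ?A q - D_half \<tau> q e2 $ 1 * ?B q)) p"
    by (rule D_half_cong[OF S' p']) (use S'S sgn flux_change(1)[OF _ v1 v(2)] in auto)
  then have 1: "D_half (flux1 X u) p e1 = ?s * (D_half \<tau> p e2 $ 2 * D_half ?A p e1 + D_half (\<lambda>q. D_half \<tau> q e2) p e1 $ 2 * ?A p
      - D_half \<tau> p e2 $ 1 * D_half ?B p e1 - D_half (\<lambda>q. D_half \<tau> q e2) p e1 $ 1 * ?B p)"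
    by (simp add: D_half_mult[OF S k C1h_minus(1)[OF S m[OF AB(1)] m[OF AB(2)]] p] D_half_const[OF S p]
      C1h_minus(2)[OF S m[OF AB(1)] m[OF AB(2)] p] D_half_mult[OF S C1_D_component AB(1) p]
      D_half_mult[OF S C1_D_component AB(2) p] D_D_component[OF p])
  have "D_half (flux2 X u) p = D_half (\<lambda>q. ?s * (D_half \<tau> q e1 $ 1 * ?B q - D_half \<tau> q e1 $ 2 * ?A q)) p"
    by (rule D_half_cong[OF S' p']) (use S'S sgn flux_change(2)[OF _ v1 v(2)] in auto)
  then have 2: "D_half (flux2 X u) p e2 = ?s * (D_half \<tau> p e1 $ 1 * D_half ?B p e2 + D_half (\<lambda>q. D_half \<tau> q e1) p e2 $ 1 * ?B p
      - D_half \<tau> p e1 $ 2 * D_half ?A p e2 - D_half (\<lambda>q. D_half \<tau> q e1) p e2 $ 2 * ?A p)"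
    by (simp add: D_half_mult[OF S k C1h_minus(1)[OF S m[OF AB(2)] m[OF AB(1)]] p] D_half_const[OF S p]
      C1h_minus(2)[OF S m[OF AB(2)] m[OF AB(1)] p] D_half_mult[OF S C1_D_component AB(1) p]
      D_half_mult[OF S C1_D_component AB(2) p] D_D_component[OF p])
  have 3: "D_half (flux1 X u) p e1 + D_half (flux2 X u) p e2
    = (?s * jac \<tau> p) * (D_half (flux1 Y v) (\<tau> p) e1 + D_half (flux2 Y v) (\<tau> p) e2)"
    unfolding 1 2 dAB jac_def \<tau>_sym[OF p, of e2 e1] by algebra
  have "?s * jac \<tau> p = \<bar>jac \<tau> p\<bar>" by (simp add: sgn_mult_self_eq abs_sgn mult.commute)
  moreover have "sqrt (det (gram X p)) = \<bar>jac \<tau> p\<bar> * sqrt (det (gram Y (\<tau> p)))"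
    by (simp add: det_gram_change[OF p] real_sqrt_mult)
  ultimately show ?thesis
    using laplace_beltrami_flux[OF S p posX, of u] laplace_beltrami_flux[OF T _ posY, of "\<tau> p" v] ST p jac_nonzero[OF p] 3
    by auto
qed

end

section \<open>Minimal surfaces in coordinates\<close>

lemma bounded_bilinear_cross3: "bounded_bilinear cross3"
  by (simp add: bilinear_conv_bounded_bilinear[symmetric] bilinear_cross)

locale minimal_chart =
  fixes U :: "(real^2) set" and X N :: "real^2 \<Rightarrow> real^3"
  assumes U: "hopen U" and X: "C2_on halfplane X U" and N: "C2_on halfplane N U"
    and X_sym: "\<And>p a b. p \<in> U \<Longrightarrow> D_half (\<lambda>q. D_half X q a) p b = D_half (\<lambda>q. D_half X q b) p a"
    and N_sym: "\<And>p a b. p \<in> U \<Longrightarrow> D_half (\<lambda>q. D_half N q a) p b = D_half (\<lambda>q. D_half N q b) p a"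
    and N_unit: "\<forall>p\<in>U. norm (N p) = 1"
    and N_normal: "\<forall>p\<in>U. \<forall>a. N p \<bullet> D_half X p a = 0"
    and inj: "\<And>p. p \<in> U \<Longrightarrow> inj (D_half X p)"
    and minimal: "\<And>p. p \<in> U \<Longrightarrow> mean_curvature X N p = 0"
begin

lemmas X1 = C2_on_C1[OF X] and N1 = C2_on_C1[OF N]

lemma pos: "p \<in> U \<Longrightarrow> 0 < det (gram X p)"
  by (rule det_gram_pos[OF X1 _ inj])

lemma N_DN: assumes "p \<in> U" shows "N p \<bullet> D_half N p a = 0"
proof -
  have "D_half (\<lambda>q. N q \<bullet> N q) p a = D_half (\<lambda>q. 1::real) p a"
    by (rule fun_cong[OF D_half_cong[OF U assms]]) (use N_unit in \<open>simp add: norm_eq_1\<close>)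
  then show ?thesis
    by (simp add: D_half_inner[OF U N1 N1 assms] D_half_const[OF U assms] inner_commute)
qed

lemma sff_eq: assumes "p \<in> U" shows "sff X N p a b = - (N p \<bullet> D_half (\<lambda>q. D_half X q b) p a)"
proof -
  have "D_half (\<lambda>q. N q \<bullet> D_half X q b) p a = D_half (\<lambda>q. 0::real) p a"
    by (rule fun_cong[OF D_half_cong[OF U assms]]) (use N_normal in simp)
  then show ?thesis
    by (simp add: D_half_inner[OF U N1 C2h_C1_D[OF X] assms] D_half_const[OF U assms] sff_def inner_commute)
qed

lemma sff_sym: "p \<in> U \<Longrightarrow> sff X N p a b = sff X N p b a"
  by (simp add: sff_eq X_sym)

lemma sff_bilinear:
  assumes p: "p \<in> U"
  shows "sff X N p a b = a $ 1 * b $ 1 * sff X N p e1 e1 + (a $ 1 * b $ 2 + a $ 2 * b $ 1) * sff X N p e1 e2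
    + a $ 2 * b $ 2 * sff X N p e2 e2"
proof -
  have "sff X N p a b = a $ 1 * b $ 1 * sff X N p e1 e1 + a $ 1 * b $ 2 * sff X N p e1 e2
    + a $ 2 * b $ 1 * sff X N p e2 e1 + a $ 2 * b $ 2 * sff X N p e2 e2"
    unfolding sff_def D_half_expand[OF X1 p, of b] D_half_expand[OF N1 p, of a]
    by (simp add: inner_add_left inner_add_right algebra_simps)
  then show ?thesis by (simp add: sff_sym[OF p, of e2 e1] algebra_simps)
qed

lemma trace_free:
  assumes p: "p \<in> U"
  shows "(D_half X p e2 \<bullet> D_half X p e2) * sff X N p e1 e1 - 2 * (D_half X p e1 \<bullet> D_half X p e2) * sff X N p e1 e2
    + (D_half X p e1 \<bullet> D_half X p e1) * sff X N p e2 e2 = 0"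
proof -
  have d: "det (gram X p) \<noteq> 0" using pos[OF p] by simp
  have "0 = det (gram X p) * mean_curvature X N p" using minimal[OF p] by simp
  also have "\<dots> = (D_half X p e2 \<bullet> D_half X p e2) * sff X N p e1 e1 - 2 * (D_half X p e1 \<bullet> D_half X p e2) * sff X N p e1 e2
    + (D_half X p e1 \<bullet> D_half X p e1) * sff X N p e2 e2"
    unfolding mean_curvature_def sum_2 matrix_inv_2[OF d] gram_entries sff_sym[OF p, of e2 e1]
    using d by (simp add: ring_distribs)
  finally show ?thesis by simp
qed

text \<open>For a trace-free operator \<open>S\<close> on a plane, \<open>tr (S\<^sup>2) = - 2 det S\<close> by Cayley-Hamilton. Here \<open>S\<close> is the
  shape operator: the inverse Gram matrix times the matrix of the second fundamental form.\<close>

lemma norm_sq_identity: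
  fixes D :: real
  assumes D: "D = E * G - F\<^sup>2" "D \<noteq> 0" and tr: "G * h11 - 2 * F * h12 + E * h22 = 0"
  shows "G/D * (G/D) * h11 * h11 + G/D * (-F/D) * h11 * h12 * 2 + (-F/D) * (G/D) * h11 * h12 * 2
    + (-F/D) * (-F/D) * h11 * h22 * 2 + (-F/D) * (-F/D) * h12 * h12 * 2 + G/D * (E/D) * h12 * h12 * 2
    + (-F/D) * (E/D) * h12 * h22 * 2 + E/D * (-F/D) * h12 * h22 * 2 + E/D * (E/D) * h22 * h22
    = - 2 * (h11 * h22 - h12\<^sup>2) / D"
proof -
  have "G * G * h11 * h11 - 4 * G * F * h11 * h12 + 2 * F * F * h11 * h22 + 2 * F * F * h12 * h12 + 2 * G * E * h12 * h12
     - 4 * F * E * h12 * h22 + E * E * h22 * h22 = - 2 * (h11 * h22 - h12\<^sup>2) * D"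
    using D(1) tr by algebra
  then have "(G * G * h11 * h11 - 4 * G * F * h11 * h12 + 2 * F * F * h11 * h22 + 2 * F * F * h12 * h12 + 2 * G * E * h12 * h12
     - 4 * F * E * h12 * h22 + E * E * h22 * h22) / D / D = - 2 * (h11 * h22 - h12\<^sup>2) / D"
    using D(2) by simp
  then show ?thesis by (simp add: add_divide_distrib diff_divide_distrib mult_ac)
qed

lemma sff_norm_sq_eq:
  assumes p: "p \<in> U"
  shows "sff_norm_sq X N p = - 2 * (sff X N p e1 e1 * sff X N p e2 e2 - (sff X N p e1 e2)\<^sup>2) / det (gram X p)"
proof -
  have d: "det (gram X p) \<noteq> 0" using pos[OF p] by simp
  show ?thesis
    unfolding norm_sq_identity[OF det_gram d trace_free[OF p], symmetric]
    unfolding sff_norm_sq_def Let_def sum_2 matrix_inv_2[OF d] gram_entries sff_sym[OF p, of e2 e1]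
    by (simp add: mult_ac)
qed

text \<open>The trace condition turns \<open>4 E G (h11 h22 - h12\<^sup>2)\<close> into minus the sum of the square
  \<open>(G h11 - E h22)\<^sup>2\<close> and the nonnegative term \<open>4 (E G - F\<^sup>2) h12\<^sup>2\<close>.\<close>

lemma sff_det_nonpos:
  assumes p: "p \<in> U"
  shows "sff X N p e1 e1 * sff X N p e2 e2 - (sff X N p e1 e2)\<^sup>2 \<le> 0"
    and "sff X N p e1 e1 * sff X N p e2 e2 - (sff X N p e1 e2)\<^sup>2 = 0 \<Longrightarrow> sff X N p a b = 0"
proof -
  define E F G where "E = D_half X p e1 \<bullet> D_half X p e1" and "F = D_half X p e1 \<bullet> D_half X p e2"
    and "G = D_half X p e2 \<bullet> D_half X p e2"
  define h11 h12 h22 where "h11 = sff X N p e1 e1" and "h12 = sff X N p e1 e2" and "h22 = sff X N p e2 e2"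
  have tr: "G * h11 - 2 * F * h12 + E * h22 = 0"
    using trace_free[OF p] by (simp add: E_def F_def G_def h11_def h12_def h22_def)
  have D: "0 < E * G - F\<^sup>2" using pos[OF p] by (simp add: det_gram E_def F_def G_def)
  have "0 \<le> E" by (simp add: E_def)
  have EG: "0 < E" "0 < G"
  proof -
    have "0 < E * G" using D zero_le_power2[of F] by linarith
    then show "0 < E" "0 < G" using \<open>0 \<le> E\<close> by (auto simp: zero_less_mult_iff)
  qed
  have id: "(G * h11 - E * h22)\<^sup>2 + 4 * E * G * (h11 * h22 - h12\<^sup>2) = - 4 * (E * G - F\<^sup>2) * h12\<^sup>2"
    using tr by algebra
  have "4 * E * G * (h11 * h22 - h12\<^sup>2) \<le> 0"
    using id D zero_le_power2[of "G * h11 - E * h22"] mult_nonneg_nonneg[OF less_imp_le[OF D] zero_le_power2[of h12]] by linarith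
  then have "h11 * h22 - h12\<^sup>2 \<le> 0" using EG by (simp add: mult_le_0_iff)
  then show "sff X N p e1 e1 * sff X N p e2 e2 - (sff X N p e1 e2)\<^sup>2 \<le> 0"
    by (simp add: h11_def h12_def h22_def)
  assume "sff X N p e1 e1 * sff X N p e2 e2 - (sff X N p e1 e2)\<^sup>2 = 0"
  then have z: "h11 * h22 - h12\<^sup>2 = 0" by (simp add: h11_def h12_def h22_def)
  have "(G * h11 - E * h22)\<^sup>2 = - (4 * ((E * G - F\<^sup>2) * h12\<^sup>2))" using id z by algebra
  then have "(E * G - F\<^sup>2) * h12\<^sup>2 \<le> 0" using zero_le_power2[of "G * h11 - E * h22"] by linarith
  then have h12: "h12 = 0" using D by (simp add: mult_le_0_iff)
  then have "h11 = 0 \<or> h22 = 0" "G * h11 + E * h22 = 0" using z tr by auto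
  then have "h11 = 0" "h22 = 0" using EG by auto
  with h12 show "sff X N p a b = 0"
    by (simp add: sff_bilinear[OF p, of a b] h11_def h12_def h22_def)
qed

lemma sff_norm_sq_nonneg: assumes p: "p \<in> U" shows "0 \<le> sff_norm_sq X N p"
proof -
  have "0 \<le> - 2 * x / d" if "x \<le> 0" "0 < d" for x d :: real
    using that by (simp add: divide_nonpos_pos)
  then show ?thesis unfolding sff_norm_sq_eq[OF p] using sff_det_nonpos(1)[OF p] pos[OF p] by blast
qed

lemma sff_norm_sq_zero: assumes p: "p \<in> U" "sff_norm_sq X N p = 0" shows "sff X N p a b = 0"
proof (rule sff_det_nonpos(2)[OF p(1)])
  show "sff X N p e1 e1 * sff X N p e2 e2 - (sff X N p e1 e2)\<^sup>2 = 0"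
  proof -
    have "x = 0" if "- 2 * x / d = 0" "0 < d" for x d :: real using that by simp
    then show ?thesis using p(2) pos[OF p(1)] unfolding sff_norm_sq_eq[OF p(1)] by blast
  qed
qed

lemma det_gram_cont: "continuous_on U (\<lambda>p. det (gram X p))"
  unfolding det_gram by (intro continuous_on_diff continuous_on_mult continuous_on_power continuous_on_inner C1h_cont_D[OF X1])

lemma sff_norm_sq_cont: "continuous_on U (sff_norm_sq X N)"
proof -
  have "continuous_on U (\<lambda>p. - 2 * (sff X N p e1 e1 * sff X N p e2 e2 - (sff X N p e1 e2)\<^sup>2) / det (gram X p))"
    unfolding sff_def
    by (intro continuous_on_divide continuous_on_diff continuous_on_mult continuous_on_power continuous_on_inner
      continuous_on_const C1h_cont_D[OF X1] C1h_cont_D[OF N1] det_gram_cont) (use pos in fastforce)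
  then show ?thesis by (rule continuous_on_eq) (simp add: sff_norm_sq_eq)
qed

section \<open>The normal as an eigenfunction of the Laplacian\<close>

abbreviation XX :: "real^2 \<Rightarrow> real^3" where "XX p \<equiv> cross3 (D_half X p e1) (D_half X p e2)"

lemma XX_sq: "p \<in> U \<Longrightarrow> XX p \<bullet> XX p = det (gram X p)"
  by (simp add: det_gram_cross power2_norm_eq_inner)

lemma normal_multiple:
  assumes p: "p \<in> U" and v: "v \<bullet> D_half X p e1 = 0" "v \<bullet> D_half X p e2 = 0"
  shows "det (gram X p) *\<^sub>R v = (v \<bullet> XX p) *\<^sub>R XX p"
proof -
  have "cross3 (XX p) v = 0"
    using v Lagrange[of v "D_half X p e1" "D_half X p e2"] cross_skew[of "XX p" v] by (simp add: inner_commute)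
  then have "0 = cross3 (XX p) (cross3 (XX p) v)" by simp
  also have "\<dots> = (XX p \<bullet> v) *\<^sub>R XX p - (XX p \<bullet> XX p) *\<^sub>R v" by (rule Lagrange)
  finally show ?thesis by (simp add: XX_sq[OF p] inner_commute)
qed

lemma XX_N: assumes p: "p \<in> U" shows "XX p = (XX p \<bullet> N p) *\<^sub>R N p" "(XX p \<bullet> N p)\<^sup>2 = det (gram X p)"
proof -
  have 1: "det (gram X p) *\<^sub>R N p = (N p \<bullet> XX p) *\<^sub>R XX p"
    using N_normal p by (intro normal_multiple) auto
  have "det (gram X p) *\<^sub>R N p \<bullet> N p = (N p \<bullet> XX p) *\<^sub>R XX p \<bullet> N p" by (simp only: 1)
  then show 2: "(XX p \<bullet> N p)\<^sup>2 = det (gram X p)"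
    using N_unit p by (simp add: norm_eq_1 power2_eq_square inner_commute)
  then have k: "XX p \<bullet> N p \<noteq> 0" using pos[OF p] by auto
  have "(XX p \<bullet> N p) *\<^sub>R ((XX p \<bullet> N p) *\<^sub>R N p) = (XX p \<bullet> N p) *\<^sub>R XX p"
    using 1 2 by (simp add: power2_eq_square inner_commute)
  then show "XX p = (XX p \<bullet> N p) *\<^sub>R N p" using k by (metis scaleR_cancel_left)
qed

lemma tangent_normal_zero:
  assumes p: "p \<in> U" and v: "v \<bullet> D_half X p e1 = 0" "v \<bullet> D_half X p e2 = 0" "v \<bullet> N p = 0"
  shows "v = 0"
proof -
  have "v \<bullet> XX p = 0" using v(3) by (subst XX_N(1)[OF p]) simp
  then show ?thesis using normal_multiple[OF p v(1,2)] pos[OF p] by simp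
qed

text \<open>The Gauss map of a minimal surface is anticonformal: raising the index of \<open>d\<nu>\<close> amounts to a
  rotation by a right angle, that is, to a cross product with the normal. Both sides are tangent to
  the surface, and their inner products with the tangent vectors agree because the trace vanishes.\<close>

lemma flux_N_vector:
  assumes p: "p \<in> U"
  shows "(D_half X p e2 \<bullet> D_half X p e2) *\<^sub>R D_half N p e1 - (D_half X p e1 \<bullet> D_half X p e2) *\<^sub>R D_half N p e2
      = - cross3 (D_half N p e2) (XX p)"
    "(D_half X p e1 \<bullet> D_half X p e1) *\<^sub>R D_half N p e2 - (D_half X p e1 \<bullet> D_half X p e2) *\<^sub>R D_half N p e1
      = - cross3 (XX p) (D_half N p e1)"
proof -
  have n: "D_half N p a \<bullet> N p = 0" "D_half X p a \<bullet> N p = 0" for a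
    using N_DN[OF p] N_normal p by (auto simp: inner_commute)
  have h: "D_half N p a \<bullet> D_half X p b = sff X N p a b" for a b by (simp add: sff_def)
  have c: "D_half X p e2 \<bullet> D_half X p e1 = D_half X p e1 \<bullet> D_half X p e2" by (rule inner_commute)
  note s = sff_sym[OF p, of e2 e1]
  have "(D_half X p e2 \<bullet> D_half X p e2) *\<^sub>R D_half N p e1 - (D_half X p e1 \<bullet> D_half X p e2) *\<^sub>R D_half N p e2
      + cross3 (D_half N p e2) (XX p) = 0"
    unfolding Lagrange
    by (rule tangent_normal_zero[OF p])
       (use trace_free[OF p] in \<open>simp_all add: inner_diff_left inner_add_left h n c s algebra_simps\<close>)
  then show "(D_half X p e2 \<bullet> D_half X p e2) *\<^sub>R D_half N p e1 - (D_half X p e1 \<bullet> D_half X p e2) *\<^sub>R D_half N p e2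
      = - cross3 (D_half N p e2) (XX p)" by (simp add: eq_neg_iff_add_eq_0)
  have "(D_half X p e1 \<bullet> D_half X p e1) *\<^sub>R D_half N p e2 - (D_half X p e1 \<bullet> D_half X p e2) *\<^sub>R D_half N p e1
      - cross3 (D_half N p e1) (XX p) = 0"
    unfolding Lagrange
    by (rule tangent_normal_zero[OF p])
       (use trace_free[OF p] in \<open>simp_all add: inner_diff_left inner_add_left h n c s algebra_simps\<close>)
  then show "(D_half X p e1 \<bullet> D_half X p e1) *\<^sub>R D_half N p e2 - (D_half X p e1 \<bullet> D_half X p e2) *\<^sub>R D_half N p e1
      = - cross3 (XX p) (D_half N p e1)" by (simp add: cross_skew[of "XX p"])
qed

text \<open>The Gauss map multiplies the area element by the Gauss curvature.\<close>

lemma DN_cross: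
  assumes p: "p \<in> U"
  shows "cross3 (D_half N p e1) (D_half N p e2)
    = ((sff X N p e1 e1 * sff X N p e2 e2 - (sff X N p e1 e2)\<^sup>2) / det (gram X p)) *\<^sub>R XX p"
proof -
  let ?c = "cross3 (D_half N p e1) (D_half N p e2)"
  have "cross3 (N p) ?c = 0" using N_DN[OF p] by (simp add: Lagrange)
  then have "cross3 (N p) (cross3 (N p) ?c) = 0" by simp
  then have c: "?c = (N p \<bullet> ?c) *\<^sub>R N p"
    using N_unit p by (simp add: Lagrange[of "N p" "N p" ?c] norm_eq_1)
  have "?c \<bullet> D_half X p a = 0" for a by (subst c) (use N_normal p in simp)
  from normal_multiple[OF p this this] have "det (gram X p) *\<^sub>R ?c = (?c \<bullet> XX p) *\<^sub>R XX p" .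
  moreover have "?c \<bullet> XX p = sff X N p e1 e1 * sff X N p e2 e2 - (sff X N p e1 e2)\<^sup>2"
    unfolding power2_eq_square by (subst (3) sff_sym[OF p]) (simp add: dot_cross sff_def)
  ultimately have "(1 / det (gram X p)) *\<^sub>R det (gram X p) *\<^sub>R ?c
      = (1 / det (gram X p)) *\<^sub>R (sff X N p e1 e1 * sff X N p e2 e2 - (sff X N p e1 e2)\<^sup>2) *\<^sub>R XX p" by simp
  then show ?thesis using pos[OF p] by simp
qed

text \<open>With the flux written as \<open>- (\<partial>\<^sub>2\<nu> \<times> \<nu>, \<nu> \<times> \<partial>\<^sub>1\<nu>)\<close> up to the orientation sign, the mixed second
  derivatives of \<open>\<nu>\<close> drop out of the divergence. What remains is \<open>2 \<partial>\<^sub>1\<nu> \<times> \<partial>\<^sub>2\<nu>\<close>, which is twice the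
  Gauss curvature times the normal and the area element.\<close>

lemma laplace_normal:
  assumes p: "p \<in> U"
  shows "laplace_beltrami X (\<lambda>q. N q \<bullet> e) p = - sff_norm_sq X N p * (N p \<bullet> e)"
proof -
  let ?k = "\<lambda>q. XX q \<bullet> N q"
  have kC: "continuous_on U ?k"
    by (intro continuous_intros continuous_on_cross C1h_cont_D[OF X1] C1_on_cont[OF N1 openin_imp_subset[OF U]])
  have k0: "?k q \<noteq> 0" if "q \<in> U" for q using XX_N(2)[OF that] pos[OF that] by auto
  obtain S' where S': "hopen S'" "S' \<subseteq> U" "p \<in> S'" "\<And>q. q \<in> S' \<Longrightarrow> sgn (?k q) = sgn (?k p)"
    using sgn_locally_constant[OF U kC p k0[OF p]] by blast
  let ?s = "sgn (?k p)"
  have sk: "sqrt (det (gram X q)) = \<bar>?k q\<bar>" if "q \<in> U" for q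
    by (simp add: XX_N(2)[OF that, symmetric])
  have Ne: "D_half (\<lambda>q. N q \<bullet> e) q a = D_half N q a \<bullet> e" if "q \<in> U" for q a
    by (simp add: D_half_inner[OF U N1 C1h_const[OF U] that] D_half_const[OF U that])
  let ?P = "\<lambda>q. cross3 (D_half N q e2) (N q) \<bullet> e" and ?Q = "\<lambda>q. cross3 (N q) (D_half N q e1) \<bullet> e"
  have f1: "flux1 X (\<lambda>q. N q \<bullet> e) q = - ?s * ?P q" "flux2 X (\<lambda>q. N q \<bullet> e) q = - ?s * ?Q q" if "q \<in> S'" for q
  proof -
    have q: "q \<in> U" using that S'(2) by auto
    have div: "?k q / \<bar>?k q\<bar> = ?s" using S'(4)[OF that] k0[OF q] by (simp add: sgn_div_norm[symmetric] sgn_if abs_if split: if_splits)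
    have "flux1 X (\<lambda>q. N q \<bullet> e) q = (- cross3 (D_half N q e2) (XX q)) \<bullet> e / \<bar>?k q\<bar>"
      unfolding flux1_def sk[OF q] Ne[OF q] flux_N_vector(1)[OF q, symmetric] by (simp add: inner_diff_left)
    also have "cross3 (D_half N q e2) (XX q) = ?k q *\<^sub>R cross3 (D_half N q e2) (N q)"
      by (subst XX_N(1)[OF q]) (simp add: cross_mult_right)
    finally show "flux1 X (\<lambda>q. N q \<bullet> e) q = - ?s * ?P q" unfolding div[symmetric] by simp
    have "flux2 X (\<lambda>q. N q \<bullet> e) q = (- cross3 (XX q) (D_half N q e1)) \<bullet> e / \<bar>?k q\<bar>"
      unfolding flux2_def sk[OF q] Ne[OF q] flux_N_vector(2)[OF q, symmetric] by (simp add: inner_diff_left)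
    also have "cross3 (XX q) (D_half N q e1) = ?k q *\<^sub>R cross3 (N q) (D_half N q e1)"
      by (subst XX_N(1)[OF q]) (simp add: cross_mult_left)
    finally show "flux2 X (\<lambda>q. N q \<bullet> e) q = - ?s * ?Q q" unfolding div[symmetric] by simp
  qed
  note c2 = C1h_bilinear[OF U bounded_bilinear_cross3 C2h_C1_D[OF N] N1]
    and c1 = C1h_bilinear[OF U bounded_bilinear_cross3 N1 C2h_C1_D[OF N]]
  note k = C1h_const[OF U, of "- ?s"] and ke = C1h_const[OF U, of e]
  have "D_half (flux1 X (\<lambda>q. N q \<bullet> e)) p = D_half (\<lambda>q. - ?s * ?P q) p"
    by (rule D_half_cong[OF S'(1,3) f1(1)])
  then have 1: "D_half (flux1 X (\<lambda>q. N q \<bullet> e)) p e1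
    = - ?s * ((cross3 (D_half N p e2) (D_half N p e1) + cross3 (D_half (\<lambda>q. D_half N q e2) p e1) (N p)) \<bullet> e)"
    by (simp only: D_half_mult[OF U k C1h_inner[OF U c2 ke] p] D_half_const[OF U p] D_half_inner[OF U c2 ke p]
      D_half_bilinear[OF U bounded_bilinear_cross3 C2h_C1_D[OF N] N1 p]) simp
  have "D_half (flux2 X (\<lambda>q. N q \<bullet> e)) p = D_half (\<lambda>q. - ?s * ?Q q) p"
    by (rule D_half_cong[OF S'(1,3) f1(2)])
  then have 2: "D_half (flux2 X (\<lambda>q. N q \<bullet> e)) p e2
    = - ?s * ((cross3 (N p) (D_half (\<lambda>q. D_half N q e1) p e2) + cross3 (D_half N p e2) (D_half N p e1)) \<bullet> e)"
    by (simp only: D_half_mult[OF U k C1h_inner[OF U c1 ke] p] D_half_const[OF U p] D_half_inner[OF U c1 ke p]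
      D_half_bilinear[OF U bounded_bilinear_cross3 N1 C2h_C1_D[OF N] p]) simp
  let ?K = "(sff X N p e1 e1 * sff X N p e2 e2 - (sff X N p e1 e2)\<^sup>2) / det (gram X p)"
  have "D_half (flux1 X (\<lambda>q. N q \<bullet> e)) p e1 + D_half (flux2 X (\<lambda>q. N q \<bullet> e)) p e2
      = 2 * ?s * (cross3 (D_half N p e1) (D_half N p e2) \<bullet> e)"
    unfolding 1 2 N_sym[OF p, of e2 e1] cross_skew[of "N p" "D_half (\<lambda>q. D_half N q e1) p e2"]
      cross_skew[of "D_half N p e2" "D_half N p e1"]
    by (simp add: inner_add_left algebra_simps)
  also have "\<dots> = 2 * ?K * (?s * ?k p) * (N p \<bullet> e)"
    unfolding DN_cross[OF p] by (subst XX_N(1)[OF p]) simp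
  also have "?s * ?k p = sqrt (det (gram X p))" unfolding sk[OF p] by (simp add: abs_sgn mult.commute)
  finally show ?thesis
    using laplace_beltrami_flux[OF U p pos, of "\<lambda>q. N q \<bullet> e"] pos[OF p]
    by (simp add: sff_norm_sq_eq[OF p]) (simp add: field_simps)
qed

end

section \<open>Change of variables for nonnegative integrals\<close>

lemma ennreal_eq_by_reals:
  fixes a b :: ennreal
  assumes "\<And>r. 0 \<le> r \<Longrightarrow> a = ennreal r \<longleftrightarrow> b = ennreal r"
  shows "a = b"
  by (cases a; cases b) (use assms in force)+

text \<open>The assumption \<open>eq\<close> says that one function has a finite integral with a certain value exactly when
  the other has; for nonnegative functions this leaves infinity as the only other value for both.\<close>

lemma nn_integral_eq_from_has_integral:
  fixes f :: "'a::euclidean_space \<Rightarrow> real" and g :: "'b::euclidean_space \<Rightarrow> real"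
  assumes f: "(\<lambda>x. indicator S x * f x) \<in> borel_measurable borel" "\<And>x. x \<in> S \<Longrightarrow> 0 \<le> f x"
    and g: "(\<lambda>x. indicator T x * g x) \<in> borel_measurable borel" "\<And>x. x \<in> T \<Longrightarrow> 0 \<le> g x"
    and eq: "\<And>b. f absolutely_integrable_on S \<and> integral S f = b \<longleftrightarrow> g absolutely_integrable_on T \<and> integral T g = b"
  shows "(\<integral>\<^sup>+x. ennreal (f x) * indicator S x \<partial>lborel) = (\<integral>\<^sup>+x. ennreal (g x) * indicator T x \<partial>lborel)"
proof -
  have 1: "(\<integral>\<^sup>+x. ennreal (h x) * indicator A x \<partial>lborel) = ennreal r \<longleftrightarrow> h absolutely_integrable_on A \<and> integral A h = r"
    if h: "(\<lambda>x. indicator A x * h x) \<in> borel_measurable borel" "\<And>x. x \<in> A \<Longrightarrow> 0 \<le> h x" and r: "0 \<le> r"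
    for h :: "'c::euclidean_space \<Rightarrow> real" and A r
  proof -
    have "(\<integral>\<^sup>+x. ennreal (h x) * indicator A x \<partial>lborel) = (\<integral>\<^sup>+x. ennreal (indicator A x * h x) \<partial>lebesgue)"
      unfolding nn_integral_completion by (intro nn_integral_cong) (auto simp: indicator_def)
    moreover have "(\<lambda>x. indicator A x * h x) \<in> borel_measurable lebesgue"
      using h(1) by (simp add: measurable_completion)
    moreover have "0 \<le> indicator A x * h x" for x using h(2) by (auto simp: indicator_def)
    ultimately have "(\<integral>\<^sup>+x. ennreal (h x) * indicator A x \<partial>lborel) = ennreal r \<longleftrightarrow>
        ((\<lambda>x. indicator A x * h x) has_integral r) UNIV"
      using has_integral_iff_nn_integral_lebesgue[of "\<lambda>x. indicator A x * h x" r] r by auto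
    also have "\<dots> \<longleftrightarrow> (h has_integral r) A"
      using has_integral_restrict_UNIV[of A h r] by (simp add: indicator_def of_bool_def if_distrib[of "\<lambda>x. x * _"] cong: if_cong)
    also have "\<dots> \<longleftrightarrow> h absolutely_integrable_on A \<and> integral A h = r"
      using nonnegative_absolutely_integrable_1[of h A] h(2) has_integral_iff absolutely_integrable_on_def by blast
    finally show ?thesis .
  qed
  show ?thesis
    by (rule ennreal_eq_by_reals) (simp add: 1[OF f] 1[OF g] eq)
qed

lemma nn_integral_change_of_variables:
  fixes f :: "real^'n::{finite,wellorder} \<Rightarrow> real" and g :: "real^'n::_ \<Rightarrow> real^'n::_"
  assumes S: "S \<in> sets borel" and g: "\<And>x. x \<in> S \<Longrightarrow> (g has_derivative g' x) (at x within S)" "inj_on g S"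
    and F: "(\<lambda>x. indicator S x * (\<bar>det (matrix (g' x))\<bar> * f (g x))) \<in> borel_measurable borel"
    and f: "(\<lambda>x. indicator (g ` S) x * f x) \<in> borel_measurable borel" "\<And>x. x \<in> g ` S \<Longrightarrow> 0 \<le> f x"
  shows "(\<integral>\<^sup>+x. ennreal (\<bar>det (matrix (g' x))\<bar> * f (g x)) * indicator S x \<partial>lborel)
      = (\<integral>\<^sup>+y. ennreal (f y) * indicator (g ` S) y \<partial>lborel)"
proof (rule nn_integral_eq_from_has_integral[OF F _ f])
  fix b
  have "S \<in> sets lebesgue" using S by (simp add: sets_completionI_sets)
  from has_absolute_integral_change_of_variables[OF this g, of "\<lambda>x. (vec (f x) :: real^1)" "vec b"]
  show "(\<lambda>x. \<bar>det (matrix (g' x))\<bar> * f (g x)) absolutely_integrable_on S \<and> integral S (\<lambda>x. \<bar>det (matrix (g' x))\<bar> * f (g x)) = b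
    \<longleftrightarrow> f absolutely_integrable_on g ` S \<and> integral (g ` S) f = b"
    by (simp add: absolutely_integrable_on_1_iff integral_on_1_eq)
qed (use f in auto)

lemma nn_integral_change_of_variables_real:
  fixes f g :: "real \<Rightarrow> real"
  assumes S: "S \<in> sets borel" and g: "\<And>x. x \<in> S \<Longrightarrow> (g has_field_derivative g' x) (at x within S)" "inj_on g S"
    and F: "(\<lambda>x. indicator S x * (\<bar>g' x\<bar> * f (g x))) \<in> borel_measurable borel"
    and f: "(\<lambda>x. indicator (g ` S) x * f x) \<in> borel_measurable borel" "\<And>x. x \<in> g ` S \<Longrightarrow> 0 \<le> f x"
  shows "(\<integral>\<^sup>+x. ennreal (\<bar>g' x\<bar> * f (g x)) * indicator S x \<partial>lborel)
      = (\<integral>\<^sup>+y. ennreal (f y) * indicator (g ` S) y \<partial>lborel)"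
proof (rule nn_integral_eq_from_has_integral[OF F _ f])
  fix b
  have "S \<in> sets lebesgue" using S by (simp add: sets_completionI_sets)
  from has_absolute_integral_change_of_variables_1'[OF this g, of f b]
  show "(\<lambda>x. \<bar>g' x\<bar> * f (g x)) absolutely_integrable_on S \<and> integral S (\<lambda>x. \<bar>g' x\<bar> * f (g x)) = b
    \<longleftrightarrow> f absolutely_integrable_on g ` S \<and> integral (g ` S) f = b" .
qed (use f in auto)

section \<open>Gluing measures\<close>

lemma suminf_swap_ennreal:
  fixes f :: "nat \<Rightarrow> nat \<Rightarrow> ennreal"
  shows "(\<Sum>i. \<Sum>n. f i n) = (\<Sum>n. \<Sum>i. f i n)"
proof -
  have "(\<Sum>i. \<Sum>n. f i n) = (\<Sum>i. \<integral>\<^sup>+n. f i n \<partial>count_space UNIV)" by (simp add: nn_integral_count_space_nat)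
  also have "\<dots> = (\<integral>\<^sup>+n. (\<Sum>i. f i n) \<partial>count_space UNIV)" by (rule nn_integral_suminf[symmetric]) simp
  also have "\<dots> = (\<Sum>n. \<Sum>i. f i n)" by (simp add: nn_integral_count_space_nat)
  finally show ?thesis .
qed

text \<open>Area and arc length have the same form: in a chart \<open>c\<close> they have a density \<open>w c\<close> on a Borel set
  \<open>Dom c\<close> of parameters, and \<open>f c\<close> maps the parameters to the surface. The parameters are points of
  the half-plane for area and edge coordinates for arc length.\<close>

locale glue =
  fixes \<A> :: "'a::{t2_space, second_countable_topology} param set"
    and Dom :: "'a param \<Rightarrow> 'e::euclidean_space set" and w :: "'a param \<Rightarrow> 'e \<Rightarrow> real" and f :: "'a param \<Rightarrow> 'e \<Rightarrow> 'a"
    and m :: "'a param \<Rightarrow> 'a set \<Rightarrow> ennreal"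
  assumes Im: "\<And>U \<phi>. (U, \<phi>) \<in> \<A> \<Longrightarrow> openin (top_of_set (points \<A>)) (\<phi> ` U)"
    and Dom: "\<And>c. c \<in> \<A> \<Longrightarrow> Dom c \<in> sets borel"
    and f: "\<And>c. c \<in> \<A> \<Longrightarrow> continuous_on (Dom c) (f c)"
    and fIm: "\<And>U \<phi>. (U, \<phi>) \<in> \<A> \<Longrightarrow> f (U, \<phi>) ` Dom (U, \<phi>) \<subseteq> \<phi> ` U"
    and w: "\<And>c. c \<in> \<A> \<Longrightarrow> continuous_on (Dom c) (w c)"
    and w_nonneg: "\<And>c x. c \<in> \<A> \<Longrightarrow> x \<in> Dom c \<Longrightarrow> 0 \<le> w c x"
    and m: "\<And>c B. c \<in> \<A> \<Longrightarrow> m c B = (\<integral>\<^sup>+x. ennreal (w c x) * indicator {x \<in> Dom c. f c x \<in> B} x \<partial>lborel)"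
    and compat: "\<And>U \<phi> V \<psi> B. (U, \<phi>) \<in> \<A> \<Longrightarrow> (V, \<psi>) \<in> \<A> \<Longrightarrow> B \<in> sets (restrict_space borel (points \<A>)) \<Longrightarrow>
       B \<subseteq> \<phi> ` U \<inter> \<psi> ` V \<Longrightarrow> m (U, \<phi>) B = m (V, \<psi>) B"
begin

abbreviation "R \<equiv> restrict_space borel (points \<A>)"

definition "chart_measure c = distr (density (restrict_space lborel (Dom c)) (\<lambda>x. ennreal (w c x))) R (f c)"

lemma f_R: assumes c: "c \<in> \<A>" shows "f c \<in> restrict_space lborel (Dom c) \<rightarrow>\<^sub>M R"
proof (rule measurable_restrict_space2)
  obtain U \<phi> where c': "c = (U, \<phi>)" by (cases c)
  show "f c \<in> space (restrict_space lborel (Dom c)) \<rightarrow> points \<A>"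
    using fIm[of U \<phi>] openin_imp_subset[OF Im[of U \<phi>]] c unfolding c' by (auto simp: space_restrict_space)
  show "f c \<in> restrict_space lborel (Dom c) \<rightarrow>\<^sub>M borel"
    using borel_measurable_continuous_on_restrict[OF f[OF c]]
    by (simp cong: measurable_cong_sets sets_restrict_space_cong[OF sets_lborel] add: measurable_def space_restrict_space)
qed

lemma w_R: assumes c: "c \<in> \<A>" shows "w c \<in> borel_measurable (restrict_space lborel (Dom c))"
  using borel_measurable_continuous_on_restrict[OF w[OF c]]
  by (simp add: measurable_def space_restrict_space sets_restrict_space)

lemma space_R: "space R = points \<A>" by (simp add: space_restrict_space)

lemma sets_chart_measure [simp]: "sets (chart_measure c) = sets R" "space (chart_measure c) = points \<A>"
  by (simp_all add: chart_measure_def space_restrict_space)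

lemma emeasure_chart_measure:
  assumes c: "c \<in> \<A>" and B: "B \<in> sets R"
  shows "emeasure (chart_measure c) B = m c B"
proof -
  let ?L = "restrict_space lborel (Dom c)"
  have D: "Dom c \<inter> space lborel \<in> sets lborel" using Dom[OF c] by simp
  have S: "f c -` B \<inter> space ?L \<in> sets ?L" using measurable_sets[OF f_R[OF c] B] .
  have "emeasure (chart_measure c) B = emeasure (density ?L (\<lambda>x. ennreal (w c x))) (f c -` B \<inter> space ?L)"
    unfolding chart_measure_def using f_R[OF c] B by (subst emeasure_distr) (auto simp: space_restrict_space)
  also have "\<dots> = (\<integral>\<^sup>+x. ennreal (w c x) * indicator (f c -` B \<inter> space ?L) x \<partial>?L)"
    using w_R[OF c] S by (intro emeasure_density) auto
  also have "\<dots> = (\<integral>\<^sup>+x. ennreal (w c x) * indicator (f c -` B \<inter> space ?L) x * indicator (Dom c) x \<partial>lborel)"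
    by (rule nn_integral_restrict_space[OF D])
  also have "\<dots> = m c B" unfolding m[OF c]
    by (intro nn_integral_cong) (auto simp: indicator_def space_restrict_space)
  finally show ?thesis .
qed

lemma Im_R: "(U, \<phi>) \<in> \<A> \<Longrightarrow> \<phi> ` U \<in> sets R"
  using Im[of U \<phi>] by (auto simp: openin_open sets_restrict_space)

lemma countable_cover:
  obtains "\<A> = {}" | c :: "nat \<Rightarrow> 'a param" where "range c \<subseteq> \<A>" "points \<A> = (\<Union>n. snd (c n) ` fst (c n))"
proof (cases "\<A> = {}")
  case False
  obtain F' where F': "F' \<subseteq> (\<lambda>(U, \<phi>). \<phi> ` U) ` \<A>" "countable F'" "\<Union>F' = \<Union>((\<lambda>(U, \<phi>). \<phi> ` U) ` \<A>)"
  proof (rule Lindelof_openin[of "(\<lambda>(U, \<phi>). \<phi> ` U) ` \<A>" "points \<A>"])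
    show "openin (top_of_set (points \<A>)) S" if "S \<in> (\<lambda>(U, \<phi>). \<phi> ` U) ` \<A>" for S
      using that Im by auto
  qed
  obtain C where C: "C \<subseteq> \<A>" "countable C" "F' = (\<lambda>(U, \<phi>). \<phi> ` U) ` C"
    using iffD1[OF countable_subset_image conjI[OF F'(2,1)]] by (elim exE conjE)
  obtain c0 where c0: "c0 \<in> \<A>" using False by blast
  have cC: "countable (insert c0 C)" "insert c0 C \<noteq> {}" using C by auto
  let ?c = "from_nat_into (insert c0 C)"
  have r: "range ?c = insert c0 C" using range_from_nat_into[OF cC(2,1)] .
  have "points \<A> = (\<Union>n. snd (?c n) ` fst (?c n))"
  proof -
    have C': "points \<A> = (\<Union>c\<in>C. snd c ` fst c)"
      using F'(3) unfolding points_def C(3) case_prod_beta by simp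
    have "snd c0 ` fst c0 \<subseteq> points \<A>" unfolding points_def case_prod_beta using c0 by blast
    then have "points \<A> = (\<Union>c\<in>insert c0 C. snd c ` fst c)"
      unfolding UN_insert C'[symmetric] by (rule Un_absorb1[symmetric])
    moreover have "(\<Union>n. snd (?c n) ` fst (?c n)) = (\<Union>c\<in>range ?c. snd c ` fst c)" by blast
    ultimately show ?thesis unfolding r by simp
  qed
  then show ?thesis
    by (rule that(2)[rotated]) (use r C(1) c0 in simp)
qed (use that in auto)

definition glued :: "'a measure \<Rightarrow> bool" where
  "glued \<mu> \<longleftrightarrow> sets \<mu> = sets R \<and> (\<forall>(U, \<phi>)\<in>\<A>. \<forall>B\<in>sets \<mu>. B \<subseteq> \<phi> ` U \<longrightarrow> emeasure \<mu> B = m (U, \<phi>) B)"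

text \<open>The surface is covered by a sequence of charts, hence it is a disjoint union of Borel pieces \<open>D n\<close>
  that lie in one chart each. Any measure with the required values on subsets of charts is determined
  by its values on subsets of the pieces; and the sum of the chart measures of the pieces has the
  required values, because the charts agree on overlaps.\<close>

lemma glued_ex1: "\<exists>!\<mu>. glued \<mu>"
proof (cases rule: countable_cover)
  case 1
  then have p: "points \<A> = {}" by (simp add: points_def)
  have eq: "\<mu> = \<mu>'" if "sets \<mu> = sets R" "sets \<mu>' = sets R" for \<mu> \<mu>' :: "'a measure"
  proof (rule measure_eqI)
    show "emeasure \<mu> X = emeasure \<mu>' X" if "X \<in> sets \<mu>" for X
    proof -
      have "X = {}" using that sets.sets_into_space[of X \<mu>] sets_eq_imp_space_eq[OF \<open>sets \<mu> = sets R\<close>] p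
        by (auto simp: space_restrict_space)
      then show ?thesis by simp
    qed
  qed (use that in simp)
  show ?thesis
  proof (rule ex1I[of _ R])
    show "glued R" unfolding glued_def using 1 by blast
    show "\<mu> = R" if "glued \<mu>" for \<mu>
      by (rule eq) (use that in \<open>unfold glued_def, blast+\<close>)
  qed
next
  case (2 c)
  then have c: "c n \<in> \<A>" for n by auto
  define D where "D = disjointed (\<lambda>n. snd (c n) ` fst (c n))"
  have DI: "D n \<subseteq> snd (c n) ` fst (c n)" for n unfolding D_def by (rule disjointed_subset)
  have Dd: "disjoint_family D" unfolding D_def by (rule disjoint_family_disjointed)
  have DU: "(\<Union>n. D n) = points \<A>" unfolding D_def 2(2) by (rule UN_disjointed_eq)
  have "snd (c n) ` fst (c n) \<in> sets R" for n
    by (rule Im_R) (simp add: c)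
  then have "range (\<lambda>n. snd (c n) ` fst (c n)) \<subseteq> sets R" by blast
  from sets.range_disjointed_sets[OF this] have DR: "D n \<in> sets R" for n
    unfolding D_def by blast
  define \<mu> where "\<mu> = measure_of (points \<A>) (sets R) (\<lambda>B. \<Sum>n. emeasure (chart_measure (c n)) (B \<inter> D n))"
  have sA: "sigma_algebra (points \<A>) (sets R)" using sets.sigma_algebra_axioms[of R] by (simp add: space_R)
  have sets: "sets \<mu> = sets R"
    unfolding \<mu>_def using sets.space_closed[of R] by (simp add: space_R sigma_algebra.sigma_sets_eq[OF sA])
  have em: "emeasure \<mu> B = (\<Sum>n. emeasure (chart_measure (c n)) (B \<inter> D n))" if B: "B \<in> sets R" for B
    unfolding \<mu>_def
  proof (rule emeasure_measure_of_sigma[OF sA _ _ B])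
    show "positive (sets R) (\<lambda>B. \<Sum>n. emeasure (chart_measure (c n)) (B \<inter> D n))"
      by (auto simp: positive_def)
    show "countably_additive (sets R) (\<lambda>B. \<Sum>n. emeasure (chart_measure (c n)) (B \<inter> D n))"
    proof (rule countably_additiveI)
      fix B :: "nat \<Rightarrow> 'a set" assume B: "range B \<subseteq> sets R" "disjoint_family B"
      have "(\<Sum>i. \<Sum>n. emeasure (chart_measure (c n)) (B i \<inter> D n))
        = (\<Sum>n. \<Sum>i. emeasure (chart_measure (c n)) (B i \<inter> D n))" by (rule suminf_swap_ennreal)
      also have "\<dots> = (\<Sum>n. emeasure (chart_measure (c n)) (\<Union>i. B i \<inter> D n))"
      proof (rule suminf_cong, rule suminf_emeasure)
        show "range (\<lambda>i. B i \<inter> D n) \<subseteq> sets (chart_measure (c n))" for n using B(1) DR by auto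
        show "disjoint_family (\<lambda>i. B i \<inter> D n)" for n using B(2) by (auto simp: disjoint_family_on_def)
      qed
      also have "\<dots> = (\<Sum>n. emeasure (chart_measure (c n)) ((\<Union>i. B i) \<inter> D n))" by (simp add: Int_commute)
      finally show "(\<Sum>i. \<Sum>n. emeasure (chart_measure (c n)) (B i \<inter> D n))
        = (\<Sum>n. emeasure (chart_measure (c n)) ((\<Union>i. B i) \<inter> D n))" .
    qed
  qed
  have decomp: "emeasure M B = (\<Sum>n. emeasure M (B \<inter> D n))" if "sets M = sets R" "B \<in> sets R" for M :: "'a measure" and B
  proof -
    have "B \<subseteq> points \<A>" using sets.sets_into_space[OF that(2)] by (simp add: space_R)
    then have "(\<Union>n. B \<inter> D n) = B" using DU by blast
    moreover have "(\<Sum>n. emeasure M (B \<inter> D n)) = emeasure M (\<Union>n. B \<inter> D n)"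
    proof (rule suminf_emeasure)
      show "range (\<lambda>n. B \<inter> D n) \<subseteq> sets M" using that DR by auto
      show "disjoint_family (\<lambda>n. B \<inter> D n)" using Dd unfolding disjoint_family_on_def by blast
    qed
    ultimately show ?thesis by simp
  qed
  have "glued \<mu>"
    unfolding glued_def case_prod_beta
  proof (intro conjI sets ballI impI)
    fix p B assume p: "p \<in> \<A>" and B: "B \<in> sets \<mu>" "B \<subseteq> snd p ` fst p"
    have "emeasure \<mu> B = (\<Sum>n. emeasure (chart_measure (c n)) (B \<inter> D n))" using em B sets by simp
    also have "\<dots> = (\<Sum>n. emeasure (chart_measure p) (B \<inter> D n))"
    proof (rule suminf_cong)
      fix n
      have BD: "B \<inter> D n \<in> sets R" using B sets DR by auto
      have "m (c n) (B \<inter> D n) = m p (B \<inter> D n)"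
        using compat[of "fst (c n)" "snd (c n)" "fst p" "snd p", OF _ _ BD] c[of n] p B(2) DI[of n] by auto
      then show "emeasure (chart_measure (c n)) (B \<inter> D n) = emeasure (chart_measure p) (B \<inter> D n)"
        by (simp add: emeasure_chart_measure c p BD)
    qed
    also have "\<dots> = emeasure (chart_measure p) B" by (rule decomp[symmetric]) (use B sets in auto)
    also have "\<dots> = m p B" by (rule emeasure_chart_measure[OF p]) (use B sets in auto)
    finally show "emeasure \<mu> B = m (fst p, snd p) B" by simp
  qed
  moreover have "\<mu>1 = \<mu>2" if g: "glued \<mu>1" "glued \<mu>2" for \<mu>1 \<mu>2
  proof (rule measure_eqI)
    show s: "sets \<mu>1 = sets \<mu>2" using g by (auto simp: glued_def)
    have s1: "sets \<mu>1 = sets R" using g by (auto simp: glued_def)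
    fix B assume B: "B \<in> sets \<mu>1"
    have "emeasure \<mu>1 (B \<inter> D n) = emeasure \<mu>2 (B \<inter> D n)" for n
    proof -
      have "B \<inter> D n \<in> sets \<mu>1" "B \<inter> D n \<in> sets \<mu>2" "B \<inter> D n \<subseteq> snd (c n) ` fst (c n)"
        using B s s1 DR[of n] le_infI2[OF DI[of n]] by auto
      then show ?thesis using g c[of n] unfolding glued_def by (auto simp: case_prod_beta)
    qed
    then show "emeasure \<mu>1 B = emeasure \<mu>2 B"
      using decomp[of \<mu>1 B] decomp[of \<mu>2 B] s s1 B by simp
  qed
  ultimately show ?thesis by blast
qed

lemma glued_measure: "glued (glued_measure \<A> m)"
  unfolding glued_measure_def using theI'[OF glued_ex1] unfolding glued_def .

lemma sets_glued [measurable_cong]: "sets (glued_measure \<A> m) = sets R"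
  using glued_measure by (simp add: glued_def)

lemma space_glued: "space (glued_measure \<A> m) = points \<A>"
  using sets_eq_imp_space_eq[OF sets_glued] by (simp add: space_R)

lemma density_glued:
  assumes c: "(U, \<phi>) \<in> \<A>"
  shows "density (glued_measure \<A> m) (indicator (\<phi> ` U)) = chart_measure (U, \<phi>)"
proof (rule measure_eqI)
  show "sets (density (glued_measure \<A> m) (indicator (\<phi> ` U))) = sets (chart_measure (U, \<phi>))"
    by (simp add: sets_glued)
  fix B assume "B \<in> sets (density (glued_measure \<A> m) (indicator (\<phi> ` U)))"
  then have B: "B \<in> sets R" by (simp add: sets_glued)
  note I = Im_R[OF c]
  have "emeasure (density (glued_measure \<A> m) (indicator (\<phi> ` U))) B
    = (\<integral>\<^sup>+x. indicator (\<phi> ` U) x * indicator B x \<partial>glued_measure \<A> m)"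
    using I B by (intro emeasure_density) (simp_all add: sets_glued borel_measurable_indicator)
  also have "\<dots> = (\<integral>\<^sup>+x. indicator (\<phi> ` U \<inter> B) x \<partial>glued_measure \<A> m)"
    by (simp add: indicator_inter_arith)
  also have "\<dots> = emeasure (glued_measure \<A> m) (\<phi> ` U \<inter> B)"
    using I B by (intro nn_integral_indicator) (simp add: sets_glued)
  also have "\<dots> = m (U, \<phi>) (\<phi> ` U \<inter> B)"
    using glued_measure c I B unfolding glued_def by auto
  also have "\<dots> = m (U, \<phi>) B"
    unfolding m[OF c] using fIm[OF c] by (intro nn_integral_cong) (auto simp: indicator_def)
  finally show "emeasure (density (glued_measure \<A> m) (indicator (\<phi> ` U))) B = emeasure (chart_measure (U, \<phi>)) B"
    by (simp add: emeasure_chart_measure[OF c B])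
qed

lemma
  fixes g :: "'a \<Rightarrow> real"
  assumes c: "(U, \<phi>) \<in> \<A>" and g: "g \<in> borel_measurable R" and g0: "\<And>x. x \<in> points \<A> - \<phi> ` U \<Longrightarrow> g x = 0"
  shows integral_chart: "integral\<^sup>L (glued_measure \<A> m) g
      = (\<integral>x. indicator (Dom (U, \<phi>)) x * (w (U, \<phi>) x * g (f (U, \<phi>) x)) \<partial>lborel)"
    and integrable_chart: "integrable (glued_measure \<A> m) g
      \<longleftrightarrow> integrable lborel (\<lambda>x. indicator (Dom (U, \<phi>)) x * (w (U, \<phi>) x * g (f (U, \<phi>) x)))"
proof -
  let ?c = "(U, \<phi>)" let ?M = "glued_measure \<A> m" and ?I = "indicator (\<phi> ` U) :: 'a \<Rightarrow> real"
  let ?L = "restrict_space lborel (Dom ?c)"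
  have D: "Dom ?c \<inter> space lborel \<in> sets lborel" using Dom[OF c] by simp
  have gM: "g \<in> borel_measurable ?M" using g by (simp cong: measurable_cong_sets add: sets_glued)
  have IM: "?I \<in> borel_measurable ?M" using Im_R[OF c] by (simp add: borel_measurable_indicator sets_glued)
  have gI: "?I x *\<^sub>R g x = g x" if "x \<in> space ?M" for x
    using g0 that by (auto simp: space_glued indicator_def)
  have gL: "(\<lambda>x. g (f ?c x)) \<in> borel_measurable ?L" using measurable_compose[OF f_R[OF c] g] .
  have wn: "AE x in ?L. 0 \<le> w ?c x"
    using w_nonneg[OF c] by (auto simp: space_restrict_space intro!: AE_I2)
  have d: "density ?M (\<lambda>x. ennreal (?I x)) = chart_measure ?c"
    using density_glued[OF c] by (simp add: ennreal_indicator)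
  have fd: "f ?c \<in> density ?L (\<lambda>x. ennreal (w ?c x)) \<rightarrow>\<^sub>M R" using f_R[OF c] by simp
  have "integral\<^sup>L ?M g = integral\<^sup>L ?M (\<lambda>x. ?I x *\<^sub>R g x)"
    by (intro Bochner_Integration.integral_cong refl gI[symmetric])
  also have "\<dots> = integral\<^sup>L (chart_measure ?c) g"
    unfolding d[symmetric] by (rule integral_density[symmetric]) (use gM IM in auto)
  also have "\<dots> = integral\<^sup>L (density ?L (\<lambda>x. ennreal (w ?c x))) (\<lambda>x. g (f ?c x))"
    unfolding chart_measure_def by (rule integral_distr[OF fd g])
  also have "\<dots> = integral\<^sup>L ?L (\<lambda>x. w ?c x *\<^sub>R g (f ?c x))"
    by (rule integral_density[OF gL w_R[OF c] wn])
  also have "\<dots> = (\<integral>x. indicator (Dom ?c) x *\<^sub>R (w ?c x *\<^sub>R g (f ?c x)) \<partial>lborel)"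
    by (rule integral_restrict_space[OF D])
  finally show "integral\<^sup>L ?M g = (\<integral>x. indicator (Dom ?c) x * (w ?c x * g (f ?c x)) \<partial>lborel)" by simp
  have "integrable ?M g \<longleftrightarrow> integrable ?M (\<lambda>x. ?I x *\<^sub>R g x)"
    by (intro Bochner_Integration.integrable_cong refl gI[symmetric])
  also have "\<dots> \<longleftrightarrow> integrable (chart_measure ?c) g"
    unfolding d[symmetric] by (rule integrable_density[symmetric]) (use gM IM in auto)
  also have "\<dots> \<longleftrightarrow> integrable (density ?L (\<lambda>x. ennreal (w ?c x))) (\<lambda>x. g (f ?c x))"
    unfolding chart_measure_def by (rule integrable_distr_eq[OF fd g])
  also have "\<dots> \<longleftrightarrow> integrable ?L (\<lambda>x. w ?c x *\<^sub>R g (f ?c x))"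
    by (rule integrable_density[OF gL w_R[OF c] wn])
  also have "\<dots> \<longleftrightarrow> integrable lborel (\<lambda>x. indicator (Dom ?c) x *\<^sub>R (w ?c x *\<^sub>R g (f ?c x)))"
    by (rule integrable_restrict_space[OF D])
  finally show "integrable ?M g \<longleftrightarrow> integrable lborel (\<lambda>x. indicator (Dom ?c) x * (w ?c x * g (f ?c x)))" by simp
qed

end

section \<open>Surfaces\<close>

lemma closed_halfplane: "closed halfplane"
  unfolding halfplane_def by (intro closed_Collect_le continuous_intros)

lemma hopen_borel: "hopen U \<Longrightarrow> U \<in> sets borel"
  using closed_halfplane by (auto simp: openin_open)

definition edge_point :: "real \<Rightarrow> real^2" where "edge_point t = t *\<^sub>R e2"

lemma vector_edge: "vector [0, t] = edge_point t"
  by (simp add: edge_point_def vec_eq_iff forall_2 axis_def)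

lemma edge_point_nth [simp]: "edge_point t $ 1 = 0" "edge_point t $ 2 = t"
  by (simp_all add: edge_point_def axis_def)

lemma edge_point_halfplane [simp]: "edge_point t \<in> halfplane" by (simp add: halfplane_def)

lemma edge_point_eq: "p $ 1 = 0 \<Longrightarrow> edge_point (p $ 2) = p"
  by (simp add: vec_eq_iff forall_2)

lemma continuous_edge_point [continuous_intros]: "continuous_on T edge_point"
  unfolding edge_point_def by (intro continuous_intros)

lemma edge_point_has_derivative: "(edge_point has_derivative (\<lambda>s. s *\<^sub>R e2)) (at t within T)"
  unfolding edge_point_def[abs_def] by (auto intro!: derivative_eq_intros)

text \<open>The derivative into the half-plane is a limit of difference quotients of \<open>h\<close>, and these are
  nonnegative when \<open>h\<close> takes its minimal value 0 at \<open>p\<close>.\<close>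

lemma D_half_edge_nonneg:
  fixes h :: "real^2 \<Rightarrow> real"
  assumes U: "hopen U" and h: "C1_on halfplane h U" and p: "p \<in> U" and nonneg: "\<And>q. q \<in> U \<Longrightarrow> 0 \<le> h q" and hp: "h p = 0"
  shows "0 \<le> D_half h p e1"
proof (rule ccontr)
  assume neg: "\<not> 0 \<le> D_half h p e1"
  have pU: "p \<in> halfplane" using openin_imp_subset[OF U] p by auto
  let ?k = "\<lambda>s::real. p + s *\<^sub>R e1"
  have kH: "?k ` {0..} \<subseteq> halfplane" using pU by (auto simp: halfplane_def axis_def)
  have "(h has_derivative D_half h p) (at (?k 0) within ?k ` {0..})"
    using has_derivative_subset[OF C1_onD[OF h p] kH] by (simp add: D_half_def)
  moreover have "(?k has_derivative (\<lambda>s. s *\<^sub>R e1)) (at 0 within {0..})" by (auto intro!: derivative_eq_intros)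
  ultimately have "(h \<circ> ?k has_derivative D_half h p \<circ> (\<lambda>s. s *\<^sub>R e1)) (at 0 within {0..})"
    by (rule diff_chain_within[rotated])
  moreover have "D_half h p \<circ> (\<lambda>s. s *\<^sub>R e1) = (*) (D_half h p e1)"
    using D_half_linear[of h p] h p by (auto simp: C1_on_def linear_cmul o_def)
  ultimately have "(h \<circ> ?k has_real_derivative D_half h p e1) (at 0 within {0..})"
    by (simp add: has_field_derivative_def)
  from has_real_derivative_neg_dec_right[OF this] neg
  obtain d where d: "d > 0" "\<And>s. s > 0 \<Longrightarrow> s < d \<Longrightarrow> h (?k s) < 0" using hp by auto
  have "((\<lambda>s. ?k s) \<longlongrightarrow> p) (at_right 0)" by (auto intro!: tendsto_eq_intros)
  moreover obtain T where T: "open T" "U = halfplane \<inter> T" using U by (auto simp: openin_open)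
  ultimately have "eventually (\<lambda>s. ?k s \<in> T) (at_right 0)" using p by (auto intro: topological_tendstoD)
  from eventually_conj[OF this eventually_at_right_real[OF d(1)]]
  have "eventually (\<lambda>s. ?k s \<in> T \<and> s < d \<and> 0 < s) (at_right 0)" by eventually_elim auto
  then obtain s where s: "?k s \<in> T" "s < d" "0 < s" by (metis (mono_tags, lifting) eventually_happens trivial_limit_at_right_real)
  then have "?k s \<in> U" using kH T by auto
  then show False using nonneg d(2)[OF s(3,2)] by force
qed

locale minimal_surface =
  fixes \<A> :: "'a::{t2_space, second_countable_topology} param set" and F \<nu> :: "'a \<Rightarrow> real^3"
  assumes immersed: "immersed_two_sided \<A> F \<nu>"
    and minimal: "\<And>U \<phi> p. (U, \<phi>) \<in> \<A> \<Longrightarrow> p \<in> U \<Longrightarrow> mean_curvature (\<lambda>q. F (\<phi> q)) (\<lambda>q. \<nu> (\<phi> q)) p = 0"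
begin

lemma
  assumes "(U, \<phi>) \<in> \<A>"
  shows chart_hopen: "hopen U" and chart_Im: "openin (top_of_set (points \<A>)) (\<phi> ` U)"
    and chart_cont: "continuous_on U \<phi>" and chart_inj: "inj_on \<phi> U"
    and chart_inv_cont: "continuous_on (\<phi> ` U) (inv_into U \<phi>)"
proof -
  have s: "smooth_surface \<A>" using immersed by (simp add: immersed_two_sided_def)
  then show "hopen U" "openin (top_of_set (points \<A>)) (\<phi> ` U)" using assms by (auto simp: smooth_surface_def)
  have h: "homeomorphism U (\<phi> ` U) \<phi> (inv_into U \<phi>)" using s assms by (auto simp: smooth_surface_def)
  then show "continuous_on U \<phi>" "continuous_on (\<phi> ` U) (inv_into U \<phi>)" by (auto simp: homeomorphism_def)
  show "inj_on \<phi> U" using h by (auto simp: homeomorphism_def intro: inj_on_inverseI)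
qed

lemma chart_in_points: "(U, \<phi>) \<in> \<A> \<Longrightarrow> p \<in> U \<Longrightarrow> \<phi> p \<in> points \<A>"
  by (auto simp: points_def)

lemma points_chart:
  assumes "x \<in> points \<A>" obtains U \<phi> p where "(U, \<phi>) \<in> \<A>" "p \<in> U" "x = \<phi> p"
  using assms by (auto simp: points_def)

lemma minimal_chart:
  assumes c: "(U, \<phi>) \<in> \<A>"
  shows "minimal_chart U (\<lambda>q. F (\<phi> q)) (\<lambda>q. \<nu> (\<phi> q))"
proof -
  have k: "(2::enat) \<le> \<infinity>" by simp
  have X: "Ck_half \<infinity> (\<lambda>q. F (\<phi> q)) U" and N: "Ck_half \<infinity> (\<lambda>q. \<nu> (\<phi> q)) U"
    using immersed c by (auto simp: immersed_two_sided_def Ck_fun_def)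
  note U = chart_hopen[OF c]
  show ?thesis
  proof
    show "C2_on halfplane (\<lambda>q. F (\<phi> q)) U" "C2_on halfplane (\<lambda>q. \<nu> (\<phi> q)) U"
      using Ck_half_C2(1)[OF X k U] Ck_half_C2(1)[OF N k U] .
    show "D_half (\<lambda>q. D_half (\<lambda>q. F (\<phi> q)) q a) p b = D_half (\<lambda>q. D_half (\<lambda>q. F (\<phi> q)) q b) p a" if "p \<in> U" for p a b
      unfolding D_half_def by (rule Ck_half_C2(2)[OF X k U that])
    show "D_half (\<lambda>q. D_half (\<lambda>q. \<nu> (\<phi> q)) q a) p b = D_half (\<lambda>q. D_half (\<lambda>q. \<nu> (\<phi> q)) q b) p a" if "p \<in> U" for p a b
      unfolding D_half_def by (rule Ck_half_C2(2)[OF N k U that])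
    show "\<forall>p\<in>U. norm (\<nu> (\<phi> p)) = 1"
      using immersed chart_in_points[OF c] by (auto simp: immersed_two_sided_def)
    show "\<forall>p\<in>U. \<forall>a. \<nu> (\<phi> p) \<bullet> D_half (\<lambda>q. F (\<phi> q)) p a = 0" "\<And>p. p \<in> U \<Longrightarrow> inj (D_half (\<lambda>q. F (\<phi> q)) p)"
      using immersed c by (auto simp: immersed_two_sided_def)
    show "\<And>p. p \<in> U \<Longrightarrow> mean_curvature (\<lambda>q. F (\<phi> q)) (\<lambda>q. \<nu> (\<phi> q)) p = 0" using minimal[OF c] .
  qed (rule U)
qed

lemma transition:
  assumes c: "(U, \<phi>) \<in> \<A>" and d: "(V, \<psi>) \<in> \<A>"
  shows "coordinate_change {p \<in> U. \<phi> p \<in> \<psi> ` V} V (\<lambda>p. inv_into V \<psi> (\<phi> p)) (\<lambda>q. F (\<phi> q)) (\<lambda>q. F (\<psi> q))"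
proof -
  let ?S = "{p \<in> U. \<phi> p \<in> \<psi> ` V}"
  have k: "(2::enat) \<le> \<infinity>" by simp
  have "openin (top_of_set U) (U \<inter> \<phi> -` (\<psi> ` V))"
    by (rule continuous_openin_preimage[OF chart_cont[OF c] _ chart_Im[OF d]]) (use chart_in_points[OF c] in auto)
  also have "U \<inter> \<phi> -` (\<psi> ` V) = ?S" by auto
  finally have S: "hopen ?S" using chart_hopen[OF c] openin_trans by blast
  have \<tau>: "Ck_half \<infinity> (\<lambda>p. inv_into V \<psi> (\<phi> p)) ?S"
    using immersed c d by (auto simp: immersed_two_sided_def smooth_surface_def)
  show ?thesis
  proof
    show "hopen ?S" by (rule S)
    show "hopen V" by (rule chart_hopen[OF d])
    show "C2_on halfplane (\<lambda>p. inv_into V \<psi> (\<phi> p)) ?S" by (rule Ck_half_C2(1)[OF \<tau> k S])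
    show "(\<lambda>p. inv_into V \<psi> (\<phi> p)) ` ?S \<subseteq> V" by (auto intro: inv_into_into)
    show "D_half (\<lambda>q. D_half (\<lambda>p. inv_into V \<psi> (\<phi> p)) q a) p b = D_half (\<lambda>q. D_half (\<lambda>p. inv_into V \<psi> (\<phi> p)) q b) p a"
      if "p \<in> ?S" for p a b unfolding D_half_def by (rule Ck_half_C2(2)[OF \<tau> k S that])
    show "C2_on halfplane (\<lambda>q. F (\<psi> q)) V" by (rule minimal_chart.X[OF minimal_chart[OF d]])
    show "\<forall>p\<in>?S. F (\<phi> p) = F (\<psi> (inv_into V \<psi> (\<phi> p)))" by (auto simp: f_inv_into_f)
    show "0 < det (gram (\<lambda>q. F (\<phi> q)) p)" if "p \<in> ?S" for p
      by (rule minimal_chart.pos[OF minimal_chart[OF c]]) (use that in auto)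
    show "0 < det (gram (\<lambda>q. F (\<psi> q)) p)" if "p \<in> V" for p
      by (rule minimal_chart.pos[OF minimal_chart[OF d] that])
  qed
qed

lemma transition_inv:
  assumes "(V, \<psi>) \<in> \<A>" "p' \<in> V" "\<psi> p' = x" shows "inv_into V \<psi> x = p'"
  using assms chart_inj by (auto intro: inv_into_f_eq)

lemma invariant_value_chart:
  assumes inv: "\<And>V \<psi>. (V, \<psi>) \<in> \<A> \<Longrightarrow> \<phi> p \<in> \<psi> ` V \<Longrightarrow> q \<phi> p = q \<psi> (inv_into V \<psi> (\<phi> p))"
    and c: "(U, \<phi>) \<in> \<A>" "p \<in> U"
  shows "invariant_value \<A> q (\<phi> p) = q \<phi> p"
  unfolding invariant_value_def
proof (rule the_equality)
  show "\<forall>(V, \<psi>)\<in>\<A>. \<forall>p'\<in>V. \<psi> p' = \<phi> p \<longrightarrow> q \<psi> p' = q \<phi> p"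
  proof (clarify)
    fix V \<psi> p' assume d: "(V, \<psi>) \<in> \<A>" "p' \<in> V" and e: "\<psi> p' = \<phi> p"
    have "q \<phi> p = q \<psi> (inv_into V \<psi> (\<phi> p))" by (rule inv[OF d(1)]) (use d e in force)
    then show "q \<psi> p' = q \<phi> p" using transition_inv[OF d e] by simp
  qed
qed (use c in blast)

definition surface_C1 :: "('a \<Rightarrow> real) \<Rightarrow> bool" where
  "surface_C1 u \<longleftrightarrow> (\<forall>(U, \<phi>)\<in>\<A>. C1_on halfplane (\<lambda>q. u (\<phi> q)) U)"

definition surface_C2 :: "('a \<Rightarrow> real) \<Rightarrow> bool" where
  "surface_C2 u \<longleftrightarrow> (\<forall>(U, \<phi>)\<in>\<A>. C2_on halfplane (\<lambda>q. u (\<phi> q)) U)"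

lemma surface_C1D: "surface_C1 u \<Longrightarrow> (U, \<phi>) \<in> \<A> \<Longrightarrow> C1_on halfplane (\<lambda>q. u (\<phi> q)) U"
  and surface_C2D: "surface_C2 u \<Longrightarrow> (U, \<phi>) \<in> \<A> \<Longrightarrow> C2_on halfplane (\<lambda>q. u (\<phi> q)) U"
  by (auto simp: surface_C1_def surface_C2_def)

lemma surface_C2_C1: "surface_C2 u \<Longrightarrow> surface_C1 u"
  by (auto simp: surface_C1_def surface_C2_def intro: C2_on_C1)

lemma Laplacian_chart:
  assumes u: "surface_C2 u" and c: "(U, \<phi>) \<in> \<A>" "p \<in> U"
  shows "Laplacian \<A> F u (\<phi> p) = laplace_beltrami (\<lambda>q. F (\<phi> q)) (\<lambda>q. u (\<phi> q)) p"
  unfolding Laplacian_def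
proof (rule invariant_value_chart[OF _ c])
  fix V \<psi> assume d: "(V, \<psi>) \<in> \<A>" "\<phi> p \<in> \<psi> ` V"
  show "laplace_beltrami (\<lambda>q. F (\<phi> q)) (\<lambda>q. u (\<phi> q)) p = laplace_beltrami (\<lambda>q. F (\<psi> q)) (\<lambda>q. u (\<psi> q)) (inv_into V \<psi> (\<phi> p))"
    by (rule coordinate_change.laplace_beltrami_change[OF transition[OF c(1) d(1)] _ surface_C2D[OF u d(1)]])
       (use c d in \<open>auto simp: f_inv_into_f\<close>)
qed

definition Grad_inner :: "('a \<Rightarrow> real) \<Rightarrow> ('a \<Rightarrow> real) \<Rightarrow> 'a \<Rightarrow> real" where
  "Grad_inner u v = invariant_value \<A> (\<lambda>\<phi>. grad_inner (\<lambda>q. F (\<phi> q)) (\<lambda>q. u (\<phi> q)) (\<lambda>q. v (\<phi> q)))"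

lemma Grad_inner_chart:
  assumes u: "surface_C1 u" and v: "surface_C1 v" and c: "(U, \<phi>) \<in> \<A>" "p \<in> U"
  shows "Grad_inner u v (\<phi> p) = grad_inner (\<lambda>q. F (\<phi> q)) (\<lambda>q. u (\<phi> q)) (\<lambda>q. v (\<phi> q)) p"
  unfolding Grad_inner_def
proof (rule invariant_value_chart[OF _ c])
  fix V \<psi> assume d: "(V, \<psi>) \<in> \<A>" "\<phi> p \<in> \<psi> ` V"
  show "grad_inner (\<lambda>q. F (\<phi> q)) (\<lambda>q. u (\<phi> q)) (\<lambda>q. v (\<phi> q)) p
     = grad_inner (\<lambda>q. F (\<psi> q)) (\<lambda>q. u (\<psi> q)) (\<lambda>q. v (\<psi> q)) (inv_into V \<psi> (\<phi> p))"
    by (rule coordinate_change.grad_inner_change[OF transition[OF c(1) d(1)] _ surface_C1D[OF u d(1)] _ surface_C1D[OF v d(1)]])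
       (use c d in \<open>auto simp: f_inv_into_f\<close>)
qed

lemma A_norm_sq_chart:
  assumes c: "(U, \<phi>) \<in> \<A>" "p \<in> U"
  shows "A_norm_sq \<A> F \<nu> (\<phi> p) = sff_norm_sq (\<lambda>q. F (\<phi> q)) (\<lambda>q. \<nu> (\<phi> q)) p"
  unfolding A_norm_sq_def
proof (rule invariant_value_chart[OF _ c])
  fix V \<psi> assume d: "(V, \<psi>) \<in> \<A>" "\<phi> p \<in> \<psi> ` V"
  let ?\<tau> = "\<lambda>p. inv_into V \<psi> (\<phi> p)"
  let ?S = "{p \<in> U. \<phi> p \<in> \<psi> ` V}"
  interpret t: coordinate_change ?S V ?\<tau> "\<lambda>q. F (\<phi> q)" "\<lambda>q. F (\<psi> q)" by (rule transition[OF c(1) d(1)])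
  interpret M: minimal_chart V "\<lambda>q. F (\<psi> q)" "\<lambda>q. \<nu> (\<psi> q)" by (rule minimal_chart[OF d(1)])
  have p: "p \<in> ?S" using c d by auto
  have pV: "?\<tau> p \<in> V" using t.ST p by auto
  have N: "\<forall>p\<in>?S. \<nu> (\<phi> p) = \<nu> (\<psi> (?\<tau> p))" by (auto simp: f_inv_into_f)
  have h: "sff (\<lambda>q. F (\<phi> q)) (\<lambda>q. \<nu> (\<phi> q)) p a b = sff (\<lambda>q. F (\<psi> q)) (\<lambda>q. \<nu> (\<psi> q)) (?\<tau> p) (D_half ?\<tau> p a) (D_half ?\<tau> p b)" for a b
    unfolding sff_def t.D_comp(1)[OF M.X1 t.XY p] t.D_comp(1)[OF M.N1 N p] ..
  have "sff (\<lambda>q. F (\<phi> q)) (\<lambda>q. \<nu> (\<phi> q)) p e1 e1 * sff (\<lambda>q. F (\<phi> q)) (\<lambda>q. \<nu> (\<phi> q)) p e2 e2 - (sff (\<lambda>q. F (\<phi> q)) (\<lambda>q. \<nu> (\<phi> q)) p e1 e2)\<^sup>2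
    = (jac ?\<tau> p)\<^sup>2 * (sff (\<lambda>q. F (\<psi> q)) (\<lambda>q. \<nu> (\<psi> q)) (?\<tau> p) e1 e1 * sff (\<lambda>q. F (\<psi> q)) (\<lambda>q. \<nu> (\<psi> q)) (?\<tau> p) e2 e2 - (sff (\<lambda>q. F (\<psi> q)) (\<lambda>q. \<nu> (\<psi> q)) (?\<tau> p) e1 e2)\<^sup>2)"
    unfolding h M.sff_bilinear[OF pV, of "D_half ?\<tau> p _" "D_half ?\<tau> p _"] jac_def by algebra
  then show "sff_norm_sq (\<lambda>q. F (\<phi> q)) (\<lambda>q. \<nu> (\<phi> q)) p = sff_norm_sq (\<lambda>q. F (\<psi> q)) (\<lambda>q. \<nu> (\<psi> q)) (?\<tau> p)"
    unfolding minimal_chart.sff_norm_sq_eq[OF minimal_chart[OF c(1)] c(2)] M.sff_norm_sq_eq[OF pV] t.det_gram_change[OF p]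
    using t.jac_nonzero[OF p] by (simp only: mult.left_commute[of "-2"]) simp
qed

text \<open>If a coordinate change moved an interior point to the edge, its first component, which is nowhere
  negative, would have an interior minimum there. The differential of that component would vanish,
  and with it the Jacobian.\<close>

lemma edge_transition_aux:
  assumes c: "(U, \<phi>) \<in> \<A>" "p \<in> U" and d: "(V, \<psi>) \<in> \<A>" "\<phi> p \<in> \<psi> ` V" and z: "inv_into V \<psi> (\<phi> p) $ 1 = 0"
  shows "p $ 1 = 0"
proof (rule ccontr)
  assume ne: "p $ 1 \<noteq> 0"
  let ?\<tau> = "\<lambda>p. inv_into V \<psi> (\<phi> p)"
  let ?S = "{p \<in> U. \<phi> p \<in> \<psi> ` V}"
  interpret t: coordinate_change ?S V ?\<tau> "\<lambda>q. F (\<phi> q)" "\<lambda>q. F (\<psi> q)" by (rule transition[OF c(1) d(1)])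
  have p: "p \<in> ?S" using c d by auto
  obtain T where T: "open T" "?S = halfplane \<inter> T" using t.S by (auto simp: openin_open)
  have p1: "0 < p $ 1" using ne p T by (auto simp: halfplane_def)
  let ?O = "T \<inter> {p. 0 < p $ 1}"
  have O: "open ?O" using T by (intro open_Int open_Collect_less continuous_intros) auto
  have OS: "?O \<subseteq> ?S" unfolding T(2) by (auto simp: halfplane_def)
  have pO: "p \<in> ?O" using p p1 T by auto
  have at: "at p within halfplane = at p"
    by (rule at_within_open_subset[OF pO O]) (use OS T in auto)
  have "((\<lambda>q. ?\<tau> q $ 1) has_derivative (\<lambda>a. D_half ?\<tau> p a $ 1)) (at p)"
    using bounded_linear.has_derivative[OF bounded_linear_vec_nth C1_onD[OF C2_on_C1[OF t.\<tau>] p], of 1]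
    unfolding D_half_def at .
  moreover have "?\<tau> q \<in> halfplane" if "q \<in> ?O" for q
    using t.ST OS that openin_imp_subset[OF t.T] by blast
  then have "\<forall>q\<in>?O. ?\<tau> p $ 1 \<le> ?\<tau> q $ 1" using z by (auto simp: halfplane_def)
  ultimately have "(\<lambda>a. D_half ?\<tau> p a $ 1) = (\<lambda>a. 0)"
    using differential_zero_maxmin[OF pO O] by blast
  then have "jac ?\<tau> p = 0" unfolding jac_def by (metis mult_zero_left diff_zero)
  then show False using t.jac_nonzero[OF p] by simp
qed

lemma edge_transition:
  assumes c: "(U, \<phi>) \<in> \<A>" "p \<in> U" and d: "(V, \<psi>) \<in> \<A>" "\<phi> p \<in> \<psi> ` V"
  shows "inv_into V \<psi> (\<phi> p) $ 1 = 0 \<longleftrightarrow> p $ 1 = 0"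
proof
  assume z: "p $ 1 = 0"
  let ?q = "inv_into V \<psi> (\<phi> p)"
  have q: "?q \<in> V" "\<psi> ?q = \<phi> p" using d by (auto intro: inv_into_into simp: f_inv_into_f)
  show "?q $ 1 = 0"
    by (rule edge_transition_aux[OF d(1) q(1) c(1)]) (use q c z transition_inv[OF c, OF refl] in auto)
qed (rule edge_transition_aux[OF c d])

lemma bdry_chart: "(U, \<phi>) \<in> \<A> \<Longrightarrow> p \<in> U \<Longrightarrow> \<phi> p \<in> bdry \<A> \<longleftrightarrow> p $ 1 = 0"
proof
  assume c: "(U, \<phi>) \<in> \<A>" "p \<in> U" and "\<phi> p \<in> bdry \<A>"
  then obtain V \<psi> q where d: "(V, \<psi>) \<in> \<A>" "q \<in> V" "q $ 1 = 0" "\<phi> p = \<psi> q" by (auto simp: bdry_def)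
  show "p $ 1 = 0" by (rule edge_transition_aux[OF c d(1)]) (use d transition_inv[OF d(1,2)] in auto)
qed (auto simp: bdry_def)

lemma bdry_subset: "bdry \<A> \<subseteq> points \<A>" by (auto simp: bdry_def points_def)

lemma surface_continuous:
  assumes "\<And>U \<phi>. (U, \<phi>) \<in> \<A> \<Longrightarrow> continuous_on {p \<in> U. \<phi> p \<in> Z} (\<lambda>q. g (\<phi> q))" and "Z \<subseteq> points \<A>"
  shows "continuous_on Z g"
  unfolding continuous_on_eq_continuous_within
proof
  fix x assume x: "x \<in> Z"
  then obtain U \<phi> p where c: "(U, \<phi>) \<in> \<A>" "p \<in> U" "x = \<phi> p" using assms(2) points_chart by blast
  have o: "openin (top_of_set Z) (Z \<inter> \<phi> ` U)"
  proof -
    obtain T where T: "open T" "\<phi> ` U = points \<A> \<inter> T" using chart_Im[OF c(1)] by (auto simp: openin_open)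
    then have "Z \<inter> \<phi> ` U = Z \<inter> T" using assms(2) by blast
    then show ?thesis using T(1) by (auto simp: openin_open)
  qed
  have "continuous_on (Z \<inter> \<phi> ` U) (\<lambda>y. g (\<phi> (inv_into U \<phi> y)))"
    by (rule continuous_on_compose2[OF assms(1)[OF c(1)] continuous_on_subset[OF chart_inv_cont[OF c(1)]]])
       (auto simp: f_inv_into_f inv_into_into)
  then have "continuous_on (Z \<inter> \<phi> ` U) g"
    by (rule continuous_on_eq) (auto simp: f_inv_into_f)
  then have "continuous (at x within Z \<inter> \<phi> ` U) g"
    using x c by (auto simp: continuous_on_eq_continuous_within)
  then show "continuous (at x within Z) g"
    using at_within_openin[OF o] x c by auto
qed

lemma surface_measurable:
  assumes "\<And>U \<phi>. (U, \<phi>) \<in> \<A> \<Longrightarrow> continuous_on U (\<lambda>q. g (\<phi> q))"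
  shows "g \<in> borel_measurable (restrict_space borel (points \<A>))"
proof (rule borel_measurable_continuous_on_restrict, rule surface_continuous)
  show "continuous_on {p \<in> U. \<phi> p \<in> points \<A>} (\<lambda>q. g (\<phi> q))" if "(U, \<phi>) \<in> \<A>" for U \<phi>
    using assms[OF that] by (rule continuous_on_subset) auto
qed auto

lemma bdry_sets: "bdry \<A> \<in> sets (restrict_space borel (points \<A>))"
proof -
  have "openin (top_of_set (points \<A>)) (points \<A> - bdry \<A>)"
  proof (subst openin_subopen, intro ballI)
    fix x assume x: "x \<in> points \<A> - bdry \<A>"
    then obtain U \<phi> p where c: "(U, \<phi>) \<in> \<A>" "p \<in> U" "x = \<phi> p" using points_chart by blast
    let ?T = "\<phi> ` U \<inter> inv_into U \<phi> -` {p. 0 < p $ 1}"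
    have "openin (top_of_set (\<phi> ` U)) ?T"
      by (rule continuous_openin_preimage_gen[OF chart_inv_cont[OF c(1)]]) (intro open_Collect_less continuous_intros)
    then have "openin (top_of_set (points \<A>)) ?T" using chart_Im[OF c(1)] openin_trans by blast
    moreover have "x \<in> ?T"
    proof -
      have "p $ 1 \<noteq> 0" using x c bdry_chart[OF c(1,2)] by auto
      moreover have "p \<in> halfplane" using c(2) openin_imp_subset[OF chart_hopen[OF c(1)]] by auto
      ultimately show ?thesis using c transition_inv[OF c(1,2)] by (auto simp: halfplane_def)
    qed
    moreover have "?T \<subseteq> points \<A> - bdry \<A>"
    proof
      fix y assume "y \<in> ?T"
      then obtain q where q: "q \<in> U" "y = \<phi> q" "0 < inv_into U \<phi> (\<phi> q) $ 1" by auto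
      then show "y \<in> points \<A> - bdry \<A>"
        using bdry_chart[OF c(1) q(1)] transition_inv[OF c(1) q(1) refl] chart_in_points[OF c(1) q(1)] by auto
    qed
    ultimately show "\<exists>T. openin (top_of_set (points \<A>)) T \<and> x \<in> T \<and> T \<subseteq> points \<A> - bdry \<A>" by blast
  qed
  then obtain T where T: "open T" "points \<A> - bdry \<A> = points \<A> \<inter> T" by (auto simp: openin_open)
  then have "bdry \<A> = points \<A> \<inter> (- T)" using bdry_subset by auto
  moreover have "- T \<in> sets borel" using T by auto
  ultimately show ?thesis by (auto simp: sets_restrict_space)
qed

lemma bdry_measurable:
  fixes g :: "'a \<Rightarrow> real"
  assumes "\<And>U \<phi>. (U, \<phi>) \<in> \<A> \<Longrightarrow> continuous_on {p \<in> U. p $ 1 = 0} (\<lambda>q. g (\<phi> q))"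
  shows "(\<lambda>x. indicator (bdry \<A>) x *\<^sub>R g x) \<in> borel_measurable (restrict_space borel (points \<A>))"
proof -
  have "continuous_on (bdry \<A>) g"
  proof (rule surface_continuous[OF _ bdry_subset])
    show "continuous_on {p \<in> U. \<phi> p \<in> bdry \<A>} (\<lambda>q. g (\<phi> q))" if "(U, \<phi>) \<in> \<A>" for U \<phi>
      using assms[OF that] by (rule continuous_on_subset) (use bdry_chart[OF that] in auto)
  qed
  then have "g \<in> borel_measurable (restrict_space borel (bdry \<A>))" by (rule borel_measurable_continuous_on_restrict)
  moreover have "sets (restrict_space (restrict_space borel (points \<A>)) (bdry \<A>)) = sets (restrict_space borel (bdry \<A>))"
    unfolding sets_restrict_space image_image Int_assoc[symmetric] Int_absorb2[OF bdry_subset] ..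
  ultimately have "g \<in> borel_measurable (restrict_space (restrict_space borel (points \<A>)) (bdry \<A>))"
    by (simp cong: measurable_cong_sets)
  then show ?thesis
    using bdry_sets bdry_subset by (subst borel_measurable_restrict_space_iff[symmetric]) (auto simp: space_restrict_space Int_absorb2)
qed

section \<open>Area and arc length\<close>

lemma preimage_borel:
  fixes h :: "'e::euclidean_space \<Rightarrow> 'a"
  assumes D: "D \<in> sets borel" and h: "continuous_on D h" and B: "B \<in> sets (restrict_space borel (points \<A>))"
    and hD: "h ` D \<subseteq> points \<A>"
  shows "{x \<in> D. h x \<in> B} \<in> sets borel"
proof -
  obtain B' where B': "B' \<in> sets borel" "B = points \<A> \<inter> B'" using B by (auto simp: sets_restrict_space)
  have "h -` B' \<inter> space (restrict_space borel D) \<in> sets (restrict_space borel D)"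
    by (rule measurable_sets[OF borel_measurable_continuous_on_restrict[OF h] B'(1)])
  moreover have "h -` B' \<inter> space (restrict_space borel D) = {x \<in> D. h x \<in> B}"
    using B'(2) hD by (auto simp: space_restrict_space)
  ultimately show ?thesis using D by (auto simp: sets_restrict_space)
qed

lemma measurable_indicator_part:
  fixes h :: "'e::euclidean_space \<Rightarrow> real"
  assumes "D \<in> sets borel" "continuous_on D h" "S \<in> sets borel" "S \<subseteq> D" "\<And>x. x \<in> S \<Longrightarrow> k x = h x"
  shows "(\<lambda>x. indicator S x * k x) \<in> borel_measurable borel"
proof -
  have "(\<lambda>x. indicator S x *\<^sub>R h x) \<in> borel_measurable borel"
    by (rule borel_measurable_continuous_on_indicator[OF assms(3) continuous_on_subset[OF assms(2,4)]])
  moreover have "(\<lambda>x. indicator S x *\<^sub>R h x) = (\<lambda>x. indicator S x * k x)"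
    using assms(5) by (auto simp: fun_eq_iff indicator_def)
  ultimately show ?thesis by simp
qed

definition density_area :: "'a param \<Rightarrow> real^2 \<Rightarrow> real" where
  "density_area c p = sqrt (det (gram (\<lambda>q. F (snd c q)) p))"

definition density_length :: "'a param \<Rightarrow> real \<Rightarrow> real" where
  "density_length c t = norm (D_half (\<lambda>q. F (snd c q)) (edge_point t) e2)"

definition area_form :: "'a param \<Rightarrow> 'a set \<Rightarrow> ennreal" where
  "area_form = (\<lambda>(U, \<phi>) B. \<integral>\<^sup>+p. ennreal (sqrt (det (gram (\<lambda>q. F (\<phi> q)) p))) * indicator {p \<in> U. \<phi> p \<in> B} p \<partial>lborel)"

definition length_form :: "'a param \<Rightarrow> 'a set \<Rightarrow> ennreal" where
  "length_form = (\<lambda>(U, \<phi>) B. \<integral>\<^sup>+t. ennreal (norm (D_half (\<lambda>q. F (\<phi> q)) (vector [0, t]) (axis 2 1))) *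
          indicator {t. vector [0, t] \<in> U \<and> \<phi> (vector [0, t]) \<in> B} t \<partial>lborel)"

lemma density_area_cont: "(U, \<phi>) \<in> \<A> \<Longrightarrow> continuous_on U (density_area (U, \<phi>))"
  unfolding density_area_def snd_conv
  by (intro continuous_on_real_sqrt minimal_chart.det_gram_cont[OF minimal_chart])

lemma density_length_cont: "(U, \<phi>) \<in> \<A> \<Longrightarrow> continuous_on {t. edge_point t \<in> U} (density_length (U, \<phi>))"
  unfolding density_length_def snd_conv
  by (intro continuous_on_norm continuous_on_compose2[OF C1h_cont_D[OF minimal_chart.X1[OF minimal_chart]]] continuous_edge_point) auto

text \<open>The absolute value of the Jacobian determinant of a coordinate change is the factor between the two area densities.\<close>

lemma area_compat:
  assumes c: "(U, \<phi>) \<in> \<A>" and d: "(V, \<psi>) \<in> \<A>" and B: "B \<in> sets (restrict_space borel (points \<A>))"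
    and BI: "B \<subseteq> \<phi> ` U \<inter> \<psi> ` V"
  shows "area_form (U, \<phi>) B = area_form (V, \<psi>) B"
proof -
  let ?\<tau> = "\<lambda>p. inv_into V \<psi> (\<phi> p)" and ?S = "{p \<in> U. \<phi> p \<in> \<psi> ` V}"
  interpret t: coordinate_change ?S V ?\<tau> "\<lambda>q. F (\<phi> q)" "\<lambda>q. F (\<psi> q)" by (rule transition[OF c d])
  let ?B1 = "{p \<in> U. \<phi> p \<in> B}" and ?B2 = "{p \<in> V. \<psi> p \<in> B}"
  let ?f = "\<lambda>y. sqrt (det (gram (\<lambda>q. F (\<psi> q)) y))"
  have B1S: "?B1 \<subseteq> ?S" using BI by auto
  have B1: "?B1 \<in> sets borel"
    by (rule preimage_borel[OF hopen_borel[OF chart_hopen[OF c]] chart_cont[OF c] B]) (use chart_in_points[OF c] in auto)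
  have B2: "?B2 \<in> sets borel"
    by (rule preimage_borel[OF hopen_borel[OF chart_hopen[OF d]] chart_cont[OF d] B]) (use chart_in_points[OF d] in auto)
  have img: "?\<tau> ` ?B1 = ?B2"
  proof
    show "?\<tau> ` ?B1 \<subseteq> ?B2" using BI by (auto simp: f_inv_into_f intro!: inv_into_into)
    show "?B2 \<subseteq> ?\<tau> ` ?B1"
    proof
      fix q assume q: "q \<in> ?B2"
      then obtain p where p: "p \<in> U" "\<psi> q = \<phi> p" using BI by auto
      have "?\<tau> p = q" using transition_inv[OF d _ p(2)] q by auto
      then show "q \<in> ?\<tau> ` ?B1" using p q by (intro image_eqI[of _ _ p]) auto
    qed
  qed
  have inj: "inj_on ?\<tau> ?B1"
  proof (rule inj_onI)
    fix p q assume pq: "p \<in> ?B1" "q \<in> ?B1" "?\<tau> p = ?\<tau> q"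
    then have "\<phi> p \<in> \<psi> ` V" "\<phi> q \<in> \<psi> ` V" using BI by blast+
    then have "\<psi> (?\<tau> p) = \<phi> p" "\<psi> (?\<tau> q) = \<phi> q" by (simp_all only: f_inv_into_f)
    then have "\<phi> p = \<phi> q" using pq(3) by metis
    then show "p = q" by (rule inj_onD[OF chart_inj[OF c]]) (use pq(1,2) in blast)+
  qed
  have j: "\<bar>det (matrix (D_half ?\<tau> p))\<bar> * ?f (?\<tau> p) = density_area (U, \<phi>) p" if "p \<in> ?B1" for p
  proof -
    have p: "p \<in> ?S" using that B1S by blast
    have "det (matrix (D_half ?\<tau> p)) = jac ?\<tau> p" by (simp add: det_2 matrix_def jac_def)
    then show ?thesis unfolding density_area_def snd_conv t.det_gram_change[OF p] by (simp add: real_sqrt_mult)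
  qed
  have "area_form (V, \<psi>) B = (\<integral>\<^sup>+y. ennreal (?f y) * indicator (?\<tau> ` ?B1) y \<partial>lborel)"
    unfolding img by (simp add: area_form_def)
  also have "\<dots> = (\<integral>\<^sup>+p. ennreal (\<bar>det (matrix (D_half ?\<tau> p))\<bar> * ?f (?\<tau> p)) * indicator ?B1 p \<partial>lborel)"
  proof (rule nn_integral_change_of_variables[OF B1 _ inj, symmetric])
    show "(?\<tau> has_derivative D_half ?\<tau> p) (at p within ?B1)" if "p \<in> ?B1" for p
      using C1_onD[OF C2_on_C1[OF t.\<tau>], of p] that B1S openin_imp_subset[OF t.S]
      unfolding D_half_def by (blast intro: has_derivative_subset)
    show "(\<lambda>x. indicator ?B1 x * (\<bar>det (matrix (D_half ?\<tau> x))\<bar> * ?f (?\<tau> x))) \<in> borel_measurable borel"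
      by (rule measurable_indicator_part[OF hopen_borel[OF chart_hopen[OF c]] density_area_cont[OF c] B1 _ j]) auto
    show "(\<lambda>x. indicator (?\<tau> ` ?B1) x * ?f x) \<in> borel_measurable borel"
      unfolding img
      by (rule measurable_indicator_part[OF hopen_borel[OF chart_hopen[OF d]] density_area_cont[OF d] B2]) (auto simp: density_area_def)
    show "0 \<le> ?f y" if "y \<in> ?\<tau> ` ?B1" for y
      using that t.posY[of y] unfolding img by simp
  qed
  also have "\<dots> = area_form (U, \<phi>) B"
    unfolding area_form_def prod.case
    by (intro nn_integral_cong) (use j in \<open>auto simp: indicator_def density_area_def\<close>)
  finally show ?thesis by simp
qed

lemma edge_Dom_borel: "(U, \<phi>) \<in> \<A> \<Longrightarrow> {t. edge_point t \<in> U} \<in> sets borel"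
proof -
  assume c: "(U, \<phi>) \<in> \<A>"
  have "edge_point \<in> borel_measurable borel"
    by (intro borel_measurable_continuous_onI continuous_edge_point)
  from measurable_sets[OF this hopen_borel[OF chart_hopen[OF c]]]
  show ?thesis by (simp add: vimage_def)
qed

lemma edge_chart_cont: "(U, \<phi>) \<in> \<A> \<Longrightarrow> continuous_on {t. edge_point t \<in> U} (\<lambda>t. \<phi> (edge_point t))"
  by (rule continuous_on_compose2[OF chart_cont continuous_edge_point]) auto

text \<open>Coordinate changes map edge points to edge points, so along the edge they are described by a function
  \<open>\<sigma>\<close> of one variable; moreover, the derivative in the edge direction has no first component, and
  \<open>|\<sigma>'|\<close> is the factor between the two length densities.\<close>

lemma length_compat:
  assumes c: "(U, \<phi>) \<in> \<A>" and d: "(V, \<psi>) \<in> \<A>" and B: "B \<in> sets (restrict_space borel (points \<A>))"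
    and BI: "B \<subseteq> \<phi> ` U \<inter> \<psi> ` V"
  shows "length_form (U, \<phi>) B = length_form (V, \<psi>) B"
proof -
  let ?\<tau> = "\<lambda>p. inv_into V \<psi> (\<phi> p)" and ?S = "{p \<in> U. \<phi> p \<in> \<psi> ` V}"
  interpret t: coordinate_change ?S V ?\<tau> "\<lambda>q. F (\<phi> q)" "\<lambda>q. F (\<psi> q)" by (rule transition[OF c d])
  let ?D1 = "{t. edge_point t \<in> U}" and ?D2 = "{t. edge_point t \<in> V}"
  let ?B1 = "{t \<in> ?D1. \<phi> (edge_point t) \<in> B}" and ?B2 = "{t \<in> ?D2. \<psi> (edge_point t) \<in> B}"
  let ?\<sigma> = "\<lambda>t. ?\<tau> (edge_point t) $ 2" and ?\<sigma>' = "\<lambda>t. D_half ?\<tau> (edge_point t) e2 $ 2"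
  let ?f = "density_length (V, \<psi>)"
  have B1S: "edge_point t \<in> ?S" if "t \<in> ?B1" for t using BI that by auto
  have B1: "?B1 \<in> sets borel"
    by (rule preimage_borel[OF edge_Dom_borel[OF c] edge_chart_cont[OF c] B]) (use chart_in_points[OF c] in auto)
  have B2: "?B2 \<in> sets borel"
    by (rule preimage_borel[OF edge_Dom_borel[OF d] edge_chart_cont[OF d] B]) (use chart_in_points[OF d] in auto)
  have tau_edge: "?\<tau> (edge_point t) = edge_point (?\<sigma> t)" if "edge_point t \<in> ?S" for t
    using edge_transition[OF c _ d, of "edge_point t"] that edge_point_eq[of "?\<tau> (edge_point t)"] by auto
  have img: "?\<sigma> ` ?B1 = ?B2"
  proof
    show "?\<sigma> ` ?B1 \<subseteq> ?B2"
    proof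
      fix s assume "s \<in> ?\<sigma> ` ?B1"
      then obtain t where t: "t \<in> ?B1" "s = ?\<sigma> t" by auto
      then have "edge_point s = ?\<tau> (edge_point t)" using tau_edge[OF B1S[OF t(1)]] by simp
      then show "s \<in> ?B2" using B1S[OF t(1)] t(1) by (auto simp: f_inv_into_f inv_into_into)
    qed
    show "?B2 \<subseteq> ?\<sigma> ` ?B1"
    proof
      fix s assume s: "s \<in> ?B2"
      then obtain p where p: "p \<in> U" "\<psi> (edge_point s) = \<phi> p" using BI by auto
      have \<tau>p: "?\<tau> p = edge_point s" using transition_inv[OF d _ p(2)] s by auto
      have pV: "\<phi> p \<in> \<psi> ` V" unfolding p(2)[symmetric] using s by blast
      have "p $ 1 = 0" by (rule iffD1[OF edge_transition[OF c p(1) d pV]]) (simp only: \<tau>p edge_point_nth)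
      then have e: "edge_point (p $ 2) = p" by (rule edge_point_eq)
      have "s = ?\<sigma> (p $ 2)" unfolding e \<tau>p by simp
      moreover have "p $ 2 \<in> ?B1" using p s unfolding mem_Collect_eq e by simp
      ultimately show "s \<in> ?\<sigma> ` ?B1" by (rule image_eqI)
    qed
  qed
  have inj: "inj_on ?\<sigma> ?B1"
  proof (rule inj_onI)
    fix a b assume ab: "a \<in> ?B1" "b \<in> ?B1" "?\<sigma> a = ?\<sigma> b"
    have "?\<tau> (edge_point a) = ?\<tau> (edge_point b)"
      using tau_edge[OF B1S[OF ab(1)]] tau_edge[OF B1S[OF ab(2)]] ab(3) by simp
    moreover have "\<psi> (?\<tau> (edge_point a)) = \<phi> (edge_point a)" "\<psi> (?\<tau> (edge_point b)) = \<phi> (edge_point b)"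
      using B1S[OF ab(1)] B1S[OF ab(2)] by (simp_all only: mem_Collect_eq f_inv_into_f)
    ultimately have "\<phi> (edge_point a) = \<phi> (edge_point b)" by metis
    then have "edge_point a = edge_point b" by (rule inj_onD[OF chart_inj[OF c]]) (use ab(1,2) in blast)+
    then show "a = b" by (metis edge_point_nth(2))
  qed
  have tauD: "(?\<tau> has_derivative D_half ?\<tau> (edge_point t)) (at (edge_point t) within halfplane)" if "edge_point t \<in> ?S" for t
    using C1_onD[OF C2_on_C1[OF t.\<tau>] that] unfolding D_half_def .
  have tau2: "((\<lambda>t. ?\<tau> (edge_point t)) has_derivative (\<lambda>s. s *\<^sub>R D_half ?\<tau> (edge_point t) e2)) (at t within T)"
    if "edge_point t \<in> ?S" for t T
  proof -
    have "(?\<tau> has_derivative D_half ?\<tau> (edge_point t)) (at (edge_point t) within edge_point ` T)"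
      by (rule has_derivative_subset[OF tauD[OF that]]) auto
    from diff_chain_within[OF edge_point_has_derivative this]
    have "(?\<tau> \<circ> edge_point has_derivative D_half ?\<tau> (edge_point t) \<circ> (\<lambda>s. s *\<^sub>R e2)) (at t within T)" .
    moreover have "D_half ?\<tau> (edge_point t) \<circ> (\<lambda>s. s *\<^sub>R e2) = (\<lambda>s. s *\<^sub>R D_half ?\<tau> (edge_point t) e2)"
      using has_derivative_linear[OF tauD[OF that]] by (auto simp: linear_cmul)
    ultimately show ?thesis by (simp add: o_def)
  qed
  have e2_0: "D_half ?\<tau> (edge_point t) e2 $ 1 = 0" if t: "edge_point t \<in> ?S" for t
  proof -
    obtain T where T: "open T" "?S = halfplane \<inter> T" using t.S by (auto simp: openin_open)
    let ?T = "edge_point -` T"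
    have oT: "open ?T" by (rule open_vimage[OF T(1)]) (use continuous_edge_point in \<open>auto simp: continuous_on_eq_continuous_at\<close>)
    have tT: "t \<in> ?T" using t T by auto
    have "((\<lambda>t. ?\<tau> (edge_point t) $ 1) has_derivative (\<lambda>s. s * D_half ?\<tau> (edge_point t) e2 $ 1)) (at t)"
      using bounded_linear.has_derivative[OF bounded_linear_vec_nth tau2[OF t, of UNIV], of 1] by simp
    moreover have "((\<lambda>t. ?\<tau> (edge_point t) $ 1) has_derivative (\<lambda>s. 0)) (at t)"
    proof (rule has_derivative_transform_within_open[OF has_derivative_const oT tT])
      fix s assume "s \<in> ?T"
      then have "edge_point s \<in> ?S" using T by auto
      from tau_edge[OF this] show "0 = ?\<tau> (edge_point s) $ 1" by (metis edge_point_nth(1))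
    qed
    ultimately have "(\<lambda>s. s * D_half ?\<tau> (edge_point t) e2 $ 1) = (\<lambda>s. 0)" by (rule has_derivative_unique)
    from fun_cong[OF this, of 1] show ?thesis by simp
  qed
  have j: "\<bar>?\<sigma>' t\<bar> * ?f (?\<sigma> t) = density_length (U, \<phi>) t" if "t \<in> ?B1" for t
  proof -
    note t = B1S[OF that]
    show ?thesis unfolding density_length_def snd_conv tau_edge[OF t, symmetric] t.DX[OF t] e2_0[OF t] by simp
  qed
  have "length_form (V, \<psi>) B = (\<integral>\<^sup>+y. ennreal (?f y) * indicator (?\<sigma> ` ?B1) y \<partial>lborel)"
    unfolding img by (simp add: length_form_def density_length_def vector_edge)
  also have "\<dots> = (\<integral>\<^sup>+t. ennreal (\<bar>?\<sigma>' t\<bar> * ?f (?\<sigma> t)) * indicator ?B1 t \<partial>lborel)"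
  proof (rule nn_integral_change_of_variables_real[OF B1 _ inj, symmetric])
    show "(?\<sigma> has_field_derivative ?\<sigma>' t) (at t within ?B1)" if "t \<in> ?B1" for t
      using bounded_linear.has_derivative[OF bounded_linear_vec_nth tau2[OF B1S[OF that], of ?B1], of 2]
      by (simp add: has_field_derivative_def mult_commute_abs)
    show "(\<lambda>x. indicator ?B1 x * (\<bar>?\<sigma>' x\<bar> * ?f (?\<sigma> x))) \<in> borel_measurable borel"
      by (rule measurable_indicator_part[OF edge_Dom_borel[OF c] density_length_cont[OF c] B1 _ j]) auto
    show "(\<lambda>x. indicator (?\<sigma> ` ?B1) x * ?f x) \<in> borel_measurable borel"
      unfolding img
      by (rule measurable_indicator_part[OF edge_Dom_borel[OF d] density_length_cont[OF d] B2]) auto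
    show "0 \<le> ?f y" for y by (simp add: density_length_def)
  qed
  also have "\<dots> = length_form (U, \<phi>) B"
    unfolding length_form_def prod.case vector_edge
    by (intro nn_integral_cong) (use j in \<open>auto simp: indicator_def density_length_def\<close>)
  finally show ?thesis by simp
qed

sublocale area: glue \<A> "\<lambda>c. fst c" density_area "\<lambda>c. snd c" area_form
proof
  show "continuous_on (fst c) (snd c)" if "c \<in> \<A>" for c using chart_cont[of "fst c" "snd c"] that by simp
  show "continuous_on (fst c) (density_area c)" if "c \<in> \<A>" for c using density_area_cont[of "fst c" "snd c"] that by simp
  show "fst c \<in> sets borel" if "c \<in> \<A>" for c using hopen_borel[OF chart_hopen[of "fst c" "snd c"]] that by simp
  show "0 \<le> density_area c x" if "c \<in> \<A>" "x \<in> fst c" for c x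
    using minimal_chart.pos[OF minimal_chart[of "fst c" "snd c"]] that by (auto simp: density_area_def intro!: less_imp_le)
  show "area_form c B = (\<integral>\<^sup>+x. ennreal (density_area c x) * indicator {x \<in> fst c. snd c x \<in> B} x \<partial>lborel)" for c B
    by (simp add: area_form_def density_area_def case_prod_beta)
qed (simp_all only: chart_Im area_compat fst_conv snd_conv order_refl)

sublocale edge: glue \<A> "\<lambda>c. {t. edge_point t \<in> fst c}" density_length "\<lambda>c t. snd c (edge_point t)" length_form
proof
  show "continuous_on {t. edge_point t \<in> fst c} (\<lambda>t. snd c (edge_point t))" if "c \<in> \<A>" for c
    using edge_chart_cont[of "fst c" "snd c"] that by simp
  show "continuous_on {t. edge_point t \<in> fst c} (density_length c)" if "c \<in> \<A>" for c
    using density_length_cont[of "fst c" "snd c"] that by simp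
  show "{t. edge_point t \<in> fst c} \<in> sets borel" if "c \<in> \<A>" for c using edge_Dom_borel[of "fst c" "snd c"] that by simp
  show "0 \<le> density_length c x" for c x by (simp add: density_length_def)
  show "length_form c B = (\<integral>\<^sup>+x. ennreal (density_length c x) * indicator {x \<in> {t. edge_point t \<in> fst c}. snd c (edge_point x) \<in> B} x \<partial>lborel)" for c B
    by (simp add: length_form_def density_length_def case_prod_beta vector_edge)
qed (auto simp only: chart_Im length_compat fst_conv snd_conv)

lemma area_measure_eq: "area_measure \<A> F = glued_measure \<A> area_form"
  by (simp add: area_measure_def area_form_def)

lemma bdry_measure_eq: "bdry_measure \<A> F = glued_measure \<A> length_form"
  by (simp add: bdry_measure_def length_form_def)

end

section \<open>The divergence theorem in the half-plane\<close>

definition pt :: "real \<Rightarrow> real \<Rightarrow> real^2" where "pt x y = x *\<^sub>R e1 + y *\<^sub>R e2"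

lemma pt_nth [simp]: "pt x y $ 1 = x" "pt x y $ 2 = y" by (simp_all add: pt_def axis_def)

lemma pt_halfplane [simp]: "pt x y \<in> halfplane \<longleftrightarrow> 0 \<le> x" by (simp add: halfplane_def)

lemma Basis_real2: "(Basis :: (real^2) set) = {e1, e2}"
  by (auto simp: Basis_vec_def UNIV_2)

lemma lborel_real2: "lborel = distr (lborel \<Otimes>\<^sub>M lborel) borel (\<lambda>(x, y). pt x y)"
proof (rule lborel_eqI)
  have [measurable]: "(\<lambda>(x, y). pt x y) \<in> borel_measurable (lborel \<Otimes>\<^sub>M lborel)"
    unfolding pt_def by measurable
  fix l u :: "real^2" assume lu: "\<And>b. b \<in> Basis \<Longrightarrow> l \<bullet> b \<le> u \<bullet> b"
  have lu': "l $ 1 \<le> u $ 1" "l $ 2 \<le> u $ 2"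
    using lu[of e1] lu[of e2] by (auto simp: Basis_real2 inner_axis)
  have vi: "(\<lambda>(x, y). pt x y) -` box l u \<inter> space (lborel \<Otimes>\<^sub>M lborel) = {l $ 1<..<u $ 1} \<times> {l $ 2<..<u $ 2}"
    by (auto simp: box_def Basis_real2 inner_axis space_pair_measure)
  have "emeasure (distr (lborel \<Otimes>\<^sub>M lborel) borel (\<lambda>(x, y). pt x y)) (box l u)
      = emeasure (lborel \<Otimes>\<^sub>M lborel) ({l $ 1<..<u $ 1} \<times> {l $ 2<..<u $ 2})"
    by (subst emeasure_distr) (simp_all add: vi)
  also have "\<dots> = ennreal (u $ 1 - l $ 1) * ennreal (u $ 2 - l $ 2)"
    using lu' by (simp add: lborel.emeasure_pair_measure_Times)
  also have "\<dots> = (\<Prod>b\<in>Basis. (u - l) \<bullet> b)"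
    using lu' by (simp add: Basis_real2 axis_eq_axis inner_axis ennreal_mult)
  finally show "emeasure (distr (lborel \<Otimes>\<^sub>M lborel) borel (\<lambda>(x, y). pt x y)) (box l u) = (\<Prod>b\<in>Basis. (u - l) \<bullet> b)" .
qed simp

lemma integral_real2:
  fixes f :: "real^2 \<Rightarrow> real"
  assumes f: "integrable lborel f"
  shows "(\<integral>p. f p \<partial>lborel) = (\<integral>x. \<integral>y. f (pt x y) \<partial>lborel \<partial>lborel)"
    and "(\<integral>p. f p \<partial>lborel) = (\<integral>y. \<integral>x. f (pt x y) \<partial>lborel \<partial>lborel)"
proof -
  have m: "(\<lambda>(x, y). pt x y) \<in> lborel \<Otimes>\<^sub>M lborel \<rightarrow>\<^sub>M borel"
    unfolding pt_def by measurable
  have fb: "f \<in> borel_measurable borel" using f by simp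
  have "integrable (distr (lborel \<Otimes>\<^sub>M lborel) borel (\<lambda>(x, y). pt x y)) f" using f lborel_real2 by simp
  then have i: "integrable (lborel \<Otimes>\<^sub>M lborel) (\<lambda>z. f (case z of (x, y) \<Rightarrow> pt x y))"
    by (rule integrable_distr[OF m])
  have "(\<integral>p. f p \<partial>lborel) = (\<integral>z. f (case z of (x, y) \<Rightarrow> pt x y) \<partial>(lborel \<Otimes>\<^sub>M lborel))"
    by (subst lborel_real2) (rule integral_distr[OF m fb])
  moreover have i': "integrable (lborel \<Otimes>\<^sub>M lborel) (\<lambda>(x, y). f (pt x y))" using i by (simp add: case_prod_beta')
  ultimately have e: "(\<integral>p. f p \<partial>lborel) = (\<integral>(x, y). f (pt x y) \<partial>(lborel \<Otimes>\<^sub>M lborel))" by (simp add: case_prod_beta')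
  show "(\<integral>p. f p \<partial>lborel) = (\<integral>x. \<integral>y. f (pt x y) \<partial>lborel \<partial>lborel)"
    unfolding e using lborel_pair.integral_fst'[OF i'] by simp
  show "(\<integral>p. f p \<partial>lborel) = (\<integral>y. \<integral>x. f (pt x y) \<partial>lborel \<partial>lborel)"
    unfolding e using lborel_pair.integral_snd[OF i'] by simp
qed

lemma compact_box_bound:
  fixes K :: "(real^2) set"
  assumes "compact K" obtains M where "0 < M" "\<And>p i. p \<in> K \<Longrightarrow> \<bar>p $ i\<bar> < M"
proof -
  obtain b where b: "\<And>p. p \<in> K \<Longrightarrow> norm p \<le> b" using compact_imp_bounded[OF assms] by (auto simp: bounded_iff)
  show ?thesis
  proof (rule that[of "\<bar>b\<bar> + 1"])
    show "\<bar>p $ i\<bar> < \<bar>b\<bar> + 1" if "p \<in> K" for p i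
      using b[OF that] component_le_norm_cart[of p i] by linarith
  qed simp
qed

lemma D_half_zero_outside:
  fixes H :: "real^2 \<Rightarrow> real"
  assumes K: "compact K" and H0: "\<forall>p\<in>halfplane - K. H p = 0" and p: "p \<in> halfplane - K"
  shows "D_half H p a = 0"
proof -
  have o: "hopen (halfplane - K)"
    using compact_imp_closed[OF K] by (auto simp: openin_open Diff_eq intro!: exI[of _ "- K"])
  have "D_half H p = D_half (\<lambda>_. 0) p" by (rule D_half_cong[OF o p]) (use H0 in blast)
  then show ?thesis using D_half_const[OF o p, of "0::real"] by simp
qed

text \<open>On a line parallel to an axis, the derivative of a compactly supported function integrates to the
  difference of its end values. These vanish except where the line meets the edge.\<close>

lemma
  fixes H :: "real^2 \<Rightarrow> real"
  assumes K: "compact K" and H0: "\<forall>p\<in>halfplane - K. H p = 0" and H: "C1_on halfplane H halfplane"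
  shows integrable_D_half: "integrable lborel (\<lambda>p. indicator halfplane p * D_half H p a)"
    and integral_D_half_e1: "(\<integral>p. indicator halfplane p * D_half H p e1 \<partial>lborel) = - (\<integral>t. H (edge_point t) \<partial>lborel)"
    and integral_D_half_e2: "(\<integral>p. indicator halfplane p * D_half H p e2 \<partial>lborel) = 0"
proof -
  have hh: "hopen halfplane" by simp
  have Kh: "compact (K \<inter> halfplane)" using K closed_halfplane by (rule compact_Int_closed)
  show int: "integrable lborel (\<lambda>p. indicator halfplane p * D_half H p a)" for a
  proof -
    have "continuous_on (K \<inter> halfplane) (\<lambda>p. D_half H p a)"
      by (rule continuous_on_subset[OF C1h_cont_D[OF H]]) auto
    from borel_integrable_compact[OF Kh this]
    have "integrable lborel (\<lambda>p. indicator (K \<inter> halfplane) p *\<^sub>R D_half H p a)" .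
    moreover have "(\<lambda>p. indicator (K \<inter> halfplane) p *\<^sub>R D_half H p a) = (\<lambda>p. indicator halfplane p * D_half H p a)"
      using D_half_zero_outside[OF K H0] by (auto simp: indicator_def fun_eq_iff)
    ultimately show ?thesis by (simp only:)
  qed
  obtain M where M: "0 < M" "\<And>p i. p \<in> K \<Longrightarrow> \<bar>p $ i\<bar> < M" using compact_box_bound[OF K] by blast
  have out: "H (pt x y) = 0" "D_half H (pt x y) a = 0" if "0 \<le> x" "M \<le> \<bar>x\<bar> \<or> M \<le> \<bar>y\<bar>" for x y a
  proof -
    have "pt x y \<in> halfplane - K" using that M(2)[of "pt x y" 1] M(2)[of "pt x y" 2] by auto
    then show "H (pt x y) = 0" "D_half H (pt x y) a = 0" using H0 D_half_zero_outside[OF K H0] by auto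
  qed
  have HD: "(H has_derivative D_half H (pt x y)) (at (pt x y) within halfplane)" if "0 \<le> x" for x y
    using C1_onD[OF H, of "pt x y"] that unfolding D_half_def by simp
  have lin: "D_half H (pt x y) (s *\<^sub>R a) = s * D_half H (pt x y) a" if "0 \<le> x" for x y s a
    using has_derivative_linear[OF HD[OF that]] by (simp add: linear_cmul)
  have slice1: "(\<integral>x. indicator halfplane (pt x y) * D_half H (pt x y) e1 \<partial>lborel) = - H (pt 0 y)" for y
  proof -
    have "(\<integral>x. indicator halfplane (pt x y) * D_half H (pt x y) e1 \<partial>lborel)
      = (\<integral>x. indicator {0..M} x *\<^sub>R D_half H (pt x y) e1 \<partial>lborel)"
      using out(2) by (intro Bochner_Integration.integral_cong) (auto simp: indicator_def)
    also have "\<dots> = H (pt M y) - H (pt 0 y)"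
    proof (rule integral_FTC_Icc)
      show "((\<lambda>x. H (pt x y)) has_vector_derivative D_half H (pt x y) e1) (at x within {0..M})" if "0 \<le> x" "x \<le> M" for x
      proof -
        have "((\<lambda>x. pt x y) has_derivative (\<lambda>s. s *\<^sub>R e1)) (at x within {0..M})"
          unfolding pt_def by (auto intro!: derivative_eq_intros)
        moreover have "(H has_derivative D_half H (pt x y)) (at (pt x y) within (\<lambda>x. pt x y) ` {0..M})"
          by (rule has_derivative_subset[OF HD]) (use that in auto)
        ultimately have "(H \<circ> (\<lambda>x. pt x y) has_derivative D_half H (pt x y) \<circ> (\<lambda>s. s *\<^sub>R e1)) (at x within {0..M})"
          by (rule diff_chain_within)
        then show ?thesis by (simp add: has_vector_derivative_def o_def lin that)
      qed
      show "continuous_on {0..M} (\<lambda>x. D_half H (pt x y) e1)"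
        by (rule continuous_on_compose2[OF C1h_cont_D[OF H]]) (auto simp: pt_def[abs_def] halfplane_def axis_def intro!: continuous_intros)
    qed (use M in auto)
    also have "H (pt M y) = 0" using out(1)[of M y] M by auto
    finally show ?thesis by simp
  qed
  have slice2: "(\<integral>y. indicator halfplane (pt x y) * D_half H (pt x y) e2 \<partial>lborel) = 0" for x
  proof (cases "0 \<le> x")
    case True
    have "(\<integral>y. indicator halfplane (pt x y) * D_half H (pt x y) e2 \<partial>lborel)
      = (\<integral>y. indicator {-M..M} y *\<^sub>R D_half H (pt x y) e2 \<partial>lborel)"
    proof (intro Bochner_Integration.integral_cong refl)
      show "indicator halfplane (pt x y) * D_half H (pt x y) e2 = indicator {-M..M} y *\<^sub>R D_half H (pt x y) e2" for y
        using out(2)[of x y e2] True by (cases "M \<le> \<bar>y\<bar>") (auto simp: indicator_def)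
    qed
    also have "\<dots> = H (pt x M) - H (pt x (-M))"
    proof (rule integral_FTC_Icc)
      show "((\<lambda>y. H (pt x y)) has_vector_derivative D_half H (pt x y) e2) (at y within {-M..M})" for y
      proof -
        have "((\<lambda>y. pt x y) has_derivative (\<lambda>s. s *\<^sub>R e2)) (at y within {-M..M})"
          unfolding pt_def by (auto intro!: derivative_eq_intros)
        moreover have "(H has_derivative D_half H (pt x y)) (at (pt x y) within (\<lambda>y. pt x y) ` {-M..M})"
          by (rule has_derivative_subset[OF HD]) (use True in auto)
        ultimately have "(H \<circ> (\<lambda>y. pt x y) has_derivative D_half H (pt x y) \<circ> (\<lambda>s. s *\<^sub>R e2)) (at y within {-M..M})"
          by (rule diff_chain_within)
        then show ?thesis by (simp add: has_vector_derivative_def o_def lin True)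
      qed
      show "continuous_on {-M..M} (\<lambda>y. D_half H (pt x y) e2)"
        by (rule continuous_on_compose2[OF C1h_cont_D[OF H]]) (use True in \<open>auto simp: pt_def[abs_def] halfplane_def axis_def intro!: continuous_intros\<close>)
    qed (use M in auto)
    also have "\<dots> = 0" using out(1)[of x M] out(1)[of x "-M"] M True by auto
    finally show ?thesis .
  qed simp
  show "(\<integral>p. indicator halfplane p * D_half H p e1 \<partial>lborel) = - (\<integral>t. H (edge_point t) \<partial>lborel)"
    unfolding integral_real2(2)[OF int] slice1 by (simp add: pt_def edge_point_def)
  show "(\<integral>p. indicator halfplane p * D_half H p e2 \<partial>lborel) = 0"
    unfolding integral_real2(1)[OF int] slice2 by simp
qed

lemma continuous_integral_zero:
  fixes h :: "real^2 \<Rightarrow> real"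
  assumes U: "hopen U" and h: "continuous_on U h" and nonneg: "\<And>p. p \<in> U \<Longrightarrow> 0 \<le> h p"
    and int: "integrable lborel (\<lambda>p. indicator U p * h p)" and zero: "(\<integral>p. indicator U p * h p \<partial>lborel) = 0" and p: "p \<in> U"
  shows "h p = 0"
proof (rule ccontr)
  assume "h p \<noteq> 0"
  then have hp: "0 < h p" using nonneg[OF p] by simp
  have AE: "AE x in lborel. indicator U x * h x = 0"
    using zero integral_nonneg_eq_0_iff_AE[OF int] nonneg by (auto simp: indicator_def)
  have "openin (top_of_set U) (U \<inter> h -` {0<..})" by (rule continuous_openin_preimage_gen[OF h]) simp
  then have "hopen (U \<inter> h -` {0<..})" using U openin_trans by blast
  then obtain T where T: "open T" "U \<inter> h -` {0<..} = halfplane \<inter> T" by (auto simp: openin_open)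
  have pT: "p \<in> halfplane" "p \<in> T" using p hp T(2) by auto
  obtain e where e: "0 < e" "ball p e \<subseteq> T" using T(1) pT openE by blast
  let ?q = "p + (e/2) *\<^sub>R e1"
  have "?q \<in> ball p e" using e(1) by (simp add: dist_norm)
  moreover have "0 < ?q $ 1" using pT(1) e(1) by (simp add: halfplane_def axis_def)
  moreover have "open (T \<inter> {q. 0 < q $ 1})" using T(1) by (intro open_Int open_Collect_less continuous_intros) auto
  ultimately have qT: "?q \<in> T \<inter> {q. 0 < q $ 1}" and O: "open (T \<inter> {q. 0 < q $ 1})" using e(2) by auto
  from AE have "AE x in lborel. x \<notin> T \<inter> {q. 0 < q $ 1}"
  proof (eventually_elim)
    case (elim x)
    show ?case
    proof
      assume "x \<in> T \<inter> {q. 0 < q $ 1}"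
      then have "x \<in> U \<inter> h -` {0<..}" unfolding T(2) by (auto simp: halfplane_def)
      then show False using elim by auto
    qed
  qed
  then have "T \<inter> {q. 0 < q $ 1} \<in> null_sets lborel"
    using O by (subst AE_iff_null_sets) auto
  then have "negligible (T \<inter> {q. 0 < q $ 1})"
    by (simp add: negligible_iff_null_sets null_sets_completionI)
  then show False using open_not_negligible[OF O] qT by blast
qed

section \<open>Powers of the positive part\<close>

text \<open>Powers of the positive part serve as explicit cutoff profiles: the square is of class \<open>C\<^sup>1\<close> and the
  cube is of class \<open>C\<^sup>2\<close>.\<close>

lemma pos_part_power_deriv:
  "((\<lambda>x::real. max 0 x ^ Suc (Suc n)) has_real_derivative real (Suc (Suc n)) * max 0 x ^ Suc n) (at x)"
proof -
  consider "0 < x" | "x < 0" | "x = 0" by linarith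
  then show ?thesis
  proof cases
    case 1
    have "((\<lambda>x. x ^ Suc (Suc n)) has_real_derivative real (Suc (Suc n)) * x ^ Suc n) (at x)"
      using DERIV_pow[of "Suc (Suc n)" x] by simp
    then have "((\<lambda>x. max 0 x ^ Suc (Suc n)) has_real_derivative real (Suc (Suc n)) * x ^ Suc n) (at x)"
      by (rule has_field_derivative_transform_within_open[of _ _ _ "{0<..}"]) (use 1 in auto)
    then show ?thesis using 1 by simp
  next
    case 2
    have "((\<lambda>x. max 0 x ^ Suc (Suc n)) has_real_derivative 0) (at x)"
      by (rule has_field_derivative_transform_within_open[OF DERIV_const[of 0], of "{..<0}"]) (use 2 in auto)
    then show ?thesis using 2 by simp
  next
    case 3
    have "isCont (\<lambda>x::real. max 0 x ^ Suc n) 0" by (intro continuous_intros)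
    moreover have "max 0 z ^ Suc (Suc n) - max 0 0 ^ Suc (Suc n) = max 0 z ^ Suc n * (z - 0)" for z :: real
      by (auto simp: max_def)
    ultimately have "((\<lambda>x::real. max 0 x ^ Suc (Suc n)) has_real_derivative 0) (at 0)"
      unfolding CARAT_DERIV by (intro exI[of _ "\<lambda>x. max 0 x ^ Suc n"]) auto
    then show ?thesis using 3 by simp
  qed
qed

context minimal_surface
begin

section \<open>Function calculus on the surface\<close>

definition surface_cont :: "('a \<Rightarrow> real) \<Rightarrow> bool" where
  "surface_cont h \<longleftrightarrow> (\<forall>(U, \<phi>)\<in>\<A>. continuous_on U (\<lambda>q. h (\<phi> q)))"

definition vanishes_off :: "('a \<Rightarrow> real) \<Rightarrow> 'a set \<Rightarrow> bool" where
  "vanishes_off g C \<longleftrightarrow> (\<forall>x\<in>points \<A> - C. g x = 0)"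

lemma surface_contD: "surface_cont h \<Longrightarrow> (U, \<phi>) \<in> \<A> \<Longrightarrow> continuous_on U (\<lambda>q. h (\<phi> q))"
  unfolding surface_cont_def by blast

lemma surface_cont_measurable: "surface_cont h \<Longrightarrow> h \<in> borel_measurable (restrict_space borel (points \<A>))"
  by (rule surface_measurable) (rule surface_contD)

lemma surface_C1_cont: "surface_C1 g \<Longrightarrow> surface_cont g"
  unfolding surface_C1_def surface_cont_def
  using C1_on_cont openin_imp_subset[OF chart_hopen] by blast

lemma surface_cont_mult: "surface_cont g \<Longrightarrow> surface_cont h \<Longrightarrow> surface_cont (\<lambda>x. g x * h x)"
  and surface_cont_add: "surface_cont g \<Longrightarrow> surface_cont h \<Longrightarrow> surface_cont (\<lambda>x. g x + h x)"
  unfolding surface_cont_def by (auto intro!: continuous_intros)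

lemma surface_C1I: "(\<And>U \<phi>. (U, \<phi>) \<in> \<A> \<Longrightarrow> C1_on halfplane (\<lambda>q. g (\<phi> q)) U) \<Longrightarrow> surface_C1 g"
  unfolding surface_C1_def by auto

lemma surface_C1_mult: "surface_C1 g \<Longrightarrow> surface_C1 h \<Longrightarrow> surface_C1 (\<lambda>x. g x * h x)"
  by (rule surface_C1I) (rule C1h_mult[OF chart_hopen surface_C1D surface_C1D])

lemma surface_C1_add: "surface_C1 g \<Longrightarrow> surface_C1 h \<Longrightarrow> surface_C1 (\<lambda>x. g x + h x)"
  by (rule surface_C1I) (rule C1h_add[OF chart_hopen surface_C1D surface_C1D])

lemma surface_C1_diff: "surface_C1 g \<Longrightarrow> surface_C1 h \<Longrightarrow> surface_C1 (\<lambda>x. g x - h x)"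
  by (rule surface_C1I) (rule C1h_minus(1)[OF chart_hopen surface_C1D surface_C1D])

lemma surface_C1_const: "surface_C1 (\<lambda>x. c)"
  by (rule surface_C1I) (rule C1h_const[OF chart_hopen])

lemma density_area_pos: "(U, \<phi>) \<in> \<A> \<Longrightarrow> p \<in> U \<Longrightarrow> 0 < density_area (U, \<phi>) p"
  using minimal_chart.pos[OF minimal_chart] by (simp add: density_area_def)

lemma vanishes_off_chart:
  assumes c: "(U, \<phi>) \<in> \<A>" and "vanishes_off k (\<phi> ` K)" "K \<subseteq> U" "p \<in> U" "p \<notin> K"
  shows "k (\<phi> p) = 0"
  using assms inj_on_image_mem_iff[OF chart_inj[OF c] assms(4,3)] chart_in_points[OF c assms(4)]
  by (simp add: vanishes_off_def)

lemma Laplacian_cont: assumes u: "surface_C2 u" shows "surface_cont (Laplacian \<A> F u)"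
  unfolding surface_cont_def
proof clarify
  fix U \<phi> assume c: "(U, \<phi>) \<in> \<A>"
  interpret M: minimal_chart U "\<lambda>q. F (\<phi> q)" "\<lambda>q. \<nu> (\<phi> q)" by (rule minimal_chart[OF c])
  note fl = flux_C1[OF M.U M.X surface_C2D[OF u c] M.pos]
  have "continuous_on U (\<lambda>q. (D_half (flux1 (\<lambda>q. F (\<phi> q)) (\<lambda>q. u (\<phi> q))) q e1 + D_half (flux2 (\<lambda>q. F (\<phi> q)) (\<lambda>q. u (\<phi> q))) q e2) / density_area (U, \<phi>) q)"
    by (intro continuous_on_divide continuous_on_add C1h_cont_D[OF fl(2)] C1h_cont_D[OF fl(3)] density_area_cont[OF c] ballI
       less_imp_neq[OF density_area_pos[OF c], symmetric])
  then show "continuous_on U (\<lambda>q. Laplacian \<A> F u (\<phi> q))"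
    by (rule continuous_on_eq)
       (simp add: Laplacian_chart[OF u c] laplace_beltrami_flux[OF M.U _ M.pos] density_area_def)
qed

lemma Grad_inner_cont: assumes u: "surface_C1 u" and v: "surface_C1 v" shows "surface_cont (Grad_inner u v)"
  unfolding surface_cont_def
proof clarify
  fix U \<phi> assume c: "(U, \<phi>) \<in> \<A>"
  interpret M: minimal_chart U "\<lambda>q. F (\<phi> q)" "\<lambda>q. \<nu> (\<phi> q)" by (rule minimal_chart[OF c])
  have "continuous_on U (grad_inner (\<lambda>q. F (\<phi> q)) (\<lambda>q. u (\<phi> q)) (\<lambda>q. v (\<phi> q)))"
    unfolding grad_inner_def
    by (intro continuous_on_divide continuous_on_diff continuous_on_add continuous_on_mult continuous_on_inner
       C1h_cont_D[OF M.X1] C1h_cont_D[OF surface_C1D[OF u c]] C1h_cont_D[OF surface_C1D[OF v c]] M.det_gram_cont ballI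
       less_imp_neq[OF M.pos, symmetric])
  then show "continuous_on U (\<lambda>q. Grad_inner u v (\<phi> q))"
    by (rule continuous_on_eq) (simp add: Grad_inner_chart[OF u v c])
qed

lemma A_norm_sq_cont: "surface_cont (A_norm_sq \<A> F \<nu>)"
  unfolding surface_cont_def
proof clarify
  fix U \<phi> assume c: "(U, \<phi>) \<in> \<A>"
  show "continuous_on U (\<lambda>q. A_norm_sq \<A> F \<nu> (\<phi> q))"
    by (rule continuous_on_eq[OF minimal_chart.sff_norm_sq_cont[OF minimal_chart[OF c]]])
       (simp add: A_norm_sq_chart[OF c])
qed

lemma Grad_inner_add:
  assumes g: "surface_C1 g" and h: "surface_C1 h" and u: "surface_C1 u" and x: "x \<in> points \<A>"
  shows "Grad_inner (\<lambda>x. g x + h x) u x = Grad_inner g u x + Grad_inner h u x"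
proof -
  obtain U \<phi> p where c: "(U, \<phi>) \<in> \<A>" "p \<in> U" and x: "x = \<phi> p" using x points_chart by blast
  have "D_half (\<lambda>q. g (\<phi> q) + h (\<phi> q)) p a = D_half (\<lambda>q. g (\<phi> q)) p a + D_half (\<lambda>q. h (\<phi> q)) p a" for a
    using D_half_add[OF chart_hopen[OF c(1)] surface_C1D[OF g c(1)] surface_C1D[OF h c(1)] c(2)] by simp
  then show ?thesis
    unfolding x Grad_inner_chart[OF surface_C1_add[OF g h] u c] Grad_inner_chart[OF g u c] Grad_inner_chart[OF h u c]
      grad_inner_def
    by (simp add: add_divide_distrib diff_divide_distrib algebra_simps)
qed

lemma hopen_off_compact:
  assumes "(V, \<psi>) \<in> \<A>" "compact C" shows "hopen {q \<in> V. \<psi> q \<notin> C}"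
proof -
  have "openin (top_of_set V) (V \<inter> \<psi> -` (- C))"
    by (rule continuous_openin_preimage_gen[OF chart_cont[OF assms(1)]]) (use assms(2) compact_imp_closed in auto)
  also have "V \<inter> \<psi> -` (- C) = {q \<in> V. \<psi> q \<notin> C}" by auto
  finally show ?thesis using chart_hopen[OF assms(1)] openin_trans by blast
qed

lemma D_half_vanishes_off:
  assumes c: "(U, \<phi>) \<in> \<A>" "p \<in> U" and C: "compact C" "vanishes_off g C" and p: "\<phi> p \<notin> C"
  shows "D_half (\<lambda>q. g (\<phi> q)) p a = 0"
proof -
  have o: "hopen {q \<in> U. \<phi> q \<notin> C}" by (rule hopen_off_compact[OF c(1) C(1)])
  have p': "p \<in> {q \<in> U. \<phi> q \<notin> C}" using c p by auto
  have "D_half (\<lambda>q. g (\<phi> q)) p = D_half (\<lambda>_. 0) p"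
    by (rule D_half_cong[OF o p']) (use C(2) chart_in_points[OF c(1)] in \<open>auto simp: vanishes_off_def\<close>)
  then show ?thesis using D_half_const[OF o p', of "0::real"] by simp
qed

lemma Grad_inner_vanishes_off:
  assumes g: "surface_C1 g" and u: "surface_C1 u" and C: "compact C" "vanishes_off g C"
  shows "vanishes_off (Grad_inner g u) C"
  unfolding vanishes_off_def
proof
  fix x assume x: "x \<in> points \<A> - C"
  then obtain U \<phi> p where c: "(U, \<phi>) \<in> \<A>" "p \<in> U" and x': "x = \<phi> p" using points_chart by blast
  have "D_half (\<lambda>q. g (\<phi> q)) p a = 0" for a by (rule D_half_vanishes_off[OF c C]) (use x x' in auto)
  then show "Grad_inner g u x = 0" unfolding x' Grad_inner_chart[OF g u c] grad_inner_def by simp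
qed

lemma vanishes_off_mult: "vanishes_off g C \<Longrightarrow> vanishes_off (\<lambda>x. g x * h x) C"
  by (auto simp: vanishes_off_def)

lemma integrable_area_local:
  assumes c: "(U, \<phi>) \<in> \<A>" and K: "compact K" "K \<subseteq> U" and k: "surface_cont k" and k0: "vanishes_off k (\<phi> ` K)"
  shows "integrable (area_measure \<A> F) k"
proof -
  have z: "k (\<phi> p) = 0" if "p \<in> U - K" for p
    using vanishes_off_chart[OF c k0 K(2)] that by simp
  have "continuous_on K (\<lambda>p. density_area (U, \<phi>) p * k (\<phi> p))"
    by (intro continuous_on_mult continuous_on_subset[OF density_area_cont[OF c] K(2)] continuous_on_subset[OF surface_contD[OF k c] K(2)])
  from borel_integrable_compact[OF K(1) this]
  have "integrable lborel (\<lambda>p. indicator K p *\<^sub>R (density_area (U, \<phi>) p * k (\<phi> p)))" .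
  moreover have "(\<lambda>p. indicator K p *\<^sub>R (density_area (U, \<phi>) p * k (\<phi> p)))
     = (\<lambda>p. indicator (fst (U, \<phi>)) p * (density_area (U, \<phi>) p * k (snd (U, \<phi>) p)))"
    using z K(2) by (auto simp: indicator_def fun_eq_iff)
  ultimately show ?thesis unfolding area_measure_eq
    by (subst area.integrable_chart[OF c surface_cont_measurable[OF k]])
       (use k0 K(2) in \<open>auto simp: vanishes_off_def\<close>)
qed

definition edge_cont :: "('a \<Rightarrow> real) \<Rightarrow> bool" where
  "edge_cont h \<longleftrightarrow> (\<forall>(U, \<phi>)\<in>\<A>. continuous_on {p \<in> U. p $ 1 = 0} (\<lambda>q. h (\<phi> q)))"

lemma edge_contD: "edge_cont h \<Longrightarrow> (U, \<phi>) \<in> \<A> \<Longrightarrow> continuous_on {p \<in> U. p $ 1 = 0} (\<lambda>q. h (\<phi> q))"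
  unfolding edge_cont_def by blast

lemma edge_cont_mult: "edge_cont g \<Longrightarrow> edge_cont h \<Longrightarrow> edge_cont (\<lambda>x. g x * h x)"
  unfolding edge_cont_def by (auto intro!: continuous_intros)

lemma surface_edge_cont: "surface_cont h \<Longrightarrow> edge_cont h"
  unfolding surface_cont_def edge_cont_def by (auto elim!: continuous_on_subset)

lemma bdry_indicator_edge: "(U, \<phi>) \<in> \<A> \<Longrightarrow> edge_point t \<in> U \<Longrightarrow> indicator (bdry \<A>) (\<phi> (edge_point t)) = (1::real)"
  by (simp add: bdry_chart indicator_def)

lemma edge_measurable:
  assumes "edge_cont k"
  shows "(\<lambda>x. indicator (bdry \<A>) x * k x) \<in> borel_measurable (restrict_space borel (points \<A>))"
  using bdry_measurable[OF edge_contD[OF assms]] by simp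

lemma integrable_edge_local:
  assumes c: "(U, \<phi>) \<in> \<A>" and K: "compact K" "K \<subseteq> U" and k: "edge_cont k" and k0: "vanishes_off k (\<phi> ` K)"
  shows "integrable (bdry_measure \<A> F) (\<lambda>x. indicator (bdry \<A>) x * k x)"
proof -
  let ?K = "{t. edge_point t \<in> K}"
  have z: "k (\<phi> p) = 0" if "p \<in> U - K" for p
    using vanishes_off_chart[OF c k0 K(2)] that by simp
  obtain M where M: "0 < M" "\<And>p i. p \<in> K \<Longrightarrow> \<bar>p $ i\<bar> < M" using compact_box_bound[OF K(1)] by blast
  have "closed ?K"
    using continuous_closed_vimage[of K edge_point] compact_imp_closed[OF K(1)] continuous_edge_point[of UNIV]
    by (simp add: vimage_def continuous_on_eq_continuous_at)
  moreover have "\<bar>t\<bar> \<le> M" if "t \<in> ?K" for t using M(2)[of "edge_point t" 2] that by auto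
  then have "bounded ?K" by (auto simp: bounded_iff)
  ultimately have cK: "compact ?K" by (simp add: compact_eq_bounded_closed)
  have "continuous_on ?K (\<lambda>t. density_length (U, \<phi>) t * k (\<phi> (edge_point t)))"
    by (intro continuous_on_mult continuous_on_subset[OF density_length_cont[OF c]] continuous_on_compose2[OF edge_contD[OF k c] continuous_edge_point])
       (use K(2) in auto)
  from borel_integrable_compact[OF cK this]
  have "integrable lborel (\<lambda>t. indicator ?K t *\<^sub>R (density_length (U, \<phi>) t * k (\<phi> (edge_point t))))" .
  moreover have "(\<lambda>t. indicator ?K t *\<^sub>R (density_length (U, \<phi>) t * k (\<phi> (edge_point t))))
     = (\<lambda>t. indicator {t. edge_point t \<in> fst (U, \<phi>)} t * (density_length (U, \<phi>) t *
          (indicator (bdry \<A>) (snd (U, \<phi>) (edge_point t)) * k (snd (U, \<phi>) (edge_point t)))))"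
    using z K(2) bdry_indicator_edge[OF c] by (auto simp: indicator_def fun_eq_iff)
  ultimately show ?thesis unfolding bdry_measure_eq
    by (subst edge.integrable_chart[OF c edge_measurable[OF k]])
       (use k0 K(2) in \<open>auto simp: vanishes_off_def\<close>)
qed

section \<open>Localization\<close>

text \<open>The bump is \<open>S \<circ> s\<close> in a chart around \<open>x\<close>: \<open>S\<close> is a \<open>C\<^sup>1\<close> step from 0 on \<open>t \<le> 0\<close> to 1 on \<open>t \<ge> 1\<close>, and
  \<open>s\<close> decreases with the distance from the centre, from 2 through 1 at distance \<open>r\<close>.\<close>

lemma bump_exists:
  assumes x: "x \<in> points \<A>"
  obtains \<beta> U \<phi> K T where "(U, \<phi>) \<in> \<A>" "compact K" "K \<subseteq> U" "surface_C1 \<beta>" "vanishes_off \<beta> (\<phi> ` K)"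
    "open T" "x \<in> T" "\<And>y. y \<in> points \<A> \<inter> T \<Longrightarrow> \<beta> y = 1" "\<And>y. 0 \<le> \<beta> y" "\<And>y. \<beta> y \<le> 1"
proof -
  obtain U \<phi> p where c: "(U, \<phi>) \<in> \<A>" and p: "p \<in> U" and xp: "x = \<phi> p" using x points_chart by blast
  note U = chart_hopen[OF c]
  obtain T0 where T0: "open T0" "U = halfplane \<inter> T0" using U by (auto simp: openin_open)
  obtain e where e: "0 < e" "cball p e \<subseteq> T0" using T0 p open_contains_cball by blast
  define r where "r = e / 2"
  have r: "0 < r" using e by (simp add: r_def)
  \<comment> \<open>\<open>s\<close> is positive only at distance less than \<open>\<surd>2 r\<close> from \<open>p\<close>, so the support lies in \<open>K\<close>\<close>
  define K where "K = cball p (2 * r) \<inter> halfplane"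
  have K: "compact K" "K \<subseteq> U"
    using e T0(2) closed_halfplane by (auto simp: K_def r_def intro: compact_Int_closed)
  define k where "k = 1 / r\<^sup>2"
  define s where "s q = 2 - k * ((q - p) \<bullet> (q - p))" for q
  define S :: "real \<Rightarrow> real" where "S t = 1 - max 0 (1 - max 0 t ^ 2) ^ 2" for t
  define \<beta> where "\<beta> y = (if y \<in> \<phi> ` U then S (s (inv_into U \<phi> y)) else 0)" for y
  have S01: "0 \<le> S t" "S t \<le> 1" "t \<le> 0 \<Longrightarrow> S t = 0" "1 \<le> t \<Longrightarrow> S t = 1" for t
  proof -
    have "max 0 (1 - max 0 t ^ 2) \<le> 1" by simp
    then have "max 0 (1 - max 0 t ^ 2) ^ 2 \<le> 1" by (intro power_le_one) auto
    then show "0 \<le> S t" by (simp add: S_def)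
    show "S t \<le> 1" by (simp add: S_def)
    show "t \<le> 0 \<Longrightarrow> S t = 0" by (simp add: S_def)
    show "1 \<le> t \<Longrightarrow> S t = 1"
      using power_mono[of 1 t 2] by (simp add: S_def)
  qed
  have d2: "((\<lambda>x::real. max 0 x ^ 2) has_real_derivative 2 * max 0 x) (at x)" for x
    using pos_part_power_deriv[of 0 x] by (simp add: numeral_2_eq_2)
  have SD: "(S has_real_derivative (2 * max 0 (1 - max 0 t ^ 2)) * (2 * max 0 t)) (at t)" for t
  proof -
    have "((\<lambda>t. 1 - max 0 t ^ 2) has_real_derivative 0 - 2 * max 0 t) (at t)"
      by (intro DERIV_diff DERIV_const d2)
    from DERIV_chain2[OF d2 this]
    have "((\<lambda>t. max 0 (1 - max 0 t ^ 2) ^ 2) has_real_derivative 2 * max 0 (1 - max 0 t ^ 2) * (0 - 2 * max 0 t)) (at t)" .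
    from DERIV_diff[OF DERIV_const[of 1] this] show ?thesis unfolding S_def[abs_def] by (simp add: algebra_simps)
  qed
  have s1: "C1_on halfplane s U"
  proof (rule C1_on_I[OF thick_halfplane openin_imp_subset[OF U]])
    show "(s has_derivative (\<lambda>a. - (k * (2 * ((q - p) \<bullet> a))))) (at q within halfplane)" for q
      unfolding s_def[abs_def]
      by (auto intro!: derivative_eq_intros simp: inner_commute algebra_simps)
    show "continuous_on U (\<lambda>q. - (k * (2 * ((q - p) \<bullet> a))))" for a
      by (intro continuous_intros)
  qed
  have Ss: "C1_on halfplane (\<lambda>q. S (s q)) U"
    by (rule C1_on_real_comp[OF thick_halfplane U s1, of UNIV, OF _ SD]) (auto intro!: continuous_intros)
  have out: "S (s q) = 0" if "q \<in> U - K" for q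
  proof -
    have "2 * r < norm (q - p)" using that T0(2) by (auto simp: K_def dist_norm norm_minus_commute)
    then have "(2 * r)\<^sup>2 \<le> (norm (q - p))\<^sup>2" using r by (intro power_mono) auto
    then have "4 * r\<^sup>2 \<le> (q - p) \<bullet> (q - p)" by (simp add: power2_norm_eq_inner power_mult_distrib)
    then have "2 * r\<^sup>2 \<le> (q - p) \<bullet> (q - p)" using zero_le_power2[of r] by linarith
    then have "2 \<le> k * ((q - p) \<bullet> (q - p))" using r by (simp add: k_def field_simps)
    then show ?thesis by (intro S01(3)) (simp add: s_def)
  qed
  have \<beta>\<phi>: "\<beta> (\<phi> q) = S (s q)" if "q \<in> U" for q
    using that transition_inv[OF c that refl] by (simp add: \<beta>_def)
  have van: "vanishes_off \<beta> (\<phi> ` K)"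
    unfolding vanishes_off_def
  proof
    fix y assume y: "y \<in> points \<A> - \<phi> ` K"
    show "\<beta> y = 0"
    proof (cases "y \<in> \<phi> ` U")
      case True
      then obtain q where q: "q \<in> U" "y = \<phi> q" by auto
      then have "q \<in> U - K" using y by auto
      then show ?thesis using \<beta>\<phi>[OF q(1)] out q by simp
    qed (simp add: \<beta>_def)
  qed
  have C1: "surface_C1 \<beta>"
    unfolding surface_C1_def
  proof clarify
    fix V \<psi> assume d: "(V, \<psi>) \<in> \<A>"
    show "C1_on halfplane (\<lambda>q. \<beta> (\<psi> q)) V"
    proof (rule C1_on_local[OF openin_imp_subset[OF chart_hopen[OF d]]])
      fix q assume q: "q \<in> V"
      show "\<exists>W. hopen W \<and> q \<in> W \<and> C1_on halfplane (\<lambda>q. \<beta> (\<psi> q)) W"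
      proof (cases "\<psi> q \<in> \<phi> ` U")
        case True
        interpret t: coordinate_change "{p \<in> V. \<psi> p \<in> \<phi> ` U}" U "\<lambda>p. inv_into U \<phi> (\<psi> p)" "\<lambda>q. F (\<psi> q)" "\<lambda>q. F (\<phi> q)"
          by (rule transition[OF d c])
        have "C1_on halfplane (\<lambda>q. S (s (inv_into U \<phi> (\<psi> q)))) {p \<in> V. \<psi> p \<in> \<phi> ` U}"
          by (rule C1h_chain[OF t.S Ss U C2_on_C1[OF t.\<tau>] t.ST])
        then have "C1_on halfplane (\<lambda>q. \<beta> (\<psi> q)) {p \<in> V. \<psi> p \<in> \<phi> ` U}"
          by (rule C1_on_cong[OF t.S, rotated]) (simp add: \<beta>_def)
        then show ?thesis using t.S q True by blast
      next
        case False
        have cK: "compact (\<phi> ` K)"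
          by (rule compact_continuous_image[OF continuous_on_subset[OF chart_cont[OF c] K(2)] K(1)])
        note o = hopen_off_compact[OF d cK]
        have "C1_on halfplane (\<lambda>q. \<beta> (\<psi> q)) {q \<in> V. \<psi> q \<notin> \<phi> ` K}"
          by (rule C1_on_cong[OF o _ C1h_const[OF o, of 0]]) (use van chart_in_points[OF d] in \<open>auto simp: vanishes_off_def\<close>)
        moreover have "q \<in> {q \<in> V. \<psi> q \<notin> \<phi> ` K}" using q False K(2) by auto
        ultimately show ?thesis using o by blast
      qed
    qed
  qed
  have "openin (top_of_set (\<phi> ` U)) (\<phi> ` U \<inter> inv_into U \<phi> -` ball p r)"
    by (rule continuous_openin_preimage_gen[OF chart_inv_cont[OF c]]) auto
  then have "openin (top_of_set (points \<A>)) (\<phi> ` U \<inter> inv_into U \<phi> -` ball p r)" using chart_Im[OF c] openin_trans by blast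
  then obtain T where T: "open T" "\<phi> ` U \<inter> inv_into U \<phi> -` ball p r = points \<A> \<inter> T" by (auto simp: openin_open)
  have "x \<in> points \<A> \<inter> T" unfolding T(2)[symmetric] using p xp r transition_inv[OF c p refl] by auto
  moreover have "\<beta> y = 1" if y: "y \<in> points \<A> \<inter> T" for y
  proof -
    obtain q where q: "q \<in> U" "y = \<phi> q" "q \<in> ball p r"
      using y unfolding T(2)[symmetric] using transition_inv[OF c _ refl] by auto
    have "norm (q - p) \<le> r" using q(3) by (simp add: dist_norm norm_minus_commute)
    then have "(norm (q - p))\<^sup>2 \<le> r\<^sup>2" by (intro power_mono) auto
    then have "1 \<le> s q" using r by (simp add: s_def k_def power2_norm_eq_inner field_simps)
    then show ?thesis using \<beta>\<phi>[OF q(1)] q(2) S01(4) by simp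
  qed
  moreover have "0 \<le> \<beta> y" "\<beta> y \<le> 1" for y by (simp_all add: \<beta>_def S01)
  ultimately show thesis using that[OF c K C1 van T(1)] by blast
qed

text \<open>The function is cut successively as \<open>g = \<beta> g + (1 - \<beta>) g\<close>. The first summand lives in one chart; the
  second is treated with the remaining bumps, and after the last bump nothing is left. Unlike for a
  partition of unity, no division by a sum of bumps occurs.\<close>

lemma localize_list:
  assumes zero: "\<And>g. surface_C1 g \<Longrightarrow> \<forall>x\<in>points \<A>. g x = 0 \<Longrightarrow> P g"
    and add: "\<And>g h. surface_C1 g \<Longrightarrow> surface_C1 h \<Longrightarrow> P g \<Longrightarrow> P h \<Longrightarrow> P (\<lambda>x. g x + h x)"
    and local: "\<And>U \<phi> K g. (U, \<phi>) \<in> \<A> \<Longrightarrow> compact K \<Longrightarrow> K \<subseteq> U \<Longrightarrow> surface_C1 g \<Longrightarrow> vanishes_off g (\<phi> ` K) \<Longrightarrow> P g"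
    and bumps: "\<forall>\<beta>\<in>set \<beta>s. surface_C1 \<beta> \<and> (\<exists>U \<phi> K. (U, \<phi>) \<in> \<A> \<and> compact K \<and> K \<subseteq> U \<and> vanishes_off \<beta> (\<phi> ` K))"
    and g: "surface_C1 g" "\<forall>x\<in>points \<A>. g x * (\<Prod>\<beta>\<leftarrow>\<beta>s. 1 - \<beta> x) = 0"
  shows "P g"
  using bumps g
proof (induction \<beta>s arbitrary: g)
  case Nil
  then show ?case using zero by simp
next
  case (Cons \<beta> \<beta>s)
  obtain U \<phi> K where \<beta>: "surface_C1 \<beta>" "(U, \<phi>) \<in> \<A>" "compact K" "K \<subseteq> U" "vanishes_off \<beta> (\<phi> ` K)"
    using Cons.prems(1) by auto
  have c1: "surface_C1 (\<lambda>x. \<beta> x * g x)" by (rule surface_C1_mult[OF \<beta>(1) Cons.prems(2)])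
  have c2: "surface_C1 (\<lambda>x. (1 - \<beta> x) * g x)"
    by (rule surface_C1_mult[OF surface_C1_diff[OF surface_C1_const \<beta>(1)] Cons.prems(2)])
  have "P (\<lambda>x. \<beta> x * g x)" by (rule local[OF \<beta>(2-4) c1 vanishes_off_mult[OF \<beta>(5)]])
  moreover have "P (\<lambda>x. (1 - \<beta> x) * g x)"
    by (rule Cons.IH[OF _ c2]) (use Cons.prems(1,3) in \<open>auto simp: mult_ac\<close>)
  ultimately have "P (\<lambda>x. \<beta> x * g x + (1 - \<beta> x) * g x)" by (rule add[OF c1 c2])
  moreover have "(\<lambda>x. \<beta> x * g x + (1 - \<beta> x) * g x) = g" by (simp add: fun_eq_iff algebra_simps)
  ultimately show ?case by simp
qed

text \<open>An additive property of compactly supported functions holds in general if it holds for functions that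
  are supported in one chart: finitely many bumps are chosen such that at every point of the support
  one of them equals 1.\<close>

lemma localize:
  assumes zero: "\<And>g. surface_C1 g \<Longrightarrow> \<forall>x\<in>points \<A>. g x = 0 \<Longrightarrow> P g"
    and add: "\<And>g h. surface_C1 g \<Longrightarrow> surface_C1 h \<Longrightarrow> P g \<Longrightarrow> P h \<Longrightarrow> P (\<lambda>x. g x + h x)"
    and local: "\<And>U \<phi> K g. (U, \<phi>) \<in> \<A> \<Longrightarrow> compact K \<Longrightarrow> K \<subseteq> U \<Longrightarrow> surface_C1 g \<Longrightarrow> vanishes_off g (\<phi> ` K) \<Longrightarrow> P g"
    and g: "surface_C1 g" and C: "compact C" "C \<subseteq> points \<A>" "vanishes_off g C"
  shows "P g"
proof -
  have "\<forall>x\<in>C. \<exists>\<beta> T. surface_C1 \<beta> \<and> (\<exists>U \<phi> K. (U, \<phi>) \<in> \<A> \<and> compact K \<and> K \<subseteq> U \<and> vanishes_off \<beta> (\<phi> ` K)) \<and>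
      open T \<and> x \<in> T \<and> (\<forall>y\<in>points \<A> \<inter> T. \<beta> y = 1)"
  proof
    fix x assume "x \<in> C"
    then have "x \<in> points \<A>" using C(2) by blast
    from bump_exists[OF this] show "\<exists>\<beta> T. surface_C1 \<beta> \<and> (\<exists>U \<phi> K. (U, \<phi>) \<in> \<A> \<and> compact K \<and> K \<subseteq> U \<and> vanishes_off \<beta> (\<phi> ` K)) \<and>
      open T \<and> x \<in> T \<and> (\<forall>y\<in>points \<A> \<inter> T. \<beta> y = 1)" by (metis (no_types, lifting))
  qed
  then obtain \<beta> T where \<beta>: "\<forall>x\<in>C. surface_C1 (\<beta> x) \<and> (\<exists>U \<phi> K. (U, \<phi>) \<in> \<A> \<and> compact K \<and> K \<subseteq> U \<and> vanishes_off (\<beta> x) (\<phi> ` K)) \<and>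
      open (T x) \<and> x \<in> T x \<and> (\<forall>y\<in>points \<A> \<inter> T x. \<beta> x y = 1)" by metis
  obtain D where D: "D \<subseteq> C" "finite D" "C \<subseteq> (\<Union>x\<in>D. T x)"
    using compactE_image[OF C(1), of C T] \<beta> by (metis UN_I subsetI)
  obtain xs where xs: "set xs = D" using finite_list[OF D(2)] by blast
  show ?thesis
  proof (rule localize_list[where P = P and \<beta>s = "map \<beta> xs"])
    show "P g" if "surface_C1 g" "\<forall>x\<in>points \<A>. g x = 0" for g by (rule zero[OF that])
    show "P (\<lambda>x. g x + h x)" if "surface_C1 g" "surface_C1 h" "P g" "P h" for g h by (rule add[OF that])
    show "P g" if "(U, \<phi>) \<in> \<A>" "compact K" "K \<subseteq> U" "surface_C1 g" "vanishes_off g (\<phi> ` K)" for U \<phi> K g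
      by (rule local[OF that])
    show "surface_C1 g" by (rule g)
    show "\<forall>c\<in>set (map \<beta> xs). surface_C1 c \<and> (\<exists>U \<phi> K. (U, \<phi>) \<in> \<A> \<and> compact K \<and> K \<subseteq> U \<and> vanishes_off c (\<phi> ` K))"
      using \<beta> xs D(1) by auto
    show "\<forall>y\<in>points \<A>. g y * (\<Prod>c\<leftarrow>map \<beta> xs. 1 - c y) = 0"
    proof
      fix y assume y: "y \<in> points \<A>"
      show "g y * (\<Prod>c\<leftarrow>map \<beta> xs. 1 - c y) = 0"
      proof (cases "y \<in> C")
        case True
        then obtain x where "x \<in> D" "y \<in> T x" using D(3) by blast
        then have "x \<in> set xs" "\<beta> x y = 1" using \<beta> y xs D(1) by auto
        then have "0 \<in> set (map (\<lambda>c. 1 - c y) (map \<beta> xs))" by force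
        then show ?thesis using prod_list_zero_iff by fastforce
      next
        case False
        then show ?thesis using C(3) y by (simp add: vanishes_off_def)
      qed
    qed
  qed
qed

lemma integrable_area_compact:
  assumes g: "surface_C1 g" and h: "surface_cont h" and C: "compact C" "C \<subseteq> points \<A>" "vanishes_off g C"
  shows "integrable (area_measure \<A> F) (\<lambda>x. g x * h x)"
proof (rule localize[where P = "\<lambda>g. integrable (area_measure \<A> F) (\<lambda>x. g x * h x)", OF _ _ _ g C])
  show "integrable (area_measure \<A> F) (\<lambda>x. g x * h x)" if "\<forall>x\<in>points \<A>. g x = 0" for g
    by (subst Bochner_Integration.integrable_cong[where g = "\<lambda>_. 0", OF refl])
       (use that in \<open>simp_all add: area_measure_eq area.space_glued\<close>)
  show "integrable (area_measure \<A> F) (\<lambda>x. g x * h x)"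
    if "(U, \<phi>) \<in> \<A>" "compact K" "K \<subseteq> U" "surface_C1 g" "vanishes_off g (\<phi> ` K)" for U \<phi> K g
    by (rule integrable_area_local[OF that(1-3) surface_cont_mult[OF surface_C1_cont[OF that(4)] h] vanishes_off_mult[OF that(5)]])
qed (simp add: distrib_right)

end

context minimal_surface
begin

section \<open>Green's formula\<close>

text \<open>This is the expression in charts of \<open>\<partial>u/\<partial>\<eta>\<close> (see \<open>D_half_conormal\<close>): multiplied by the length density
  \<open>|\<partial>\<^sub>2F|\<close>, it is the flux of the gradient out of the half-plane.\<close>

definition conormal_data :: "('a \<Rightarrow> real) \<Rightarrow> ('a \<Rightarrow> real) \<Rightarrow> bool" where
  "conormal_data u Dn \<longleftrightarrow> (\<forall>(U, \<phi>)\<in>\<A>. \<forall>p\<in>U. p $ 1 = 0 \<longrightarrow>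
     Dn (\<phi> p) = - flux1 (\<lambda>q. F (\<phi> q)) (\<lambda>q. u (\<phi> q)) p / norm (D_half (\<lambda>q. F (\<phi> q)) p e2))"

lemma norm_e2_pos:
  assumes "(U, \<phi>) \<in> \<A>" "p \<in> U" shows "0 < norm (D_half (\<lambda>q. F (\<phi> q)) p e2)"
  using minimal_chart.pos[OF minimal_chart[OF assms(1)] assms(2)] by (auto simp: det_gram)

lemma conormal_data_edge_cont:
  assumes u: "surface_C2 u" and Dn: "conormal_data u Dn"
  shows "edge_cont Dn"
  unfolding edge_cont_def
proof clarify
  fix U \<phi> assume c: "(U, \<phi>) \<in> \<A>"
  interpret M: minimal_chart U "\<lambda>q. F (\<phi> q)" "\<lambda>q. \<nu> (\<phi> q)" by (rule minimal_chart[OF c])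
  have "continuous_on U (\<lambda>p. - flux1 (\<lambda>q. F (\<phi> q)) (\<lambda>q. u (\<phi> q)) p / norm (D_half (\<lambda>q. F (\<phi> q)) p e2))"
    by (intro continuous_on_divide continuous_on_minus continuous_on_norm ballI less_imp_neq[OF norm_e2_pos[OF c], symmetric]
      C1h_cont_D[OF M.X1] C1_on_cont[OF flux_C1(2)[OF M.U M.X surface_C2D[OF u c] M.pos] openin_imp_subset[OF M.U]])
  from continuous_on_subset[OF this, of "{p \<in> U. p $ 1 = 0}"]
  show "continuous_on {p \<in> U. p $ 1 = 0} (\<lambda>q. Dn (\<phi> q))"
    by (rule continuous_on_eq) (use Dn c in \<open>auto simp: conormal_data_def\<close>)
qed

text \<open>The divergence theorem for \<open>g\<close> times the flux of \<open>u\<close>, extended by zero to the half-plane. By the product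
  rule its divergence is the area density times \<open>g \<Delta>u + \<langle>\<nabla>g, \<nabla>u\<rangle>\<close>.\<close>

lemma green_local:
  assumes c: "(U, \<phi>) \<in> \<A>" and K: "compact K" "K \<subseteq> U" and g: "surface_C1 g" "vanishes_off g (\<phi> ` K)"
    and u: "surface_C2 u" and Dn: "conormal_data u Dn"
  shows "integrable (area_measure \<A> F) (\<lambda>x. g x * Laplacian \<A> F u x)"
    "integrable (area_measure \<A> F) (Grad_inner g u)"
    "integrable (bdry_measure \<A> F) (\<lambda>x. indicator (bdry \<A>) x * (g x * Dn x))"
    "(\<integral>x. g x * Laplacian \<A> F u x \<partial>area_measure \<A> F) + (\<integral>x. Grad_inner g u x \<partial>area_measure \<A> F)
      = (\<integral>x. indicator (bdry \<A>) x * (g x * Dn x) \<partial>bdry_measure \<A> F)"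
proof -
  interpret M: minimal_chart U "\<lambda>q. F (\<phi> q)" "\<lambda>q. \<nu> (\<phi> q)" by (rule minimal_chart[OF c])
  let ?X = "\<lambda>q. F (\<phi> q)" and ?g = "\<lambda>q. g (\<phi> q)" and ?u = "\<lambda>q. u (\<phi> q)"
  note u1 = surface_C2_C1[OF u]
  have cK: "compact (\<phi> ` K)"
    by (rule compact_continuous_image[OF continuous_on_subset[OF chart_cont[OF c] K(2)] K(1)])
  have v1: "vanishes_off (\<lambda>x. g x * Laplacian \<A> F u x) (\<phi> ` K)" by (rule vanishes_off_mult[OF g(2)])
  have v2: "vanishes_off (Grad_inner g u) (\<phi> ` K)" by (rule Grad_inner_vanishes_off[OF g(1) u1 cK g(2)])
  have c1: "surface_cont (\<lambda>x. g x * Laplacian \<A> F u x)"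
    by (rule surface_cont_mult[OF surface_C1_cont[OF g(1)] Laplacian_cont[OF u]])
  have c2: "surface_cont (Grad_inner g u)" by (rule Grad_inner_cont[OF g(1) u1])
  have c3: "edge_cont (\<lambda>x. g x * Dn x)"
    by (rule edge_cont_mult[OF surface_edge_cont[OF surface_C1_cont[OF g(1)]] conormal_data_edge_cont[OF u Dn]])
  show i1: "integrable (area_measure \<A> F) (\<lambda>x. g x * Laplacian \<A> F u x)"
    by (rule integrable_area_local[OF c K c1 v1])
  show i2: "integrable (area_measure \<A> F) (Grad_inner g u)"
    by (rule integrable_area_local[OF c K c2 v2])
  show "integrable (bdry_measure \<A> F) (\<lambda>x. indicator (bdry \<A>) x * (g x * Dn x))"
    by (rule integrable_edge_local[OF c K c3 vanishes_off_mult[OF g(2)]])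
  note fl = flux_C1[OF M.U M.X surface_C2D[OF u c] M.pos]
  have g0: "g (\<phi> p) = 0" if "p \<in> U" "p \<notin> K" for p using vanishes_off_chart[OF c g(2) K(2) that] .
  define H where "H f p = (if p \<in> U then g (\<phi> p) * f p else 0)" for f :: "real^2 \<Rightarrow> real" and p
  have H0: "\<forall>p\<in>halfplane - K. H f p = 0" for f using g0 by (auto simp: H_def)
  have oK: "hopen (halfplane - K)"
    using compact_imp_closed[OF K(1)] by (auto simp: openin_open Diff_eq intro!: exI[of _ "- K"])
  have HC: "C1_on halfplane (H f) halfplane" if f: "C1_on halfplane f U" for f
  proof (rule C1_on_local[OF order_refl])
    fix p assume p: "p \<in> halfplane"
    show "\<exists>V. hopen V \<and> p \<in> V \<and> C1_on halfplane (H f) V"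
    proof (cases "p \<in> U")
      case True
      have "C1_on halfplane (H f) U"
        by (rule C1_on_cong[OF M.U _ C1h_mult[OF M.U surface_C1D[OF g(1) c] f]]) (simp add: H_def)
      then show ?thesis using M.U True by blast
    next
      case False
      have "C1_on halfplane (H f) (halfplane - K)"
        by (rule C1_on_cong[OF oK _ C1h_const[OF oK, of 0]]) (use H0 in simp)
      then show ?thesis using oK p False K(2) by blast
    qed
  qed
  have HD: "D_half (H f) p a = g (\<phi> p) * D_half f p a + D_half ?g p a * f p" if f: "C1_on halfplane f U" and p: "p \<in> U" for f p a
  proof -
    have "D_half (H f) p = D_half (\<lambda>p. g (\<phi> p) * f p) p" by (rule D_half_cong[OF M.U p]) (simp add: H_def)
    then show ?thesis using D_half_mult[OF M.U surface_C1D[OF g(1) c] f p] by simp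
  qed
  let ?f1 = "flux1 ?X ?u" and ?f2 = "flux2 ?X ?u"
  have div: "indicator U p * (density_area (U, \<phi>) p * (g (\<phi> p) * Laplacian \<A> F u (\<phi> p) + Grad_inner g u (\<phi> p)))
     = indicator halfplane p * D_half (H ?f1) p e1 + indicator halfplane p * D_half (H ?f2) p e2" for p
  proof (cases "p \<in> U")
    case True
    have d: "0 < det (gram ?X p)" by (rule M.pos[OF True])
    have "density_area (U, \<phi>) p * (g (\<phi> p) * Laplacian \<A> F u (\<phi> p) + Grad_inner g u (\<phi> p))
      = g (\<phi> p) * (sqrt (det (gram ?X p)) * laplace_beltrami ?X ?u p) + sqrt (det (gram ?X p)) * grad_inner ?X ?g ?u p"
      by (simp add: density_area_def Laplacian_chart[OF u c True] Grad_inner_chart[OF g(1) u1 c True] algebra_simps)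
    also have "sqrt (det (gram ?X p)) * laplace_beltrami ?X ?u p = D_half ?f1 p e1 + D_half ?f2 p e2"
      using laplace_beltrami_flux[OF M.U True M.pos, of ?u] d by simp
    also have "sqrt (det (gram ?X p)) * grad_inner ?X ?g ?u p = D_half ?g p e1 * ?f1 p + D_half ?g p e2 * ?f2 p"
      by (rule flux_grad_inner[OF d, symmetric])
    finally show ?thesis
      using True openin_imp_subset[OF M.U] by (auto simp: HD[OF fl(2)] HD[OF fl(3)] algebra_simps)
  next
    case False
    then have "p \<notin> K" using K(2) by auto
    then show ?thesis using False D_half_zero_outside[OF K(1) H0, of p] by (auto simp: indicator_def)
  qed
  have v12: "g x * Laplacian \<A> F u x + Grad_inner g u x = 0" if "x \<in> points \<A> - \<phi> ` U" for x
  proof -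
    have x: "x \<in> points \<A> - \<phi> ` K" using that K(2) by blast
    then have "g x * Laplacian \<A> F u x = 0" "Grad_inner g u x = 0" using v1 v2 unfolding vanishes_off_def by blast+
    then show ?thesis by simp
  qed
  have "(\<integral>x. g x * Laplacian \<A> F u x \<partial>area_measure \<A> F) + (\<integral>x. Grad_inner g u x \<partial>area_measure \<A> F)
    = (\<integral>x. g x * Laplacian \<A> F u x + Grad_inner g u x \<partial>area_measure \<A> F)"
    by (rule Bochner_Integration.integral_add[OF i1 i2, symmetric])
  also have "\<dots> = (\<integral>p. indicator U p * (density_area (U, \<phi>) p * (g (\<phi> p) * Laplacian \<A> F u (\<phi> p) + Grad_inner g u (\<phi> p))) \<partial>lborel)"
    unfolding area_measure_eq
    by (subst area.integral_chart[OF c surface_cont_measurable[OF surface_cont_add[OF c1 c2]] v12]) simp_all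
  also have "\<dots> = (\<integral>p. indicator halfplane p * D_half (H ?f1) p e1 \<partial>lborel) + (\<integral>p. indicator halfplane p * D_half (H ?f2) p e2 \<partial>lborel)"
    unfolding div
    by (rule Bochner_Integration.integral_add[OF integrable_D_half[OF K(1) H0 HC[OF fl(2)]] integrable_D_half[OF K(1) H0 HC[OF fl(3)]]])
  also have "\<dots> = - (\<integral>t. H ?f1 (edge_point t) \<partial>lborel)"
    using integral_D_half_e1[OF K(1) H0 HC[OF fl(2)]] integral_D_half_e2[OF K(1) H0 HC[OF fl(3)]] by linarith
  also have "\<dots> = (\<integral>t. - H ?f1 (edge_point t) \<partial>lborel)" by simp
  also have "\<dots> = (\<integral>t. indicator {t. edge_point t \<in> fst (U, \<phi>)} t * (density_length (U, \<phi>) t *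
          (indicator (bdry \<A>) (snd (U, \<phi>) (edge_point t)) * (g (snd (U, \<phi>) (edge_point t)) * Dn (snd (U, \<phi>) (edge_point t))))) \<partial>lborel)"
  proof (intro Bochner_Integration.integral_cong refl)
    fix t
    show "- H ?f1 (edge_point t) = indicator {t. edge_point t \<in> fst (U, \<phi>)} t * (density_length (U, \<phi>) t *
          (indicator (bdry \<A>) (snd (U, \<phi>) (edge_point t)) * (g (snd (U, \<phi>) (edge_point t)) * Dn (snd (U, \<phi>) (edge_point t)))))"
    proof (cases "edge_point t \<in> U")
      case True
      have "Dn (\<phi> (edge_point t)) = - ?f1 (edge_point t) / norm (D_half ?X (edge_point t) e2)"
        using Dn c True by (auto simp: conormal_data_def)
      then show ?thesis
        using True norm_e2_pos[OF c True] bdry_indicator_edge[OF c True] by (simp add: H_def density_length_def)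
    qed (simp add: H_def)
  qed
  also have "\<dots> = (\<integral>x. indicator (bdry \<A>) x * (g x * Dn x) \<partial>bdry_measure \<A> F)"
    unfolding bdry_measure_eq
    by (rule edge.integral_chart[OF c edge_measurable[OF c3], symmetric])
       (use g(2) K(2) in \<open>auto simp: vanishes_off_def\<close>)
  finally show "(\<integral>x. g x * Laplacian \<A> F u x \<partial>area_measure \<A> F) + (\<integral>x. Grad_inner g u x \<partial>area_measure \<A> F)
      = (\<integral>x. indicator (bdry \<A>) x * (g x * Dn x) \<partial>bdry_measure \<A> F)" .
qed

lemma green:
  assumes g: "surface_C1 g" and C: "compact C" "C \<subseteq> points \<A>" "vanishes_off g C"
    and u: "surface_C2 u" and Dn: "conormal_data u Dn"
  shows "integrable (area_measure \<A> F) (\<lambda>x. g x * Laplacian \<A> F u x) \<and>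
    integrable (area_measure \<A> F) (Grad_inner g u) \<and>
    integrable (bdry_measure \<A> F) (\<lambda>x. indicator (bdry \<A>) x * (g x * Dn x)) \<and>
    (\<integral>x. g x * Laplacian \<A> F u x \<partial>area_measure \<A> F) + (\<integral>x. Grad_inner g u x \<partial>area_measure \<A> F)
      = (\<integral>x. indicator (bdry \<A>) x * (g x * Dn x) \<partial>bdry_measure \<A> F)"
proof (rule localize[where P = "\<lambda>g. integrable (area_measure \<A> F) (\<lambda>x. g x * Laplacian \<A> F u x) \<and>
    integrable (area_measure \<A> F) (Grad_inner g u) \<and>
    integrable (bdry_measure \<A> F) (\<lambda>x. indicator (bdry \<A>) x * (g x * Dn x)) \<and>
    (\<integral>x. g x * Laplacian \<A> F u x \<partial>area_measure \<A> F) + (\<integral>x. Grad_inner g u x \<partial>area_measure \<A> F)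
      = (\<integral>x. indicator (bdry \<A>) x * (g x * Dn x) \<partial>bdry_measure \<A> F)", OF _ _ _ g C], goal_cases)
  case (1 g)
  have z: "vanishes_off g {}" using 1(2) by (simp add: vanishes_off_def)
  have "vanishes_off (Grad_inner g u) {}"
    by (rule Grad_inner_vanishes_off[OF 1(1) surface_C2_C1[OF u] _ z]) simp
  then have e: "g x * Laplacian \<A> F u x = 0" "Grad_inner g u x = 0" "indicator (bdry \<A>) x * (g x * Dn x) = 0" if "x \<in> points \<A>" for x
    using 1(2) that by (auto simp: vanishes_off_def)
  have sp: "space (area_measure \<A> F) = points \<A>" "space (bdry_measure \<A> F) = points \<A>"
    by (simp_all add: area_measure_eq area.space_glued bdry_measure_eq edge.space_glued)
  have "integrable (area_measure \<A> F) (\<lambda>x. g x * Laplacian \<A> F u x) = integrable (area_measure \<A> F) (\<lambda>x. 0::real)"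
    "integrable (area_measure \<A> F) (Grad_inner g u) = integrable (area_measure \<A> F) (\<lambda>x. 0::real)"
    "integrable (bdry_measure \<A> F) (\<lambda>x. indicator (bdry \<A>) x * (g x * Dn x)) = integrable (bdry_measure \<A> F) (\<lambda>x. 0::real)"
    by (rule Bochner_Integration.integrable_cong[OF refl], rule e, simp only: sp)+
  moreover have "(\<integral>x. g x * Laplacian \<A> F u x \<partial>area_measure \<A> F) = (\<integral>x. (0::real) \<partial>area_measure \<A> F)"
    "(\<integral>x. Grad_inner g u x \<partial>area_measure \<A> F) = (\<integral>x. (0::real) \<partial>area_measure \<A> F)"
    "(\<integral>x. indicator (bdry \<A>) x * (g x * Dn x) \<partial>bdry_measure \<A> F) = (\<integral>x. (0::real) \<partial>bdry_measure \<A> F)"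
    by (rule Bochner_Integration.integral_cong[OF refl], rule e, simp only: sp)+
  ultimately show ?case by simp
next
  case (2 g h)
  have sp: "space (area_measure \<A> F) = points \<A>" by (simp add: area_measure_eq area.space_glued)
  have G: "Grad_inner (\<lambda>x. g x + h x) u x = Grad_inner g u x + Grad_inner h u x" if "x \<in> space (area_measure \<A> F)" for x
    using Grad_inner_add[OF 2(1,2) surface_C2_C1[OF u]] that sp by simp
  have "integrable (area_measure \<A> F) (Grad_inner (\<lambda>x. g x + h x) u)
    = integrable (area_measure \<A> F) (\<lambda>x. Grad_inner g u x + Grad_inner h u x)"
    by (rule Bochner_Integration.integrable_cong[OF refl G])
  moreover have "(\<integral>x. Grad_inner (\<lambda>x. g x + h x) u x \<partial>area_measure \<A> F)
    = (\<integral>x. Grad_inner g u x + Grad_inner h u x \<partial>area_measure \<A> F)"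
    by (rule Bochner_Integration.integral_cong[OF refl G])
  moreover have "(g x + h x) * Laplacian \<A> F u x = g x * Laplacian \<A> F u x + h x * Laplacian \<A> F u x"
    "indicator (bdry \<A>) x * ((g x + h x) * Dn x) = indicator (bdry \<A>) x * (g x * Dn x) + indicator (bdry \<A>) x * (h x * Dn x)" for x
    by (simp_all add: algebra_simps)
  ultimately show ?case using 2(3,4) by simp
next
  case (3 U \<phi> K g)
  show ?case using green_local[OF 3 u Dn] by blast
qed

end

section \<open>The edge of a capillary surface\<close>

lemma D_half_edge_zero:
  fixes h :: "real^2 \<Rightarrow> real"
  assumes U: "hopen U" and h: "C1_on halfplane h U" and p: "p \<in> U" "p $ 1 = 0" and z: "\<And>q. q \<in> U \<Longrightarrow> q $ 1 = 0 \<Longrightarrow> h q = 0"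
  shows "D_half h p e2 = 0"
proof -
  define t where "t = p $ 2"
  have pt: "edge_point t = p" unfolding t_def by (rule edge_point_eq[OF p(2)])
  obtain T where T: "open T" "U = halfplane \<inter> T" using U by (auto simp: openin_open)
  have oT: "open (edge_point -` T)"
    by (rule open_vimage[OF T(1)]) (use continuous_edge_point in \<open>auto simp: continuous_on_eq_continuous_at\<close>)
  have tT: "t \<in> edge_point -` T" using pt p T by auto
  have hD: "(h has_derivative D_half h p) (at p within halfplane)" using C1_onD[OF h p(1)] unfolding D_half_def .
  have "(h has_derivative D_half h p) (at (edge_point t) within edge_point ` UNIV)"
    unfolding pt by (rule has_derivative_subset[OF hD]) auto
  from diff_chain_within[OF edge_point_has_derivative this]
  have "((\<lambda>t. h (edge_point t)) has_derivative (\<lambda>s. s * D_half h p e2)) (at t)"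
    using has_derivative_linear[OF hD] by (simp add: o_def linear_cmul)
  moreover have "((\<lambda>t. h (edge_point t)) has_derivative (\<lambda>s. 0)) (at t)"
    by (rule has_derivative_transform_within_open[OF has_derivative_const oT tT]) (use z T in auto)
  ultimately have "(\<lambda>s. s * D_half h p e2) = (\<lambda>s. 0)" by (rule has_derivative_unique)
  from fun_cong[OF this, of 1] show ?thesis by simp
qed

text \<open>A tangent vector that is orthogonal to the second coordinate direction is determined up to a factor, its length fixes the
  factor up to the sign, and the sign is fixed by pointing outward. In coordinates it is the raised
  first coordinate direction, normalized and reversed.\<close>

lemma conormal_eq:
  fixes X :: "real^2 \<Rightarrow> real^3"
  assumes X: "C1_on halfplane X U" and p: "p \<in> U" and pos: "0 < det (gram X p)"
  defines "G \<equiv> D_half X p e2 \<bullet> D_half X p e2"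
  shows "conormal X p = (- G / sqrt (det (gram X p) * G)) *\<^sub>R e1 + ((D_half X p e1 \<bullet> D_half X p e2) / sqrt (det (gram X p) * G)) *\<^sub>R e2"
    (is "_ = ?a")
    and "norm (D_half X p (conormal X p)) = 1" "D_half X p (conormal X p) \<bullet> D_half X p e2 = 0" "conormal X p $ 1 < 0"
proof -
  define D E f where "D = det (gram X p)" and "E = D_half X p e1 \<bullet> D_half X p e1" and "f = D_half X p e1 \<bullet> D_half X p e2"
  have D: "D = E * G - f\<^sup>2" "0 < D" using pos by (simp_all add: D_def E_def f_def G_def det_gram)
  have G: "0 < G"
  proof -
    have "0 < E * G" using D zero_le_power2[of f] by linarith
    moreover have "0 \<le> E" "0 \<le> G" by (simp_all add: E_def G_def)
    ultimately show ?thesis by (auto simp: zero_less_mult_iff)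
  qed
  define s where "s = sqrt (D * G)"
  have s: "0 < s" "s * s = D * G" using D(2) G by (simp_all add: s_def)
  have DX: "D_half X p a = a $ 1 *\<^sub>R D_half X p e1 + a $ 2 *\<^sub>R D_half X p e2" for a
    by (rule D_half_expand[OF X p])
  have sq: "D_half X p a \<bullet> D_half X p a = a $ 1 * a $ 1 * E + 2 * (a $ 1 * a $ 2) * f + a $ 2 * a $ 2 * G" for a
    unfolding DX[of a] inner_combination E_def f_def G_def by (simp add: algebra_simps)
  have tg: "D_half X p a \<bullet> D_half X p e2 = a $ 1 * f + a $ 2 * G" for a
    unfolding DX[of a] by (simp add: inner_add_left f_def G_def)
  have a_nth: "?a $ 1 = - G / s" "?a $ 2 = f / s" by (simp_all add: axis_def s_def D_def f_def)
  have a1: "norm (D_half X p ?a) = 1"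
  proof -
    have "D_half X p ?a \<bullet> D_half X p ?a = (G * G * E - 2 * G * f * f + f * f * G) / (s * s)"
      unfolding sq a_nth using s(1) by (simp add: field_simps)
    also have "G * G * E - 2 * G * f * f + f * f * G = D * G" unfolding D(1) by algebra
    finally show ?thesis using s D(2) G by (simp add: norm_eq_1)
  qed
  have a2: "D_half X p ?a \<bullet> D_half X p e2 = 0" using tg[of ?a] a_nth s(1) by simp
  have a3: "?a $ 1 < 0" unfolding a_nth using G s by simp
  have uniq: "b = ?a" if b: "norm (D_half X p b) = 1" "D_half X p b \<bullet> D_half X p e2 = 0" "b $ 1 < 0" for b
  proof -
    have 1: "b $ 1 * f + b $ 2 * G = 0" using b(2) tg by simp
    have 2: "b $ 1 * b $ 1 * E + 2 * (b $ 1 * b $ 2) * f + b $ 2 * b $ 2 * G = 1" using b(1) sq[of b] by (simp add: norm_eq_1)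
    have "(b $ 1)\<^sup>2 * D = G" using 1 2 unfolding D(1) by algebra
    then have "((- (b $ 1)) * s)\<^sup>2 = G * G"
      unfolding power_mult_distrib power2_eq_square[of s] s(2) by simp
    then have "((- (b $ 1)) * s)\<^sup>2 = G\<^sup>2" by (simp only: power2_eq_square)
    moreover have "0 \<le> (- (b $ 1)) * s" using b(3) s(1) by (simp add: mult_nonpos_nonneg)
    ultimately have b1s: "(- (b $ 1)) * s = G"
      by (rule power2_eq_imp_eq) (use G in simp)
    then have "b $ 1 = - G / s" using s(1) by (simp add: field_simps)
    moreover have "b $ 2 = f / s"
    proof -
      have "G * (b $ 2 * s) = G * f" using 1 b1s by algebra
      then show ?thesis using G s(1) by (simp add: field_simps)
    qed
    ultimately show ?thesis using a_nth by (simp add: vec_eq_iff forall_2)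
  qed
  show eq: "conormal X p = ?a"
    unfolding conormal_def by (rule the_equality) (use a1 a2 a3 uniq in blast)+
  show "norm (D_half X p (conormal X p)) = 1" "D_half X p (conormal X p) \<bullet> D_half X p e2 = 0" "conormal X p $ 1 < 0"
    unfolding eq by (fact a1 a2 a3)+
qed

lemma axis_nth_2: "e1 $ 1 = 1" "e1 $ 2 = 0" "e2 $ 1 = 0" "e2 $ 2 = 1"
  by (simp_all add: axis_def)

lemma D_half_conormal:
  fixes X :: "real^2 \<Rightarrow> real^3" and u :: "real^2 \<Rightarrow> real"
  assumes X: "C1_on halfplane X U" and u: "C1_on halfplane u U" and p: "p \<in> U" and pos: "0 < det (gram X p)"
  shows "D_half u p (conormal X p) = - flux1 X u p / norm (D_half X p e2)"
proof -
  have n: "norm (D_half X p e2) = sqrt (D_half X p e2 \<bullet> D_half X p e2)" by (simp add: norm_eq_sqrt_inner)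
  have nth: "conormal X p $ 1 = - (D_half X p e2 \<bullet> D_half X p e2) / sqrt (det (gram X p) * (D_half X p e2 \<bullet> D_half X p e2))"
    "conormal X p $ 2 = (D_half X p e1 \<bullet> D_half X p e2) / sqrt (det (gram X p) * (D_half X p e2 \<bullet> D_half X p e2))"
    unfolding conormal_eq(1)[OF X p pos] vector_add_component vector_scaleR_component by (simp_all add: axis_nth_2)
  show ?thesis
    unfolding D_half_expand[OF u p, of "conormal X p"] nth flux1_def n real_sqrt_mult
    by (simp add: diff_divide_distrib)
qed

locale capillary_surface = minimal_surface \<A> F \<nu>
  for \<A> :: "'a::{t2_space, second_countable_topology} param set" and F \<nu> :: "'a \<Rightarrow> real^3" +
  fixes \<theta> :: real
  assumes \<theta>: "0 < \<theta>" "\<theta> < pi"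
    and in_halfspace: "F ` points \<A> \<subseteq> halfspace"
    and bdry_frontier: "F ` bdry \<A> \<subseteq> frontier halfspace"
    and angle: "\<And>x. x \<in> bdry \<A> \<Longrightarrow> \<nu> x \<bullet> eta_bar = cos \<theta>"
begin

lemma sin_pos: "0 < sin \<theta>" using \<theta> by (rule sin_gt_zero)

lemma F_bdry: assumes "x \<in> bdry \<A>" shows "F x $ 1 = 0"
proof -
  have "halfspace = {x. axis 1 1 \<bullet> x \<ge> (0::real)}" by (simp add: halfspace_def inner_axis')
  moreover have "frontier {x. axis 1 1 \<bullet> x \<ge> (0::real)} = {x :: real^3. axis 1 1 \<bullet> x = 0}"
    by (rule frontier_halfspace_ge) (simp add: axis_eq_0_iff)
  ultimately have "frontier halfspace = {x. axis 1 1 \<bullet> x = (0::real)}" by simp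
  then show ?thesis using bdry_frontier assms by (auto simp: inner_axis')
qed

text \<open>The edge of the surface lies in the plane \<open>x\<^sub>1 = 0\<close>, so \<open>eta_bar\<close> is orthogonal to it and therefore a
  combination of \<open>\<nu>\<close> and the conormal \<open>\<eta>\<close>. The coefficient of \<open>\<nu>\<close> is \<open>cos \<theta>\<close>, that of \<open>\<eta>\<close> is
  \<open>sin \<theta>\<close> up to the sign; the sign is positive since the surface lies in the half-space. In
  particular, the conormal vector in space does not depend on the chart.\<close>

lemma conormal_vector:
  assumes c: "(U, \<phi>) \<in> \<A>" "p \<in> U" and e: "p $ 1 = 0"
  shows "D_half (\<lambda>q. F (\<phi> q)) p (conormal (\<lambda>q. F (\<phi> q)) p) = (1 / sin \<theta>) *\<^sub>R (eta_bar - cos \<theta> *\<^sub>R \<nu> (\<phi> p))"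
proof -
  interpret M: minimal_chart U "\<lambda>q. F (\<phi> q)" "\<lambda>q. \<nu> (\<phi> q)" by (rule minimal_chart[OF c(1)])
  let ?X = "\<lambda>q. F (\<phi> q)"
  define a where "a = conormal ?X p"
  define n where "n = D_half ?X p a"
  have con: "norm n = 1" "n \<bullet> D_half ?X p e2 = 0" "a $ 1 < 0"
    unfolding n_def a_def by (fact conormal_eq(2-4)[OF M.X1 c(2) M.pos[OF c(2)]])+
  have n: "n = a $ 1 *\<^sub>R D_half ?X p e1 + a $ 2 *\<^sub>R D_half ?X p e2"
    unfolding n_def by (rule D_half_expand[OF M.X1 c(2)])
  have h1: "C1_on halfplane (\<lambda>q. F (\<phi> q) \<bullet> axis 1 1) U" by (rule C1h_inner[OF M.U M.X1 C1h_const[OF M.U]])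
  have hD: "D_half (\<lambda>q. F (\<phi> q) \<bullet> axis 1 1) p b = D_half ?X p b $ 1" for b
    using D_half_inner[OF M.U M.X1 C1h_const[OF M.U] c(2), of "axis 1 1"] D_half_const[OF M.U c(2), of "axis 1 1 :: real^3"]
    by (simp add: inner_axis)
  have edge0: "F (\<phi> q) $ 1 = 0" if "q \<in> U" "q $ 1 = 0" for q
    by (rule F_bdry) (use bdry_chart[OF c(1) that(1)] that in simp)
  have X1: "0 \<le> D_half ?X p e1 $ 1"
    unfolding hD[symmetric]
    by (rule D_half_edge_nonneg[OF M.U h1 c(2)])
       (use in_halfspace chart_in_points[OF c(1)] edge0[OF c(2) e] in \<open>auto simp: halfspace_def inner_axis\<close>)
  have X2: "D_half ?X p e2 $ 1 = 0"
    unfolding hD[symmetric]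
    by (rule D_half_edge_zero[OF M.U h1 c(2) e]) (use edge0 in \<open>simp add: inner_axis\<close>)
  have eb: "eta_bar \<bullet> v = - v $ 1" for v by (simp add: eta_bar_def inner_axis')
  have NX: "\<nu> (\<phi> p) \<bullet> D_half ?X p b = 0" for b using M.N_normal c(2) by blast
  have NN: "\<nu> (\<phi> p) \<bullet> \<nu> (\<phi> p) = 1" using M.N_unit c(2) by (simp add: norm_eq_1)
  have nn: "n \<bullet> n = 1" using con(1) by (simp add: norm_eq_1)
  have Nn: "\<nu> (\<phi> p) \<bullet> n = 0" unfolding n_def by (rule NX)
  have eN: "eta_bar \<bullet> \<nu> (\<phi> p) = cos \<theta>"
    using angle[of "\<phi> p"] bdry_chart[OF c] e by (simp add: inner_commute)
  define k where "k = eta_bar \<bullet> n"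
  define v where "v = eta_bar - cos \<theta> *\<^sub>R \<nu> (\<phi> p) - k *\<^sub>R n"
  have v2: "v \<bullet> D_half ?X p e2 = 0"
    unfolding v_def by (simp add: inner_diff_left eb X2 NX con(2))
  have "v \<bullet> n = 0" unfolding v_def by (simp add: inner_diff_left Nn nn k_def)
  then have "a $ 1 * (v \<bullet> D_half ?X p e1) = 0" unfolding n using v2 by (simp add: inner_add_right)
  then have v1: "v \<bullet> D_half ?X p e1 = 0" using con(3) by simp
  have vN: "v \<bullet> \<nu> (\<phi> p) = 0"
    unfolding v_def by (simp add: inner_diff_left eN NN Nn inner_commute[of n])
  have "v = 0" by (rule M.tangent_normal_zero[OF c(2) v1 v2 vN])
  then have dec: "eta_bar = cos \<theta> *\<^sub>R \<nu> (\<phi> p) + k *\<^sub>R n" by (simp add: v_def algebra_simps)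
  have "1 = eta_bar \<bullet> eta_bar" by (simp add: eta_bar_def inner_axis_axis)
  also have "\<dots> = eta_bar \<bullet> (cos \<theta> *\<^sub>R \<nu> (\<phi> p) + k *\<^sub>R n)" by (rule arg_cong[OF dec])
  also have "\<dots> = cos \<theta> * (eta_bar \<bullet> \<nu> (\<phi> p)) + k * (eta_bar \<bullet> n)"
    by (simp only: inner_add_right inner_scaleR_right)
  also have "\<dots> = (cos \<theta>)\<^sup>2 + k\<^sup>2"
    unfolding eN k_def[symmetric] by (simp only: power2_eq_square)
  finally have "k\<^sup>2 = (sin \<theta>)\<^sup>2" using sin_cos_squared_add[of \<theta>] by linarith
  moreover have "0 \<le> k"
    unfolding k_def eb n using X1 X2 con(3) by (simp add: mult_nonpos_nonneg)
  ultimately have "k = sin \<theta>" using sin_pos power2_eq_iff_nonneg[of k "sin \<theta>"] by simp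
  then have "n = (1 / sin \<theta>) *\<^sub>R (eta_bar - cos \<theta> *\<^sub>R \<nu> (\<phi> p))"
    using sin_pos by (subst dec) simp
  then show ?thesis by (simp add: n_def a_def)
qed

lemma conormal_transition:
  assumes c: "(U, \<phi>) \<in> \<A>" "p \<in> U" and e: "p $ 1 = 0" and d: "(V, \<psi>) \<in> \<A>" "\<phi> p \<in> \<psi> ` V"
  shows "conormal (\<lambda>q. F (\<psi> q)) (inv_into V \<psi> (\<phi> p))
    = D_half (\<lambda>p. inv_into V \<psi> (\<phi> p)) p (conormal (\<lambda>q. F (\<phi> q)) p)"
proof -
  let ?S = "{p \<in> U. \<phi> p \<in> \<psi> ` V}" and ?\<tau> = "\<lambda>p. inv_into V \<psi> (\<phi> p)"
  interpret t: coordinate_change ?S V ?\<tau> "\<lambda>q. F (\<phi> q)" "\<lambda>q. F (\<psi> q)" by (rule transition[OF c(1) d(1)])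
  interpret M: minimal_chart V "\<lambda>q. F (\<psi> q)" "\<lambda>q. \<nu> (\<psi> q)" by (rule minimal_chart[OF d(1)])
  have p: "p \<in> ?S" using c d by auto
  have pV: "?\<tau> p \<in> V" using t.ST p by auto
  have "?\<tau> p $ 1 = 0" using edge_transition[OF c d] e by simp
  then have "D_half (\<lambda>q. F (\<psi> q)) (?\<tau> p) (conormal (\<lambda>q. F (\<psi> q)) (?\<tau> p)) = (1 / sin \<theta>) *\<^sub>R (eta_bar - cos \<theta> *\<^sub>R \<nu> (\<phi> p))"
    using conormal_vector[OF d(1) pV] d(2) by (simp add: f_inv_into_f)
  also have "\<dots> = D_half (\<lambda>q. F (\<phi> q)) p (conormal (\<lambda>q. F (\<phi> q)) p)" by (rule conormal_vector[OF c e, symmetric])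
  also have "\<dots> = D_half (\<lambda>q. F (\<psi> q)) (?\<tau> p) (D_half ?\<tau> p (conormal (\<lambda>q. F (\<phi> q)) p))"
    by (rule t.D_comp(1)[OF M.X1 t.XY p])
  finally show ?thesis using M.inj[OF pV] by (simp add: inj_eq)
qed

lemma conormal_deriv_chart:
  assumes u: "surface_C1 u" and c: "(U, \<phi>) \<in> \<A>" "p \<in> U" and e: "p $ 1 = 0"
  shows "conormal_deriv \<A> F u (\<phi> p) = D_half (\<lambda>q. u (\<phi> q)) p (conormal (\<lambda>q. F (\<phi> q)) p)"
  unfolding conormal_deriv_def
proof (rule invariant_value_chart[OF _ c])
  fix V \<psi> assume d: "(V, \<psi>) \<in> \<A>" "\<phi> p \<in> \<psi> ` V"
  interpret t: coordinate_change "{p \<in> U. \<phi> p \<in> \<psi> ` V}" V "\<lambda>p. inv_into V \<psi> (\<phi> p)" "\<lambda>q. F (\<phi> q)" "\<lambda>q. F (\<psi> q)"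
    by (rule transition[OF c(1) d(1)])
  show "D_half (\<lambda>q. u (\<phi> q)) p (conormal (\<lambda>q. F (\<phi> q)) p)
    = D_half (\<lambda>q. u (\<psi> q)) (inv_into V \<psi> (\<phi> p)) (conormal (\<lambda>q. F (\<psi> q)) (inv_into V \<psi> (\<phi> p)))"
    unfolding conormal_transition[OF c e d]
    by (rule t.D_comp(1)[OF surface_C1D[OF u d(1)]]) (use c d in \<open>auto simp: f_inv_into_f\<close>)
qed

lemma A_conormal_chart:
  assumes c: "(U, \<phi>) \<in> \<A>" "p \<in> U" and e: "p $ 1 = 0"
  shows "A_conormal \<A> F \<nu> (\<phi> p) = sff (\<lambda>q. F (\<phi> q)) (\<lambda>q. \<nu> (\<phi> q)) p (conormal (\<lambda>q. F (\<phi> q)) p) (conormal (\<lambda>q. F (\<phi> q)) p)"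
  unfolding A_conormal_def Let_def
proof (rule invariant_value_chart[OF _ c])
  fix V \<psi> assume d: "(V, \<psi>) \<in> \<A>" "\<phi> p \<in> \<psi> ` V"
  let ?S = "{p \<in> U. \<phi> p \<in> \<psi> ` V}"
  interpret t: coordinate_change ?S V "\<lambda>p. inv_into V \<psi> (\<phi> p)" "\<lambda>q. F (\<phi> q)" "\<lambda>q. F (\<psi> q)"
    by (rule transition[OF c(1) d(1)])
  interpret M: minimal_chart V "\<lambda>q. F (\<psi> q)" "\<lambda>q. \<nu> (\<psi> q)" by (rule minimal_chart[OF d(1)])
  have p: "p \<in> ?S" using c d by auto
  have N: "\<forall>p\<in>?S. \<nu> (\<phi> p) = \<nu> (\<psi> (inv_into V \<psi> (\<phi> p)))" by (auto simp: f_inv_into_f)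
  show "sff (\<lambda>q. F (\<phi> q)) (\<lambda>q. \<nu> (\<phi> q)) p (conormal (\<lambda>q. F (\<phi> q)) p) (conormal (\<lambda>q. F (\<phi> q)) p)
    = sff (\<lambda>q. F (\<psi> q)) (\<lambda>q. \<nu> (\<psi> q)) (inv_into V \<psi> (\<phi> p)) (conormal (\<lambda>q. F (\<psi> q)) (inv_into V \<psi> (\<phi> p)))
       (conormal (\<lambda>q. F (\<psi> q)) (inv_into V \<psi> (\<phi> p)))"
    unfolding conormal_transition[OF c e d] sff_def t.D_comp(1)[OF M.X1 t.XY p] t.D_comp(1)[OF M.N1 N p] ..
qed

lemma conormal_data_deriv: assumes u: "surface_C1 u" shows "conormal_data u (conormal_deriv \<A> F u)"
  unfolding conormal_data_def
proof (clarify)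
  fix U \<phi> p assume c: "(U, \<phi>) \<in> \<A>" "p \<in> U" and e: "p $ 1 = 0"
  interpret M: minimal_chart U "\<lambda>q. F (\<phi> q)" "\<lambda>q. \<nu> (\<phi> q)" by (rule minimal_chart[OF c(1)])
  show "conormal_deriv \<A> F u (\<phi> p) = - flux1 (\<lambda>q. F (\<phi> q)) (\<lambda>q. u (\<phi> q)) p / norm (D_half (\<lambda>q. F (\<phi> q)) p e2)"
    unfolding conormal_deriv_chart[OF u c e]
    by (rule D_half_conormal[OF M.X1 surface_C1D[OF u c(1)] c(2) M.pos[OF c(2)]])
qed

section \<open>The weight function\<close>

text \<open>The function \<open>1 - cos \<theta> \<langle>\<nu>, eta_bar\<rangle>\<close>, written as \<open>1 + \<langle>\<nu>, e\<rangle>\<close> with a constant vector \<open>e\<close> to fit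
  \<open>laplace_normal\<close>.\<close>

definition weight :: "'a \<Rightarrow> real" where
  "weight x = 1 + \<nu> x \<bullet> (- cos \<theta> *\<^sub>R eta_bar)"

lemma weight_C2: "surface_C2 weight"
  unfolding surface_C2_def weight_def
proof clarify
  fix U \<phi> assume c: "(U, \<phi>) \<in> \<A>"
  interpret M: minimal_chart U "\<lambda>q. F (\<phi> q)" "\<lambda>q. \<nu> (\<phi> q)" by (rule minimal_chart[OF c])
  show "C2_on halfplane (\<lambda>q. 1 + \<nu> (\<phi> q) \<bullet> (- cos \<theta> *\<^sub>R eta_bar)) U"
    by (intro C2h_add[OF M.U] C2h_inner[OF M.U] C2h_const[OF M.U] M.N)
qed

lemma D_half_weight:
  assumes c: "(U, \<phi>) \<in> \<A>" "p \<in> U"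
  shows "D_half (\<lambda>q. weight (\<phi> q)) p a = D_half (\<lambda>q. \<nu> (\<phi> q) \<bullet> (- cos \<theta> *\<^sub>R eta_bar)) p a"
    and "D_half (\<lambda>q. weight (\<phi> q)) p a = - cos \<theta> * (D_half (\<lambda>q. \<nu> (\<phi> q)) p a \<bullet> eta_bar)"
proof -
  interpret M: minimal_chart U "\<lambda>q. F (\<phi> q)" "\<lambda>q. \<nu> (\<phi> q)" by (rule minimal_chart[OF c(1)])
  note n = C1h_inner[OF M.U M.N1 C1h_const[OF M.U, of "- cos \<theta> *\<^sub>R eta_bar"]]
  show 1: "D_half (\<lambda>q. weight (\<phi> q)) p a = D_half (\<lambda>q. \<nu> (\<phi> q) \<bullet> (- cos \<theta> *\<^sub>R eta_bar)) p a"
    unfolding weight_def using D_half_add[OF M.U C1h_const[OF M.U] n c(2), of 1] D_half_const[OF M.U c(2), of "1::real"] by simp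
  show "D_half (\<lambda>q. weight (\<phi> q)) p a = - cos \<theta> * (D_half (\<lambda>q. \<nu> (\<phi> q)) p a \<bullet> eta_bar)"
    unfolding 1 using D_half_inner[OF M.U M.N1 C1h_const[OF M.U] c(2), of "- cos \<theta> *\<^sub>R eta_bar"]
      D_half_const[OF M.U c(2), of "- cos \<theta> *\<^sub>R eta_bar"] by simp
qed

lemma Laplacian_weight:
  assumes x: "x \<in> points \<A>"
  shows "Laplacian \<A> F weight x + A_norm_sq \<A> F \<nu> x * weight x = A_norm_sq \<A> F \<nu> x"
proof -
  obtain U \<phi> p where c: "(U, \<phi>) \<in> \<A>" "p \<in> U" and x: "x = \<phi> p" using x points_chart by blast
  interpret M: minimal_chart U "\<lambda>q. F (\<phi> q)" "\<lambda>q. \<nu> (\<phi> q)" by (rule minimal_chart[OF c(1)])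
  let ?X = "\<lambda>q. F (\<phi> q)" and ?w = "\<lambda>q. weight (\<phi> q)" and ?n = "\<lambda>q. \<nu> (\<phi> q) \<bullet> (- cos \<theta> *\<^sub>R eta_bar)"
  have "flux1 ?X ?w q = flux1 ?X ?n q" "flux2 ?X ?w q = flux2 ?X ?n q" if "q \<in> U" for q
    unfolding flux1_def flux2_def D_half_weight(1)[OF c(1) that] by simp_all
  then have "D_half (flux1 ?X ?w) p = D_half (flux1 ?X ?n) p" "D_half (flux2 ?X ?w) p = D_half (flux2 ?X ?n) p"
    by (auto intro!: D_half_cong[OF M.U c(2)])
  then have "laplace_beltrami ?X ?w p = laplace_beltrami ?X ?n p"
    by (simp only: laplace_beltrami_flux[OF M.U c(2) M.pos])
  also have "\<dots> = - sff_norm_sq ?X (\<lambda>q. \<nu> (\<phi> q)) p * ?n p" by (rule M.laplace_normal[OF c(2)])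
  finally show ?thesis
    unfolding x Laplacian_chart[OF weight_C2 c] A_norm_sq_chart[OF c] by (simp add: weight_def algebra_simps)
qed

text \<open>Since \<open>eta_bar = cos \<theta> \<nu> + sin \<theta> \<eta>\<close> and the derivative of \<open>\<nu>\<close> is orthogonal to \<open>\<nu>\<close>, the derivative of
  \<open>\<langle>\<nu>, eta_bar\<rangle>\<close> in direction \<open>\<eta>\<close> is \<open>sin \<theta> A(\<eta>, \<eta>)\<close>; and the weight equals \<open>sin\<^sup>2 \<theta>\<close> on the
  boundary.\<close>

lemma conormal_deriv_weight:
  assumes x: "x \<in> bdry \<A>"
  shows "conormal_deriv \<A> F weight x = (- cot \<theta> * A_conormal \<A> F \<nu> x) * weight x"
proof -
  obtain U \<phi> p where c: "(U, \<phi>) \<in> \<A>" "p \<in> U" and x': "x = \<phi> p" using x bdry_subset points_chart by blast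
  have e: "p $ 1 = 0" using bdry_chart[OF c] x x' by simp
  interpret M: minimal_chart U "\<lambda>q. F (\<phi> q)" "\<lambda>q. \<nu> (\<phi> q)" by (rule minimal_chart[OF c(1)])
  let ?X = "\<lambda>q. F (\<phi> q)" and ?N = "\<lambda>q. \<nu> (\<phi> q)"
  let ?a = "conormal ?X p"
  have "sin \<theta> *\<^sub>R D_half ?X p ?a = eta_bar - cos \<theta> *\<^sub>R \<nu> (\<phi> p)" unfolding conormal_vector[OF c e] using sin_pos by simp
  then have dec: "eta_bar = sin \<theta> *\<^sub>R D_half ?X p ?a + cos \<theta> *\<^sub>R \<nu> (\<phi> p)" by (simp add: algebra_simps)
  have "D_half ?N p ?a \<bullet> eta_bar = sin \<theta> * sff ?X ?N p ?a ?a"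
    by (subst dec) (use M.N_DN[OF c(2), of ?a] in \<open>simp add: inner_add_right sff_def inner_commute\<close>)
  then have 1: "conormal_deriv \<A> F weight x = - cos \<theta> * (sin \<theta> * A_conormal \<A> F \<nu> x)"
    unfolding x' conormal_deriv_chart[OF surface_C2_C1[OF weight_C2] c e] D_half_weight(2)[OF c] A_conormal_chart[OF c e] by simp
  have "weight x = 1 - cos \<theta> * cos \<theta>" using angle[OF x] by (simp add: weight_def)
  also have "\<dots> = sin \<theta> * sin \<theta>" using sin_squared_eq[of \<theta>] by (simp add: power2_eq_square)
  finally show ?thesis unfolding 1 cot_def using sin_pos by simp
qed

lemma weight_bounds: assumes x: "x \<in> points \<A>" shows "1 - \<bar>cos \<theta>\<bar> \<le> weight x" "weight x \<le> 2"
proof -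
  have "\<bar>\<nu> x \<bullet> eta_bar\<bar> \<le> norm (\<nu> x) * norm eta_bar" by (rule Cauchy_Schwarz_ineq2)
  also have "\<dots> = 1" using immersed x by (simp add: immersed_two_sided_def eta_bar_def)
  finally have "\<bar>cos \<theta> * (\<nu> x \<bullet> eta_bar)\<bar> \<le> \<bar>cos \<theta>\<bar>"
    unfolding abs_mult using mult_left_le[of "\<bar>\<nu> x \<bullet> eta_bar\<bar>" "\<bar>cos \<theta>\<bar>"] by simp
  then show "1 - \<bar>cos \<theta>\<bar> \<le> weight x" "weight x \<le> 2"
    unfolding weight_def inner_scaleR_right abs_le_iff[of "cos \<theta> * _"] using abs_cos_le_one[of \<theta>] by linarith+
qed

lemma abs_cos_less: "\<bar>cos \<theta>\<bar> < 1"
proof -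
  have "(cos \<theta>)\<^sup>2 < 1" using sin_pos sin_cos_squared_add[of \<theta>] zero_less_power[OF sin_pos, of 2] by linarith
  then show ?thesis by (simp add: abs_square_less_1)
qed

end

section \<open>The logarithmic cutoff\<close>

text \<open>The profile of the cutoff as a function of \<open>r = |F|\<^sup>2\<close>, and its first two derivatives. The cube makes
  it of class \<open>C\<^sup>2\<close>, as stability requires of test functions. The logarithm makes \<open>r cut'(r)\<^sup>2\<close> at most
  \<open>9/(L\<^sup>2 (1 + r))\<close>, and quadratic area growth leaves the integral of this over the support of order \<open>1/L\<close>.\<close>

definition cut :: "real \<Rightarrow> real \<Rightarrow> real" where
  "cut L r = max 0 (1 - ln (1 + r) / L) ^ 3"

definition cut' :: "real \<Rightarrow> real \<Rightarrow> real" where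
  "cut' L r = 3 * max 0 (1 - ln (1 + r) / L) ^ 2 * (- (1 / (L * (1 + r))))"

definition cut'' :: "real \<Rightarrow> real \<Rightarrow> real" where
  "cut'' L r = 3 * (2 * max 0 (1 - ln (1 + r) / L) * (- (1 / (L * (1 + r))))) * (- (1 / (L * (1 + r))))
     + 3 * max 0 (1 - ln (1 + r) / L) ^ 2 * (1 / (L * (1 + r)\<^sup>2))"

lemma cut_deriv:
  assumes L: "0 < L" and r: "0 \<le> r"
  shows "(cut L has_real_derivative cut' L r) (at r)" "(cut' L has_real_derivative cut'' L r) (at r)"
proof -
  have s: "((\<lambda>r. 1 - ln (1 + r) / L) has_real_derivative - (1 / (L * (1 + r)))) (at r)"
    using L r by (auto intro!: derivative_eq_intros)
  have t: "((\<lambda>r. - (1 / (L * (1 + r)))) has_real_derivative 1 / (L * (1 + r)\<^sup>2)) (at r)"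
  proof -
    have "((\<lambda>r. - (1 / L) * inverse (1 + r)) has_real_derivative - (1 / L) * - (inverse (1 + r) * 1 * inverse (1 + r))) (at r)"
      using L r by (auto intro!: derivative_eq_intros)
    then show ?thesis by (simp add: divide_inverse power2_eq_square mult_ac)
  qed
  have p3: "((\<lambda>x::real. max 0 x ^ 3) has_real_derivative 3 * max 0 x ^ 2) (at x)" for x
    using pos_part_power_deriv[of 1 x] by (simp add: numeral_2_eq_2 numeral_3_eq_3)
  have p2: "((\<lambda>x::real. max 0 x ^ 2) has_real_derivative 2 * max 0 x) (at x)" for x
    using pos_part_power_deriv[of 0 x] by (simp add: numeral_2_eq_2)
  show "(cut L has_real_derivative cut' L r) (at r)"
    unfolding cut_def[abs_def] cut'_def by (rule DERIV_chain2[OF p3 s])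
  show "(cut' L has_real_derivative cut'' L r) (at r)"
    unfolding cut'_def[abs_def] cut''_def
    using DERIV_mult[OF DERIV_cmult[OF DERIV_chain2[OF p2 s], of 3] t] by (simp add: algebra_simps)
qed

lemma cut''_cont: "0 < L \<Longrightarrow> continuous_on {0..} (cut'' L)"
  unfolding cut''_def by (intro continuous_intros) (auto simp: add_nonneg_eq_0_iff)

lemma cut'_cont: "0 < L \<Longrightarrow> continuous_on {0..} (cut' L)"
  unfolding cut'_def by (intro continuous_intros) (auto simp: add_nonneg_eq_0_iff)

lemma cut_zero: "0 < L \<Longrightarrow> L \<le> ln (1 + r) \<Longrightarrow> cut L r = 0 \<and> cut' L r = 0"
  unfolding cut_def cut'_def by (simp add: field_simps)

lemma cut'_bound:
  assumes L: "0 < L" and r: "0 \<le> r"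
  shows "(cut' L r)\<^sup>2 * r \<le> 9 / (L\<^sup>2 * (1 + r))"
proof -
  have m: "max 0 (1 - ln (1 + r) / L) \<le> 1" "0 \<le> max 0 (1 - ln (1 + r) / L)" using L r by auto
  then have m4: "max 0 (1 - ln (1 + r) / L) ^ 4 \<le> 1" by (intro power_le_one) auto
  have "(cut' L r)\<^sup>2 = 9 * max 0 (1 - ln (1 + r) / L) ^ 4 / (L * (1 + r))\<^sup>2"
    unfolding cut'_def by (simp add: power_mult_distrib power_divide flip: power_mult)
  also have "\<dots> \<le> 9 / (L * (1 + r))\<^sup>2" using m4 by (intro divide_right_mono) auto
  finally have "(cut' L r)\<^sup>2 * r \<le> 9 / (L * (1 + r))\<^sup>2 * (1 + r)" using r by (intro mult_mono) auto
  also have "\<dots> = 9 / (L\<^sup>2 * (1 + r))"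
  proof -
    have "9 / (L * a)\<^sup>2 * a = 9 / (L\<^sup>2 * a)" if "0 < a" for a using that by (simp add: power2_eq_square)
    from this[of "1 + r"] show ?thesis using r by (simp only: add_pos_nonneg zero_less_one)
  qed
  finally show ?thesis .
qed

text \<open>Summing over dyadic scales reduces the integral of \<open>1/(1 + r)\<close> to the areas of balls.\<close>

lemma dyadic_bound:
  fixes r :: real
  assumes r: "0 \<le> r" and "1 + r < 2 ^ K"
  shows "1 / (1 + r) \<le> (\<Sum>k<K. (1/2) ^ k * of_bool (r < 2 ^ Suc k))"
  using assms(2)
proof (induction K)
  case 0
  then show ?case using r by simp
next
  case (Suc K)
  have nn: "0 \<le> (\<Sum>k<K. (1/2::real) ^ k * of_bool (r < 2 ^ Suc k))" by (intro sum_nonneg) auto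
  show ?case
  proof (cases "1 + r < 2 ^ K")
    case True
    moreover have "0 \<le> (1/2::real) ^ K * of_bool (r < 2 ^ Suc K)" by simp
    ultimately show ?thesis using Suc.IH unfolding sum.lessThan_Suc by linarith
  next
    case False
    then have "1 / (1 + r) \<le> 1 / 2 ^ K" using r by (intro divide_left_mono) auto
    moreover have "r < 2 ^ Suc K" using Suc.prems by simp
    ultimately show ?thesis using nn by (simp add: power_one_over)
  qed
qed

text \<open>The quotient is the squared length of the projection of \<open>v\<close> to the tangent plane.\<close>

lemma bessel:
  fixes X :: "real^2 \<Rightarrow> real^3" and v :: "real^3"
  assumes pos: "0 < det (gram X p)"
  defines "q \<equiv> (D_half X p e2 \<bullet> D_half X p e2) * (v \<bullet> D_half X p e1)\<^sup>2
     - 2 * (D_half X p e1 \<bullet> D_half X p e2) * (v \<bullet> D_half X p e1) * (v \<bullet> D_half X p e2)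
     + (D_half X p e1 \<bullet> D_half X p e1) * (v \<bullet> D_half X p e2)\<^sup>2"
  shows "0 \<le> q / det (gram X p)" "q / det (gram X p) \<le> v \<bullet> v"
proof -
  define E f G b1 b2 where "E = D_half X p e1 \<bullet> D_half X p e1" and "f = D_half X p e1 \<bullet> D_half X p e2"
    and "G = D_half X p e2 \<bullet> D_half X p e2" and "b1 = v \<bullet> D_half X p e1" and "b2 = v \<bullet> D_half X p e2"
  define D where "D = det (gram X p)"
  have D: "D = E * G - f\<^sup>2" "0 < D" using pos by (simp_all add: D_def E_def f_def G_def det_gram)
  have q: "q = G * b1\<^sup>2 - 2 * f * b1 * b2 + E * b2\<^sup>2"
    by (simp add: q_def E_def f_def G_def b1_def b2_def)
  \<comment> \<open>\<open>z\<close> is \<open>D\<close> times the projection of \<open>v\<close> to the tangent plane\<close>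
  define z where "z = (G * b1 - f * b2) *\<^sub>R D_half X p e1 + (E * b2 - f * b1) *\<^sub>R D_half X p e2"
  have vz: "v \<bullet> z = q"
    unfolding z_def q inner_add_right inner_scaleR_right b1_def[symmetric] b2_def[symmetric] by algebra
  have zz: "z \<bullet> z = D * q"
    unfolding z_def q inner_combination E_def[symmetric] f_def[symmetric] G_def[symmetric] D(1) by algebra
  have "0 \<le> D * q" using zz inner_ge_zero[of z] by simp
  then have q0: "0 \<le> q" using D(2) by (simp add: zero_le_mult_iff)
  then show "0 \<le> q / det (gram X p)" using pos by simp
  have "0 \<le> (D *\<^sub>R v - z) \<bullet> (D *\<^sub>R v - z)" by (rule inner_ge_zero)
  also have "\<dots> = D * (D * (v \<bullet> v) - q)"
    using vz zz by (simp add: inner_diff_left inner_diff_right inner_commute[of z v] algebra_simps)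
  finally have "q \<le> D * (v \<bullet> v)" using D(2) by (simp add: zero_le_mult_iff)
  then show "q / det (gram X p) \<le> v \<bullet> v" using D(2) by (simp add: D_def[symmetric] pos_divide_le_eq mult.commute)
qed

context capillary_surface
begin

definition \<rho> :: "'a \<Rightarrow> real" where "\<rho> x = F x \<bullet> F x"

lemma \<rho>_nonneg [simp]: "0 \<le> \<rho> x" by (simp add: \<rho>_def)

definition cutoff :: "real \<Rightarrow> 'a \<Rightarrow> real" where "cutoff L x = cut L (\<rho> x)"

lemma \<rho>_C1: "surface_C1 \<rho>"
  unfolding \<rho>_def
  by (rule surface_C1I) (rule C1h_inner[OF chart_hopen minimal_chart.X1[OF minimal_chart] minimal_chart.X1[OF minimal_chart]])

lemma cutoff_C1: assumes L: "0 < L" shows "surface_C1 (cutoff L)"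
  unfolding cutoff_def
proof (rule surface_C1I)
  fix U \<phi> assume c: "(U, \<phi>) \<in> \<A>"
  show "C1_on halfplane (\<lambda>q. cut L (\<rho> (\<phi> q))) U"
    by (rule C1_on_real_comp[OF thick_halfplane chart_hopen[OF c] surface_C1D[OF \<rho>_C1 c], of "{0..}"])
       (use cut_deriv(1)[OF L] cut'_cont[OF L] in auto)
qed

lemma test_Ck:
  assumes L: "0 < L"
  shows "Ck_fun 2 \<A> (\<lambda>x. cutoff L x * weight x)"
  unfolding Ck_fun_def
proof clarify
  fix U \<phi> assume c: "(U, \<phi>) \<in> \<A>"
  have X: "Ck_half \<infinity> (\<lambda>q. F (\<phi> q)) U" and N: "Ck_half \<infinity> (\<lambda>q. \<nu> (\<phi> q)) U"
    using immersed c by (auto simp: immersed_two_sided_def Ck_fun_def)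
  show "Ck_half 2 (\<lambda>p. cutoff L (\<phi> p) * weight (\<phi> p)) U"
    unfolding Ck_half_def
  proof
    fix p assume p: "p \<in> U"
    obtain W1 g1 where W1: "open W1" "p \<in> W1" "Ck_on \<infinity> g1 W1" "\<forall>q\<in>U \<inter> W1. g1 q = F (\<phi> q)"
      using X p unfolding Ck_half_def by blast
    obtain W2 g2 where W2: "open W2" "p \<in> W2" "Ck_on \<infinity> g2 W2" "\<forall>q\<in>U \<inter> W2. g2 q = \<nu> (\<phi> q)"
      using N p unfolding Ck_half_def by blast
    let ?W = "W1 \<inter> W2"
    let ?g = "\<lambda>q. cut L (g1 q \<bullet> g1 q) * (1 + g2 q \<bullet> (- cos \<theta> *\<^sub>R eta_bar))"
    have W: "open ?W" using W1 W2 by auto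
    then have W': "openin (top_of_set UNIV) ?W" by (simp add: subtopology_UNIV)
    have g1: "C2_on UNIV g1 ?W" by (rule C2_on_subset[OF Ck_on_imp_C2_on[OF W1(3) _ W1(1)]]) auto
    have g2: "C2_on UNIV g2 ?W" by (rule C2_on_subset[OF Ck_on_imp_C2_on[OF W2(3) _ W2(1)]]) auto
    note B = C2_on_bilinear[OF thick_UNIV W']
    have "C2_on UNIV (\<lambda>q. cut L (g1 q \<bullet> g1 q)) ?W"
      by (rule C2_on_real_comp[OF thick_UNIV W' B[OF bounded_bilinear_inner g1 g1], of "{0..}"])
         (use cut_deriv[OF L] cut''_cont[OF L] in auto)
    moreover have "C2_on UNIV (\<lambda>q. 1 + g2 q \<bullet> (- cos \<theta> *\<^sub>R eta_bar)) ?W"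
      by (intro C2_on_add[OF thick_UNIV W'] C2_on_const[OF thick_UNIV W'] B[OF bounded_bilinear_inner g2])
    ultimately have "C2_on UNIV ?g ?W" by (rule B[OF bounded_bilinear_mult])
    then have "Ck_on 2 ?g ?W" by (rule C2_on_imp_Ck_on)
    moreover have "\<forall>q\<in>U \<inter> ?W. ?g q = cutoff L (\<phi> q) * weight (\<phi> q)"
      using W1(4) W2(4) by (auto simp: cutoff_def \<rho>_def weight_def)
    ultimately show "\<exists>W g. open W \<and> p \<in> W \<and> Ck_on 2 g W \<and> (\<forall>q\<in>U \<inter> W. g q = cutoff L (\<phi> q) * weight (\<phi> q))"
      using W W1(2) W2(2) by blast
  qed
qed

lemma Ck_surface_C2: assumes "Ck_fun 2 \<A> f" shows "surface_C2 f"
  unfolding surface_C2_def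
proof clarify
  fix U \<phi> assume c: "(U, \<phi>) \<in> \<A>"
  show "C2_on halfplane (\<lambda>q. f (\<phi> q)) U"
    by (rule Ck_half_C2(1)[of 2, OF _ order_refl chart_hopen[OF c]]) (use assms c in \<open>auto simp: Ck_fun_def\<close>)
qed

lemma cutoff_vanishes:
  assumes L: "0 < L" shows "vanishes_off (cutoff L) {x \<in> points \<A>. F x \<in> cball 0 (sqrt (exp L))}"
  unfolding vanishes_off_def
proof
  fix x assume "x \<in> points \<A> - {x \<in> points \<A>. F x \<in> cball 0 (sqrt (exp L))}"
  then have "sqrt (exp L) < norm (F x)" by auto
  then have "(sqrt (exp L))\<^sup>2 < (norm (F x))\<^sup>2" by (intro power_strict_mono) auto
  then have "exp L < \<rho> x" by (simp add: \<rho>_def power2_norm_eq_inner)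
  then have "exp L \<le> 1 + \<rho> x" by simp
  then have "L \<le> ln (1 + \<rho> x)" by (metis ln_exp ln_le_cancel_iff exp_gt_zero order_less_le_trans)
  then show "cutoff L x = 0" using cut_zero[OF L] by (simp add: cutoff_def)
qed

lemma Grad_cutoff:
  assumes L: "0 < L" and x: "x \<in> points \<A>"
  shows "0 \<le> Grad_inner (cutoff L) (cutoff L) x"
    "Grad_inner (cutoff L) (cutoff L) x \<le> 36 / (L\<^sup>2 * (1 + \<rho> x))"
    "L \<le> ln (1 + \<rho> x) \<Longrightarrow> Grad_inner (cutoff L) (cutoff L) x = 0"
proof -
  obtain U \<phi> p where c: "(U, \<phi>) \<in> \<A>" "p \<in> U" and x: "x = \<phi> p" using x points_chart by blast
  interpret M: minimal_chart U "\<lambda>q. F (\<phi> q)" "\<lambda>q. \<nu> (\<phi> q)" by (rule minimal_chart[OF c(1)])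
  let ?X = "\<lambda>q. F (\<phi> q)"
  let ?k = "cut' L (\<rho> x)"
  have d: "D_half (\<lambda>q. cutoff L (\<phi> q)) p a = ?k * (2 * (F x \<bullet> D_half ?X p a))" for a
  proof -
    have "D_half (\<lambda>q. cut L (\<rho> (\<phi> q))) p = (\<lambda>a. ?k * D_half (\<lambda>q. \<rho> (\<phi> q)) p a)"
      unfolding D_half_def x
      by (rule frechet_real_comp[OF thick_halfplane M.U surface_C1D[OF \<rho>_C1 c(1)] c(2) cut_deriv(1)[OF L]]) simp
    moreover have "D_half (\<lambda>q. \<rho> (\<phi> q)) p a = 2 * (F x \<bullet> D_half ?X p a)"
      unfolding \<rho>_def x using D_half_inner[OF M.U M.X1 M.X1 c(2)] by (simp add: inner_commute)
    ultimately show ?thesis by (simp add: cutoff_def)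
  qed
  define Q where "Q = ((D_half ?X p e2 \<bullet> D_half ?X p e2) * (F x \<bullet> D_half ?X p e1)\<^sup>2
     - 2 * (D_half ?X p e1 \<bullet> D_half ?X p e2) * (F x \<bullet> D_half ?X p e1) * (F x \<bullet> D_half ?X p e2)
     + (D_half ?X p e1 \<bullet> D_half ?X p e1) * (F x \<bullet> D_half ?X p e2)\<^sup>2) / det (gram ?X p)"
  have Q: "0 \<le> Q" "Q \<le> \<rho> x" unfolding Q_def \<rho>_def by (rule bessel[OF M.pos[OF c(2)]])+
  have eq: "Grad_inner (cutoff L) (cutoff L) x = 4 * (?k\<^sup>2 * Q)"
    unfolding x Grad_inner_chart[OF cutoff_C1[OF L] cutoff_C1[OF L] c]
    unfolding x[symmetric] grad_inner_def d Q_def times_divide_eq_right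
    by (rule arg_cong2[where f = "(/)", OF _ refl]) algebra
  show "0 \<le> Grad_inner (cutoff L) (cutoff L) x" unfolding eq using Q by simp
  have "?k\<^sup>2 * Q \<le> ?k\<^sup>2 * \<rho> x" using Q by (intro mult_left_mono) auto
  also have "\<dots> \<le> 9 / (L\<^sup>2 * (1 + \<rho> x))" by (rule cut'_bound[OF L]) simp
  finally show "Grad_inner (cutoff L) (cutoff L) x \<le> 36 / (L\<^sup>2 * (1 + \<rho> x))" unfolding eq by simp
  show "L \<le> ln (1 + \<rho> x) \<Longrightarrow> Grad_inner (cutoff L) (cutoff L) x = 0"
    unfolding eq using cut_zero[OF L, of "\<rho> x"] by simp
qed

lemma Grad_product:
  assumes f: "surface_C1 f" and w: "surface_C1 w" and x: "x \<in> points \<A>"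
  shows "Grad_inner (\<lambda>x. f x * w x) (\<lambda>x. f x * w x) x
    = Grad_inner (\<lambda>x. f x * f x * w x) w x + (w x)\<^sup>2 * Grad_inner f f x"
proof -
  obtain U \<phi> p where c: "(U, \<phi>) \<in> \<A>" "p \<in> U" and x: "x = \<phi> p" using x points_chart by blast
  note U = chart_hopen[OF c(1)]
  note fw = surface_C1_mult[OF f w] and ff = surface_C1_mult[OF f f]
  note ffw = surface_C1_mult[OF ff w]
  have 1: "D_half (\<lambda>q. f (\<phi> q) * w (\<phi> q)) p a = f (\<phi> p) * D_half (\<lambda>q. w (\<phi> q)) p a + D_half (\<lambda>q. f (\<phi> q)) p a * w (\<phi> p)" for a
    using D_half_mult[OF U surface_C1D[OF f c(1)] surface_C1D[OF w c(1)] c(2)] by simp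
  have 2: "D_half (\<lambda>q. f (\<phi> q) * f (\<phi> q) * w (\<phi> q)) p a = f (\<phi> p) * f (\<phi> p) * D_half (\<lambda>q. w (\<phi> q)) p a
      + 2 * f (\<phi> p) * D_half (\<lambda>q. f (\<phi> q)) p a * w (\<phi> p)" for a
    using D_half_mult[OF U surface_C1D[OF ff c(1)] surface_C1D[OF w c(1)] c(2)]
      D_half_mult[OF U surface_C1D[OF f c(1)] surface_C1D[OF f c(1)] c(2)] by (simp add: algebra_simps)
  show ?thesis
    unfolding x Grad_inner_chart[OF fw fw c] Grad_inner_chart[OF ffw w c] Grad_inner_chart[OF f f c] grad_inner_def 1 2
      times_divide_eq_right add_divide_distrib[symmetric]
    by (rule arg_cong2[where f = "(/)", OF _ refl]) algebra
qed

text \<open>Because \<open>\<partial>w/\<partial>\<eta> = Q w\<close>, the boundary terms of Green's formula for \<open>\<zeta> w, \<zeta> w\<close> and for \<open>\<zeta>\<^sup>2 w, w\<close> are exactly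
  the two boundary terms of the stability form. What remains of stability are the gradient term
  \<open>w\<^sup>2 |\<nabla>\<zeta>|\<^sup>2\<close> and the potential term \<open>\<zeta>\<^sup>2 w (\<Delta>w + |A|\<^sup>2 w) = \<zeta>\<^sup>2 w |A|\<^sup>2\<close>.\<close>

lemma stability_weighted:
  assumes stable: "capillary_stable \<theta> \<A> F \<nu>" and proper: "properly_immersed \<A> F" and L: "0 < L"
  shows "integrable (area_measure \<A> F) (\<lambda>x. (cutoff L x)\<^sup>2 * (weight x * A_norm_sq \<A> F \<nu> x))"
    "integrable (area_measure \<A> F) (\<lambda>x. (weight x)\<^sup>2 * Grad_inner (cutoff L) (cutoff L) x)"
    "(\<integral>x. (cutoff L x)\<^sup>2 * (weight x * A_norm_sq \<A> F \<nu> x) \<partial>area_measure \<A> F)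
      \<le> (\<integral>x. (weight x)\<^sup>2 * Grad_inner (cutoff L) (cutoff L) x \<partial>area_measure \<A> F)"
proof -
  let ?\<mu> = "area_measure \<A> F" and ?\<beta> = "bdry_measure \<A> F" and ?A = "A_norm_sq \<A> F \<nu>"
  let ?f = "\<lambda>x. cutoff L x * weight x" and ?g = "\<lambda>x. cutoff L x * cutoff L x * weight x"
  let ?df = "conormal_deriv \<A> F ?f" and ?dw = "conormal_deriv \<A> F weight"
  define C where "C = {x \<in> points \<A>. F x \<in> cball 0 (sqrt (exp L))}"
  have C: "compact C" "C \<subseteq> points \<A>" using proper compact_cball unfolding C_def properly_immersed_def by blast+
  have sp: "space ?\<mu> = points \<A>" "space ?\<beta> = points \<A>"
    by (simp_all add: area_measure_eq area.space_glued bdry_measure_eq edge.space_glued)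
  note c1 = cutoff_C1[OF L] and w1 = surface_C2_C1[OF weight_C2]
  have Ck: "Ck_fun 2 \<A> ?f" by (rule test_Ck[OF L])
  have f2: "surface_C2 ?f" by (rule Ck_surface_C2[OF Ck])
  note f1 = surface_C2_C1[OF f2]
  have g1: "surface_C1 ?g" by (rule surface_C1_mult[OF surface_C1_mult[OF c1 c1] w1])
  have van: "vanishes_off (cutoff L) C" unfolding C_def by (rule cutoff_vanishes[OF L])
  have vf: "vanishes_off ?f C" by (rule vanishes_off_mult[OF van])
  have vg: "vanishes_off ?g C" using vanishes_off_mult[OF van, of "\<lambda>x. cutoff L x * weight x"] by (simp add: mult.assoc)
  note Gf = green[OF f1 C vf f2 conormal_data_deriv[OF f1]]
  note Gw = green[OF g1 C vg weight_C2 conormal_data_deriv[OF w1]]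
  have iA: "integrable ?\<mu> (\<lambda>x. ?f x * (?A x * ?f x))"
    by (rule integrable_area_compact[OF f1 surface_cont_mult[OF A_norm_sq_cont surface_C1_cont[OF f1]] C vf])
  show iM: "integrable ?\<mu> (\<lambda>x. (cutoff L x)\<^sup>2 * (weight x * ?A x))"
    using integrable_area_compact[OF g1 A_norm_sq_cont C vg] by (simp add: power2_eq_square mult.assoc)
  have GP: "(weight x)\<^sup>2 * Grad_inner (cutoff L) (cutoff L) x = Grad_inner ?f ?f x - Grad_inner ?g weight x"
    if "x \<in> space ?\<mu>" for x using Grad_product[OF c1 w1, of x] that sp by simp
  have iG: "integrable ?\<mu> (\<lambda>x. Grad_inner ?f ?f x - Grad_inner ?g weight x)"
    by (rule Bochner_Integration.integrable_diff) (use Gf Gw in blast)+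
  show "integrable ?\<mu> (\<lambda>x. (weight x)\<^sup>2 * Grad_inner (cutoff L) (cutoff L) x)"
    using iG by (subst Bochner_Integration.integrable_cong[OF refl GP])
  have "compactly_supported \<A> ?f"
    unfolding compactly_supported_def using C vf by (auto simp: vanishes_off_def)
  then have "0 \<le> - (LINT x|?\<mu>. ?f x * Laplacian \<A> F ?f x + ?A x * (?f x)\<^sup>2)
     + (LINT x:bdry \<A>|?\<beta>. ?f x * (?df x - (- cot \<theta> * A_conormal \<A> F \<nu> x) * ?f x))"
    using stable Ck unfolding capillary_stable_def Let_def by blast
  also have "(LINT x|?\<mu>. ?f x * Laplacian \<A> F ?f x + ?A x * (?f x)\<^sup>2)
     = (LINT x|?\<mu>. ?f x * Laplacian \<A> F ?f x) + (LINT x|?\<mu>. ?f x * (?A x * ?f x))"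
    using Gf iA by (subst Bochner_Integration.integral_add[symmetric]) (simp_all add: power2_eq_square mult_ac)
  also have "(LINT x:bdry \<A>|?\<beta>. ?f x * (?df x - (- cot \<theta> * A_conormal \<A> F \<nu> x) * ?f x))
     = (\<integral>x. indicator (bdry \<A>) x * (?f x * ?df x) - indicator (bdry \<A>) x * (?g x * ?dw x) \<partial>?\<beta>)"
    unfolding set_lebesgue_integral_def
  proof (intro Bochner_Integration.integral_cong refl)
    fix x
    show "indicator (bdry \<A>) x *\<^sub>R (?f x * (?df x - (- cot \<theta> * A_conormal \<A> F \<nu> x) * ?f x))
      = indicator (bdry \<A>) x * (?f x * ?df x) - indicator (bdry \<A>) x * (?g x * ?dw x)"
    proof (cases "x \<in> bdry \<A>")
      case True
      then show ?thesis using conormal_deriv_weight[OF True] by (simp add: algebra_simps)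
    qed simp
  qed
  also have "\<dots> = (\<integral>x. indicator (bdry \<A>) x * (?f x * ?df x) \<partial>?\<beta>) - (\<integral>x. indicator (bdry \<A>) x * (?g x * ?dw x) \<partial>?\<beta>)"
    using Gf Gw by (intro Bochner_Integration.integral_diff) blast+
  finally have S: "0 \<le> (LINT x|?\<mu>. Grad_inner ?f ?f x) - (LINT x|?\<mu>. Grad_inner ?g weight x)
      - (LINT x|?\<mu>. ?f x * (?A x * ?f x)) - (LINT x|?\<mu>. ?g x * Laplacian \<A> F weight x)"
    using Gf Gw by linarith
  have "(LINT x|?\<mu>. ?f x * (?A x * ?f x)) + (LINT x|?\<mu>. ?g x * Laplacian \<A> F weight x)
    = (LINT x|?\<mu>. ?f x * (?A x * ?f x) + ?g x * Laplacian \<A> F weight x)"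
    using iA Gw by (intro Bochner_Integration.integral_add[symmetric]) blast+
  also have "\<dots> = (LINT x|?\<mu>. (cutoff L x)\<^sup>2 * (weight x * ?A x))"
  proof (intro Bochner_Integration.integral_cong refl)
    fix x assume "x \<in> space ?\<mu>"
    then have A: "?A x = Laplacian \<A> F weight x + ?A x * weight x" using Laplacian_weight sp by simp
    have "(cutoff L x)\<^sup>2 * (weight x * ?A x) = (cutoff L x)\<^sup>2 * (weight x * (Laplacian \<A> F weight x + ?A x * weight x))"
      using A by (rule arg_cong)
    then show "?f x * (?A x * ?f x) + ?g x * Laplacian \<A> F weight x = (cutoff L x)\<^sup>2 * (weight x * ?A x)"
      by (simp add: power2_eq_square algebra_simps)
  qed
  finally have e1: "(LINT x|?\<mu>. ?f x * (?A x * ?f x)) + (LINT x|?\<mu>. ?g x * Laplacian \<A> F weight x)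
     = (LINT x|?\<mu>. (cutoff L x)\<^sup>2 * (weight x * ?A x))" .
  have "(LINT x|?\<mu>. (weight x)\<^sup>2 * Grad_inner (cutoff L) (cutoff L) x)
    = (LINT x|?\<mu>. Grad_inner ?f ?f x - Grad_inner ?g weight x)"
    by (rule Bochner_Integration.integral_cong[OF refl GP])
  also have "\<dots> = (LINT x|?\<mu>. Grad_inner ?f ?f x) - (LINT x|?\<mu>. Grad_inner ?g weight x)"
    using Gf Gw by (intro Bochner_Integration.integral_diff) blast+
  finally show "(\<integral>x. (cutoff L x)\<^sup>2 * (weight x * ?A x) \<partial>?\<mu>) \<le> (\<integral>x. (weight x)\<^sup>2 * Grad_inner (cutoff L) (cutoff L) x \<partial>?\<mu>)"
    using S e1 by linarith
qed

section \<open>Area growth\<close>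

text \<open>With \<open>L = K ln 2\<close> the cutoff is supported where \<open>1 + |F|\<^sup>2 \<le> 2\<^sup>K\<close>. Each of the \<open>K\<close> dyadic scales
  contributes at most \<open>2\<^sup>-\<^sup>k C 2\<^sup>k\<^sup>+\<^sup>1 = 2 C\<close> to the sum, while the factor in front of it is of order
  \<open>1/K\<^sup>2\<close>.\<close>

lemma cutoff_energy:
  assumes C: "0 < C" and growth: "\<And>r. 0 < r \<Longrightarrow> emeasure (area_measure \<A> F) {x \<in> points \<A>. F x \<in> ball 0 r} < ennreal (C * r\<^sup>2)"
    and K: "0 < K" and int: "integrable (area_measure \<A> F) (\<lambda>x. (weight x)\<^sup>2 * Grad_inner (cutoff (real K * ln 2)) (cutoff (real K * ln 2)) x)"
  shows "(\<integral>x. (weight x)\<^sup>2 * Grad_inner (cutoff (real K * ln 2)) (cutoff (real K * ln 2)) x \<partial>area_measure \<A> F)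
     \<le> 288 * C / (ln 2)\<^sup>2 / real K"
proof -
  let ?\<mu> = "area_measure \<A> F"
  define L where "L = real K * ln 2"
  have L: "0 < L" using K by (simp add: L_def)
  define B where "B k = {x \<in> points \<A>. F x \<in> ball 0 (sqrt (2 ^ Suc k))}" for k :: nat
  have sp: "space ?\<mu> = points \<A>" by (simp add: area_measure_eq area.space_glued)
  have BB: "x \<in> B k \<longleftrightarrow> \<rho> x < 2 ^ Suc k" if "x \<in> points \<A>" for x k
    using that by (simp add: B_def \<rho>_def norm_eq_sqrt_inner real_sqrt_less_iff del: power_Suc)
  have growth': "emeasure ?\<mu> (B k) < ennreal (C * 2 ^ Suc k)" for k
    using growth[of "sqrt (2 ^ Suc k)"] by (simp add: B_def del: power_Suc)
  have F: "F \<in> borel_measurable ?\<mu>"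
  proof -
    have "F \<in> borel_measurable (restrict_space borel (points \<A>))"
    proof (rule surface_measurable)
      show "continuous_on U (\<lambda>q. F (\<phi> q))" if "(U, \<phi>) \<in> \<A>" for U \<phi>
        by (rule C1_on_cont[OF minimal_chart.X1[OF minimal_chart[OF that]] openin_imp_subset[OF chart_hopen[OF that]]])
    qed
    then show ?thesis unfolding area_measure_eq using area.sets_glued by (simp cong: measurable_cong_sets)
  qed
  have Bs: "B k \<in> sets ?\<mu>" for k
  proof -
    have "F -` ball 0 (sqrt (2 ^ Suc k)) \<inter> space ?\<mu> \<in> sets ?\<mu>" by (rule measurable_sets[OF F]) simp
    moreover have "F -` ball 0 (sqrt (2 ^ Suc k)) \<inter> space ?\<mu> = B k" by (auto simp: B_def sp)
    ultimately show ?thesis by simp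
  qed
  have Bfin: "emeasure ?\<mu> (B k) < \<infinity>" for k by (rule order_less_trans[OF growth']) simp
  have iB: "integrable ?\<mu> (indicator (B k) :: 'a \<Rightarrow> real)" for k
    by (rule integrable_real_indicator) (use Bs Bfin in auto)
  have mB: "measure ?\<mu> (B k) \<le> C * 2 ^ Suc k" for k
    unfolding measure_def using growth'[of k] C by (intro enn2real_leI) auto
  have "(\<integral>x. (weight x)\<^sup>2 * Grad_inner (cutoff L) (cutoff L) x \<partial>?\<mu>)
      \<le> (\<integral>x. 144 / L\<^sup>2 * (\<Sum>k<K. (1/2) ^ k * indicator (B k) x) \<partial>?\<mu>)"
  proof (rule integral_mono)
    show "integrable ?\<mu> (\<lambda>x. (weight x)\<^sup>2 * Grad_inner (cutoff L) (cutoff L) x)" using int by (simp add: L_def)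
    show "integrable ?\<mu> (\<lambda>x. 144 / L\<^sup>2 * (\<Sum>k<K. (1/2) ^ k * indicator (B k) x))"
      by (intro integrable_mult_right Bochner_Integration.integrable_sum iB)
    fix x assume "x \<in> space ?\<mu>"
    then have x: "x \<in> points \<A>" using sp by simp
    have s0: "0 \<le> (\<Sum>k<K. (1/2) ^ k * indicator (B k) x :: real)" by (intro sum_nonneg) auto
    have w: "0 \<le> weight x" "weight x \<le> 2" using weight_bounds[OF x] abs_cos_less by auto
    \<comment> \<open>the constant 144 is 4 from \<open>w\<^sup>2 \<le> 4\<close> times 36 from the bound on the gradient of the cutoff\<close>
    then have w4: "(weight x)\<^sup>2 \<le> 4" using power_mono[of "weight x" 2 2] by simp
    show "(weight x)\<^sup>2 * Grad_inner (cutoff L) (cutoff L) x \<le> 144 / L\<^sup>2 * (\<Sum>k<K. (1/2) ^ k * indicator (B k) x)"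
    proof (cases "L \<le> ln (1 + \<rho> x)")
      case True
      then show ?thesis using Grad_cutoff(3)[OF L x] s0 by simp
    next
      case False
      then have "ln (1 + \<rho> x) < ln (2 ^ K)" by (simp add: L_def ln_realpow)
      then have "1 + \<rho> x < 2 ^ K" by (subst (asm) ln_less_cancel_iff) (auto simp: add_pos_nonneg)
      from dyadic_bound[OF \<rho>_nonneg this]
      have db: "1 / (1 + \<rho> x) \<le> (\<Sum>k<K. (1/2) ^ k * indicator (B k) x)"
        using BB[OF x] by (simp add: indicator_def del: power_Suc)
      have "(weight x)\<^sup>2 * Grad_inner (cutoff L) (cutoff L) x \<le> 4 * (36 / (L\<^sup>2 * (1 + \<rho> x)))"
        by (intro mult_mono w4 Grad_cutoff(1,2)[OF L x]) auto
      also have "\<dots> = 144 / L\<^sup>2 * (1 / (1 + \<rho> x))" by simp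
      also have "\<dots> \<le> 144 / L\<^sup>2 * (\<Sum>k<K. (1/2) ^ k * indicator (B k) x)" using db by (intro mult_left_mono) auto
      finally show ?thesis .
    qed
  qed
  also have "\<dots> = 144 / L\<^sup>2 * (\<Sum>k<K. (1/2) ^ k * measure ?\<mu> (B k))"
  proof -
    have "(\<integral>x. (\<Sum>k<K. (1/2::real) ^ k * indicator (B k) x) \<partial>?\<mu>) = (\<Sum>k<K. \<integral>x. (1/2) ^ k * indicator (B k) x \<partial>?\<mu>)"
      by (rule Bochner_Integration.integral_sum) (intro integrable_mult_right iB)
    also have "\<dots> = (\<Sum>k<K. (1/2) ^ k * measure ?\<mu> (B k))"
      by (intro sum.cong refl) (simp add: Int_absorb2 sets.sets_into_space[OF Bs])
    finally show ?thesis by (simp only: integral_mult_right_zero)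
  qed
  also have "\<dots> \<le> 144 / L\<^sup>2 * (\<Sum>k<K. (1/2) ^ k * (C * 2 ^ Suc k))"
    using mB by (intro mult_left_mono sum_mono) auto
  also have "(\<Sum>k<K. (1/2::real) ^ k * (C * 2 ^ Suc k)) = (\<Sum>k<K. 2 * C)"
    by (intro sum.cong refl) (simp add: power_one_over field_simps)
  also have "144 / L\<^sup>2 * (\<Sum>k<K. 2 * C) = 288 * C / (ln 2)\<^sup>2 / real K"
    using K by (simp add: L_def power_mult_distrib power2_eq_square field_simps)
  finally show ?thesis by (simp add: L_def)
qed

text \<open>The cutoffs tend to 1 uniformly on compact sets. Once they are at least \<open>1/8\<close> on the support of a
  bump, \<open>64\<close> times their square dominates the bump, so the integral of the bump times \<open>w |A|\<^sup>2\<close> is bounded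
  by a null sequence. Its integrand is continuous and nonnegative and hence vanishes.\<close>

lemma stable_imp_planar:
  assumes stable: "capillary_stable \<theta> \<A> F \<nu>" and proper: "properly_immersed \<A> F" and growth: "euclidean_area_growth \<A> F"
  shows "sff_vanishes \<A> F \<nu>"
proof -
  let ?\<mu> = "area_measure \<A> F" and ?A = "A_norm_sq \<A> F \<nu>"
  obtain C where C: "0 < C" "\<And>r. 0 < r \<Longrightarrow> emeasure ?\<mu> {x \<in> points \<A>. F x \<in> ball 0 r} < ennreal (C * r\<^sup>2)"
    using growth by (auto simp: euclidean_area_growth_def)
  have A0: "?A x = 0" if x: "x \<in> points \<A>" for x
  proof -
    obtain \<beta> U \<phi> S T where c: "(U, \<phi>) \<in> \<A>" and S: "compact S" "S \<subseteq> U" and \<beta>: "surface_C1 \<beta>" "vanishes_off \<beta> (\<phi> ` S)"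
      and T: "open T" "x \<in> T" "\<And>y. y \<in> points \<A> \<inter> T \<Longrightarrow> \<beta> y = 1" and \<beta>0: "\<And>y. 0 \<le> \<beta> y" "\<And>y. \<beta> y \<le> 1"
      by (rule bump_exists[OF x]) blast
    interpret M: minimal_chart U "\<lambda>q. F (\<phi> q)" "\<lambda>q. \<nu> (\<phi> q)" by (rule minimal_chart[OF c])
    have A_nonneg: "0 \<le> ?A y" if y: "y \<in> points \<A>" for y
    proof -
      obtain V \<psi> q where d: "(V, \<psi>) \<in> \<A>" "q \<in> V" "y = \<psi> q" using points_chart[OF y] by blast
      show ?thesis unfolding d(3) A_norm_sq_chart[OF d(1,2)] by (rule minimal_chart.sff_norm_sq_nonneg[OF minimal_chart[OF d(1)] d(2)])
    qed
    have w0: "0 < weight y" if "y \<in> points \<A>" for y using weight_bounds(1)[OF that] abs_cos_less by linarith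
    have sp: "space ?\<mu> = points \<A>" by (simp add: area_measure_eq area.space_glued)
    let ?h = "\<lambda>y. \<beta> y * (weight y * ?A y)"
    note wA = surface_cont_mult[OF surface_C1_cont[OF surface_C2_C1[OF weight_C2]] A_norm_sq_cont]
    have hc: "surface_cont ?h" by (rule surface_cont_mult[OF surface_C1_cont[OF \<beta>(1)] wA])
    have hv: "vanishes_off ?h (\<phi> ` S)" by (rule vanishes_off_mult[OF \<beta>(2)])
    have hi: "integrable ?\<mu> ?h" by (rule integrable_area_local[OF c S hc hv])
    have h0: "0 \<le> ?h y" if "y \<in> points \<A>" for y using \<beta>0(1)[of y] w0[OF that] A_nonneg[OF that] by simp
    have "continuous_on S (\<lambda>p. ln (1 + \<rho> (\<phi> p)))"
      by (intro continuous_intros continuous_on_subset[OF surface_contD[OF surface_C1_cont[OF \<rho>_C1] c] S(2)])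
         (auto simp: add_nonneg_eq_0_iff)
    then have "bounded ((\<lambda>p. ln (1 + \<rho> (\<phi> p))) ` S)"
      by (intro compact_imp_bounded compact_continuous_image S)
    then obtain b where b: "\<And>p. p \<in> S \<Longrightarrow> ln (1 + \<rho> (\<phi> p)) \<le> b" by (auto simp: bounded_iff abs_le_iff)
    obtain K0 :: nat where K0: "2 * b / ln 2 < real K0" using reals_Archimedean2 by blast
    have bound: "(\<integral>y. ?h y \<partial>?\<mu>) \<le> 64 * (288 * C / (ln 2)\<^sup>2 / real K)" if K: "K0 < K" "0 < K" for K
    proof -
      define L where "L = real K * ln 2"
      have L: "0 < L" using K by (simp add: L_def)
      note st = stability_weighted[OF stable proper L]
      have "2 * b / ln 2 < real K" using K0 K by linarith
      then have Lb: "2 * b < L" by (simp add: L_def field_simps)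
      have cut8: "1/8 \<le> cutoff L (\<phi> p)" if "p \<in> S" for p
      proof -
        have "ln (1 + \<rho> (\<phi> p)) / L \<le> 1/2" using b[OF that] Lb L by (simp add: field_simps)
        then have "1/2 \<le> 1 - ln (1 + \<rho> (\<phi> p)) / L" by linarith
        also have "\<dots> \<le> max 0 (1 - ln (1 + \<rho> (\<phi> p)) / L)" by simp
        finally have "(1/2) ^ 3 \<le> max 0 (1 - ln (1 + \<rho> (\<phi> p)) / L) ^ 3" by (rule power_mono) simp
        then show ?thesis by (simp add: cutoff_def cut_def power3_eq_cube)
      qed
      have "(\<integral>y. ?h y \<partial>?\<mu>) \<le> (\<integral>y. 64 * ((cutoff L y)\<^sup>2 * (weight y * ?A y)) \<partial>?\<mu>)"
      proof (rule integral_mono[OF hi])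
        show "integrable ?\<mu> (\<lambda>y. 64 * ((cutoff L y)\<^sup>2 * (weight y * ?A y)))" using st(1) by simp
        fix y assume "y \<in> space ?\<mu>"
        then have y: "y \<in> points \<A>" using sp by simp
        have wA0: "0 \<le> weight y * ?A y" using w0[OF y] A_nonneg[OF y] by simp
        show "?h y \<le> 64 * ((cutoff L y)\<^sup>2 * (weight y * ?A y))"
        proof (cases "y \<in> \<phi> ` S")
          case True
          then have "1/8 \<le> cutoff L y" using cut8 by auto
          then have "(1/8)\<^sup>2 \<le> (cutoff L y)\<^sup>2" by (intro power_mono) auto
          then have "\<beta> y \<le> 64 * (cutoff L y)\<^sup>2" using \<beta>0(2)[of y] by (simp add: power2_eq_square)
          from mult_right_mono[OF this wA0] show ?thesis by (simp add: mult.assoc)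
        next
          case False
          then have "?h y = 0" using hv y by (simp add: vanishes_off_def)
          then show ?thesis using mult_nonneg_nonneg[OF zero_le_power2[of "cutoff L y"] wA0] by linarith
        qed
      qed
      also have "\<dots> = 64 * (\<integral>y. (cutoff L y)\<^sup>2 * (weight y * ?A y) \<partial>?\<mu>)" by simp
      also have "\<dots> \<le> 64 * (288 * C / (ln 2)\<^sup>2 / real K)"
        using st(3) cutoff_energy[OF C(1) C(2) K(2) st(2)[unfolded L_def]] by (simp add: L_def)
      finally show ?thesis .
    qed
    have lim: "(\<lambda>K. 64 * (288 * C / (ln 2)\<^sup>2 / real K)) \<longlonglongrightarrow> 0"
      by (intro tendsto_mult_right_zero lim_const_over_n)
    have "(\<integral>y. ?h y \<partial>?\<mu>) \<le> 0"
    proof (rule LIMSEQ_le_const[OF lim], intro exI allI impI)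
      fix K assume "Suc K0 \<le> K" then show "(\<integral>y. ?h y \<partial>?\<mu>) \<le> 64 * (288 * C / (ln 2)\<^sup>2 / real K)"
        by (intro bound) auto
    qed
    moreover have "0 \<le> (\<integral>y. ?h y \<partial>?\<mu>)" by (rule Bochner_Integration.integral_nonneg) (use h0 sp in blast)
    ultimately have z: "(\<integral>y. ?h y \<partial>?\<mu>) = 0" by simp
    have hv0: "?h y = 0" if "y \<in> points \<A> - \<phi> ` U" for y
      using hv that S(2) unfolding vanishes_off_def by blast
    note ch = area.integral_chart[OF c surface_cont_measurable[OF hc] hv0, folded area_measure_eq, unfolded fst_conv snd_conv]
      area.integrable_chart[OF c surface_cont_measurable[OF hc] hv0, folded area_measure_eq, unfolded fst_conv snd_conv]
    have xU: "x \<in> \<phi> ` S"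
    proof (rule ccontr)
      assume "x \<notin> \<phi> ` S"
      then have "\<beta> x = 0" using \<beta>(2) x by (simp add: vanishes_off_def)
      then show False using T(2,3) x by force
    qed
    then obtain p where p: "p \<in> U" "x = \<phi> p" using S(2) by blast
    have "density_area (U, \<phi>) p * ?h (\<phi> p) = 0"
    proof (rule continuous_integral_zero[OF M.U _ _ _ _ p(1)])
      show "continuous_on U (\<lambda>p. density_area (U, \<phi>) p * ?h (\<phi> p))"
        by (rule continuous_on_mult[OF density_area_cont[OF c] surface_contD[OF hc c]])
      show "0 \<le> density_area (U, \<phi>) q * ?h (\<phi> q)" if "q \<in> U" for q
        using density_area_pos[OF c that] h0[OF chart_in_points[OF c that]] by simp
      show "integrable lborel (\<lambda>p. indicator U p * (density_area (U, \<phi>) p * ?h (\<phi> p)))" using ch(2) hi by simp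
      show "(\<integral>p. indicator U p * (density_area (U, \<phi>) p * ?h (\<phi> p)) \<partial>lborel) = 0" using ch(1) z by simp
    qed
    moreover have "\<beta> x = 1" using T x by simp
    ultimately show ?thesis using density_area_pos[OF c p(1)] w0[OF x] p(2) by simp
  qed
  show ?thesis
    unfolding sff_vanishes_def
  proof (clarify)
    fix U \<phi> p a b assume c: "(U, \<phi>) \<in> \<A>" "p \<in> U"
    show "sff (\<lambda>q. F (\<phi> q)) (\<lambda>q. \<nu> (\<phi> q)) p a b = 0"
      by (rule minimal_chart.sff_norm_sq_zero[OF minimal_chart[OF c(1)] c(2)])
         (use A0[OF chart_in_points[OF c]] A_norm_sq_chart[OF c] in simp)
  qed
qed

end

theorem theorem0p2:
  fixes \<A> :: "'a::{t2_space, second_countable_topology} param set"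
    and F :: "'a \<Rightarrow> real ^ 3"
    and \<nu> :: "'a \<Rightarrow> real ^ 3"
    and \<theta> :: real
  assumes "0 < \<theta>" and "\<theta> < pi"
    and "capillary_minimal_surface \<theta> \<A> F \<nu>"
    and "properly_immersed \<A> F"
    and "euclidean_area_growth \<A> F"
    and "capillary_stable \<theta> \<A> F \<nu>"
  shows "sff_vanishes \<A> F \<nu>"
proof -
  interpret capillary_surface \<A> F \<nu> \<theta>
    by unfold_locales (use assms(1-3) in \<open>auto simp: capillary_minimal_surface_def\<close>)
  show ?thesis by (rule stable_imp_planar[OF assms(6,4,5)])
qed

end
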